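(* Let $\Sigma$ be a closed orientable surface of genus at least $2$. There is a representation $\theta$ of $\pi_1(\Sigma)$ into $\mathrm{Homeo}_+(\mathbb{R})$ without global fixed points, whose conjugacy class under $\mathrm{Homeo}_+(\mathbb{R})$, that is, the set of representations $g\mapsto \psi\,\theta(g)\,\psi^{-1}$ with $\psi\in\mathrm{Homeo}_+(\mathbb{R})$, is dense in $\mathrm{Rep}(\pi_1(\Sigma),\mathrm{Homeo}_+(\mathbb{R}))$.
   Context: $\mathrm{Homeo}_+(\mathbb{R})$ is the group of orientation preserving homeomorphisms of $\mathbb{R}$, with the compact-open topology (uniform convergence on compact sets). For a countable discrete group $G$, $\mathrm{Rep}(G,\mathrm{Homeo}_+(\mathbb{R}))$ is the set of group homomorphisms $G\to\mathrm{Homeo}_+(\mathbb{R})$ with the topology of pointwise convergence: $\rho_n\to\rho$ iff $\rho_n(g)\to\rho(g)$ in the compact-open topology for every $g\in G$. A global fixed point of $\rho$ is a point $x\in\mathbb{R}$ with $\rho(g)(x)=x$ for all $g\in G$. *)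

theory Defs
  imports "HOL-Analysis.Analysis" "HOL-Algebra.Group"
begin

section \<open>Closed orientable surfaces\<close>

text \<open>The unit disc is viewed as a polygon with \<open>4g\<close> sides: the real number \<open>s\<close> in
  \<open>[i, i + 1]\<close> names a point on the \<open>i\<close>-th side.\<close>

definition polygon_boundary :: "nat \<Rightarrow> real \<Rightarrow> complex" where
  "polygon_boundary g s = cis (2 * pi * s / (4 * real g))"

text \<open>Side \<open>4k\<close> is glued to side \<open>4k + 2\<close> and side \<open>4k + 1\<close> to side \<open>4k + 3\<close>, in each case with
  reversed direction; the boundary thus reads
  \<open>a\<^sub>1 b\<^sub>1 a\<^sub>1\<inverse> b\<^sub>1\<inverse> \<dots> a\<^sub>g b\<^sub>g a\<^sub>g\<inverse> b\<^sub>g\<inverse>\<close>.\<close>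

definition side_pairing :: "nat \<Rightarrow> complex \<Rightarrow> complex \<Rightarrow> bool" where
  "side_pairing g z w \<longleftrightarrow>
     (\<exists>k<g. \<exists>r\<in>{0, 1}. \<exists>t\<in>{0..1}.
        z = polygon_boundary g (4 * real k + r + t) \<and>
        w = polygon_boundary g (4 * real k + r + 2 + (1 - t)))"

text \<open>\<open>X\<close> is (a copy of) the closed orientable surface of genus \<open>g\<close>, for \<open>g \<ge> 1\<close>, if it is the
  quotient of the polygon by the equivalence relation generated by the side pairing.\<close>

definition closed_orientable_surface :: "nat \<Rightarrow> 'a topology \<Rightarrow> bool" where
  "closed_orientable_surface g X \<longleftrightarrow>
     (\<exists>q. quotient_map (top_of_set (cball 0 1)) X q \<and>
          (\<forall>z\<in>cball 0 1. \<forall>w\<in>cball 0 1.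
              q z = q w \<longleftrightarrow> equivclp (side_pairing g) z w))"

lemma closed_orientable_surface_homeomorphic:
  assumes "closed_orientable_surface g X" and "X homeomorphic_space Y"
  shows "closed_orientable_surface g Y"
proof -
  obtain q where q: "quotient_map (top_of_set (cball 0 1)) X q"
    "\<forall>z\<in>cball 0 1. \<forall>w\<in>cball 0 1. q z = q w \<longleftrightarrow> equivclp (side_pairing g) z w"
    using assms(1) unfolding closed_orientable_surface_def by blast
  obtain h where h: "homeomorphic_map X Y h"
    using assms(2) homeomorphic_space by blast
  have "q ` cball 0 1 = topspace X"
    using quotient_imp_surjective_map[OF q(1)] by simp
  moreover have "inj_on h (topspace X)"
    using h homeomorphic_imp_injective_map by blast
  ultimately have "(h \<circ> q) z = (h \<circ> q) w \<longleftrightarrow> q z = q w"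
    if "z \<in> cball 0 1" "w \<in> cball 0 1" for z w
    using that by (metis comp_apply image_eqI inj_on_eq_iff)
  moreover have "quotient_map (top_of_set (cball 0 1)) Y (h \<circ> q)"
    using q(1) h quotient_map_compose unfolding homeomorphic_map_def by blast
  ultimately show ?thesis
    unfolding closed_orientable_surface_def using q(2) by metis
qed


section \<open>The fundamental group\<close>

definition loops :: "'a topology \<Rightarrow> 'a \<Rightarrow> (real \<Rightarrow> 'a) set" where
  "loops X x = {p. pathin X p \<and> p 0 = x \<and> p 1 = x}"

definition loop_homotopy :: "'a topology \<Rightarrow> 'a \<Rightarrow> ((real \<Rightarrow> 'a) \<times> (real \<Rightarrow> 'a)) set" where
  "loop_homotopy X x =
     {(p, q). homotopic_with (\<lambda>h. h 0 = x \<and> h 1 = x) (top_of_set {0..1}) X p q}"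

text \<open>The library's \<^const>\<open>joinpaths\<close> is restricted to types of class
  \<^class>\<open>topological_space\<close>.\<close>

definition concat_paths :: "(real \<Rightarrow> 'a) \<Rightarrow> (real \<Rightarrow> 'a) \<Rightarrow> real \<Rightarrow> 'a" where
  "concat_paths p q = (\<lambda>t. if t \<le> 1/2 then p (2 * t) else q (2 * t - 1))"

definition fundamental_group :: "'a topology \<Rightarrow> 'a \<Rightarrow> (real \<Rightarrow> 'a) set monoid" where
  "fundamental_group X x =
     \<lparr> carrier = loops X x // loop_homotopy X x,
       mult = (\<lambda>A B. \<Union>p\<in>A. \<Union>q\<in>B. loop_homotopy X x `` {concat_paths p q}),
       one = loop_homotopy X x `` {\<lambda>_. x} \<rparr>"


section \<open>The group of orientation preserving homeomorphisms of the line\<close>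

definition Homeo_plus :: "(real \<Rightarrow> real) monoid" where
  "Homeo_plus =
     \<lparr> carrier = {f. homeomorphic_map euclideanreal euclideanreal f \<and> strict_mono f},
       mult = (\<circ>), one = id \<rparr>"

lemma group_Homeo_plus: "group Homeo_plus"
proof (rule groupI)
  fix f assume "f \<in> carrier Homeo_plus"
  then have f: "homeomorphic_map euclideanreal euclideanreal f" "strict_mono f"
    by (auto simp: Homeo_plus_def)
  then obtain h where h: "homeomorphic_maps euclideanreal euclideanreal f h"
    using homeomorphic_map_maps by blast
  then have inv: "h (f x) = x" "f (h x) = x" for x
    by (auto simp: homeomorphic_maps_def)
  have "strict_mono h"
    using f(2) inv(2) by (metis strict_monoI strict_mono_less)
  moreover have "homeomorphic_map euclideanreal euclideanreal h"
    using h homeomorphic_map_maps homeomorphic_maps_sym by blast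
  ultimately show "\<exists>h\<in>carrier Homeo_plus. h \<otimes>\<^bsub>Homeo_plus\<^esub> f = \<one>\<^bsub>Homeo_plus\<^esub>"
    using inv by (auto simp: Homeo_plus_def fun_eq_iff intro!: bexI[of _ h])
qed (auto simp: Homeo_plus_def comp_assoc strict_mono_o
       intro: homeomorphic_map_compose strict_monoI simp flip: id_def)

definition compact_open_Homeo_plus :: "(real \<Rightarrow> real) topology" where
  "compact_open_Homeo_plus =
     topology_generated_by
       {{f \<in> carrier Homeo_plus. f ` K \<subseteq> U} | K U. compact K \<and> open U}"

lemma topspace_compact_open_Homeo_plus [simp]:
  "topspace compact_open_Homeo_plus = carrier Homeo_plus"
proof -
  have "carrier Homeo_plus \<in>
      {{f \<in> carrier Homeo_plus. f ` K \<subseteq> U} | K U. compact K \<and> open U}"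
    by (rule CollectI, rule exI[of _ "{}"], rule exI[of _ UNIV]) auto
  then show ?thesis
    unfolding compact_open_Homeo_plus_def topology_generated_by_topspace by blast
qed


section \<open>Spaces of representations\<close>

text \<open>The product topology lives on functions that are \<^const>\<open>undefined\<close> outside
  \<^term>\<open>carrier G\<close>, so that homomorphisms agreeing on the group are identified.\<close>

definition Rep :: "('g, 'b) monoid_scheme \<Rightarrow> ('g \<Rightarrow> real \<Rightarrow> real) topology" where
  "Rep G = subtopology (product_topology (\<lambda>_. compact_open_Homeo_plus) (carrier G))
             (hom G Homeo_plus)"

lemma topspace_Rep: "topspace (Rep G) = hom G Homeo_plus \<inter> extensional (carrier G)"
  by (auto simp: Rep_def topspace_product_topology PiE_def hom_def)

definition global_fixed_point ::
    "('g, 'b) monoid_scheme \<Rightarrow> ('g \<Rightarrow> real \<Rightarrow> real) \<Rightarrow> real \<Rightarrow> bool" where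
  "global_fixed_point G \<rho> x \<longleftrightarrow> (\<forall>a\<in>carrier G. \<rho> a x = x)"

definition conjugacy_class ::
    "('g, 'b) monoid_scheme \<Rightarrow> ('g \<Rightarrow> real \<Rightarrow> real) \<Rightarrow> ('g \<Rightarrow> real \<Rightarrow> real) set" where
  "conjugacy_class G \<rho> =
     {\<lambda>a\<in>carrier G. \<psi> \<circ> \<rho> a \<circ> inv_into UNIV \<psi> | \<psi>. \<psi> \<in> carrier Homeo_plus}"

end

theory Submission
  imports Defs
begin

unbundle no m_inv_syntax

(* Dyn1 *)




abbreviation Homeos :: "(real \<Rightarrow> real) set" where "Homeos \<equiv> carrier Homeo_plus"

lemma strict_mono_surj_continuous:
  fixes f :: "real \<Rightarrow> real"
  assumes "strict_mono f" "surj f"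
  shows "continuous_on UNIV f"
  using assms by (intro continuous_onI_mono) (auto simp: strict_mono_less_eq)

lemma strict_mono_surj_inv:
  fixes f :: "real \<Rightarrow> real"
  assumes "strict_mono f" "surj f"
  shows "strict_mono (inv f)" "surj (inv f)"
proof -
  have i: "inj f" using assms(1) by (rule strict_mono_imp_inj_on)
  show "strict_mono (inv f)"
    using assms by (intro strict_monoI) (metis surj_f_inv_f strict_mono_less)
  show "surj (inv f)" using i by (rule inj_imp_surj_inv)
qed

lemma Homeos_iff: "f \<in> Homeos \<longleftrightarrow> strict_mono f \<and> surj f"
proof
  assume "f \<in> Homeos"
  then show "strict_mono f \<and> surj f"
    using homeomorphic_imp_surjective_map by (force simp: Homeo_plus_def)
next
  assume f: "strict_mono f \<and> surj f"
  then have i: "inj f" using strict_mono_imp_inj_on by blast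
  have "homeomorphic_maps euclideanreal euclideanreal f (inv f)"
    unfolding homeomorphic_maps_def
    using f i strict_mono_surj_continuous[of f] strict_mono_surj_continuous[of "inv f"]
      strict_mono_surj_inv[of f]
    by (auto simp: surj_f_inv_f)
  then show "f \<in> Homeos"
    using f homeomorphic_map_maps by (auto simp: Homeo_plus_def)
qed

lemma HomeosI: "\<lbrakk>\<And>x y. x < y \<Longrightarrow> f x < f y; \<And>y. \<exists>x. f x = y\<rbrakk> \<Longrightarrow> f \<in> Homeos"
  unfolding Homeos_iff by (metis strict_monoI surjI surj_def)

lemma Homeos_less: "f \<in> Homeos \<Longrightarrow> f x < f y \<longleftrightarrow> x < y"
  by (simp add: Homeos_iff strict_mono_less)

lemma Homeos_le: "f \<in> Homeos \<Longrightarrow> f x \<le> f y \<longleftrightarrow> x \<le> y"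
  by (simp add: Homeos_iff strict_mono_less_eq)

lemma Homeos_eq: "f \<in> Homeos \<Longrightarrow> f x = f y \<longleftrightarrow> x = y"
  by (simp add: Homeos_iff strict_mono_eq)

lemmas Homeos_order = Homeos_less Homeos_le Homeos_eq

lemma Homeos_inv_left [simp]: "f \<in> Homeos \<Longrightarrow> inv f (f x) = x"
  by (simp add: Homeos_iff strict_mono_imp_inj_on)

lemma Homeos_inv_right [simp]: "f \<in> Homeos \<Longrightarrow> f (inv f x) = x"
  by (simp add: Homeos_iff surj_f_inv_f)

lemma Homeos_inv [simp, intro]: "f \<in> Homeos \<Longrightarrow> inv f \<in> Homeos"
  by (simp add: Homeos_iff strict_mono_surj_inv)

lemma Homeos_comp [simp, intro]: "\<lbrakk>f \<in> Homeos; h \<in> Homeos\<rbrakk> \<Longrightarrow> f \<circ> h \<in> Homeos"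
  unfolding Homeos_iff by (metis comp_surj strict_mono_o)

lemma Homeos_id [simp, intro]: "id \<in> Homeos" "(\<lambda>x. x) \<in> Homeos"
  by (auto simp: Homeos_iff strict_mono_def)

lemma Homeos_funpow [simp, intro]: "f \<in> Homeos \<Longrightarrow> f ^^ n \<in> Homeos"
  by (induction n) auto

lemma Homeos_inv_inv [simp]: "f \<in> Homeos \<Longrightarrow> inv (inv f) = f"
  by (simp add: Homeos_iff bij_def inv_inv_eq strict_mono_imp_inj_on)

lemma Homeos_inv_eq_iff: "f \<in> Homeos \<Longrightarrow> inv f x = y \<longleftrightarrow> x = f y"
  by (metis Homeos_inv_left Homeos_inv_right)

lemma Homeos_inv_less_iff: "f \<in> Homeos \<Longrightarrow> inv f x < y \<longleftrightarrow> x < f y"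
  by (metis Homeos_inv_right Homeos_less)

lemma Homeos_less_inv_iff: "f \<in> Homeos \<Longrightarrow> y < inv f x \<longleftrightarrow> f y < x"
  by (metis Homeos_inv_right Homeos_less)

lemma Homeos_inv_le_iff: "f \<in> Homeos \<Longrightarrow> inv f x \<le> y \<longleftrightarrow> x \<le> f y"
  by (metis Homeos_inv_right Homeos_le)

lemma Homeos_le_inv_iff: "f \<in> Homeos \<Longrightarrow> y \<le> inv f x \<longleftrightarrow> f y \<le> x"
  by (metis Homeos_inv_right Homeos_le)

lemma Homeos_inv_comp: "\<lbrakk>f \<in> Homeos; h \<in> Homeos\<rbrakk> \<Longrightarrow> inv (f \<circ> h) = inv h \<circ> inv f"
  by (rule o_inv_distrib) (auto simp: Homeos_iff bij_def strict_mono_imp_inj_on)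

lemma Homeos_isCont [simp]: "f \<in> Homeos \<Longrightarrow> isCont f x"
  using strict_mono_surj_continuous[of f] by (simp add: Homeos_iff continuous_on_eq_continuous_at)

lemma Homeos_continuous_on: "f \<in> Homeos \<Longrightarrow> continuous_on A f"
  by (simp add: continuous_at_imp_continuous_on)

lemma Homeos_glue:
  assumes f: "f \<in> Homeos" and h: "h \<in> Homeos" and eq: "f s = h s"
  shows "(\<lambda>x. if x \<le> s then f x else h x) \<in> Homeos"
proof (rule HomeosI)
  fix x y :: real assume "x < y"
  then show "(if x \<le> s then f x else h x) < (if y \<le> s then f y else h y)"
    using f h eq by (smt (verit) Homeos_less)
next
  fix y
  show "\<exists>x. (if x \<le> s then f x else h x) = y"
  proof (cases "y \<le> f s")
    case True
    then show ?thesis using f by (intro exI[of _ "inv f y"]) (simp add: Homeos_inv_le_iff)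
  next
    case False
    then show ?thesis using h eq by (intro exI[of _ "inv h y"]) (simp add: Homeos_inv_le_iff)
  qed
qed

lemma Homeos_add: "f \<in> Homeos \<Longrightarrow> (\<lambda>x. f x + c) \<in> Homeos"
proof (rule HomeosI)
  show "\<exists>x. f x + c = y" if "f \<in> Homeos" for y
    using that by (intro exI[of _ "inv f (y - c)"]) simp
qed (simp add: Homeos_order)

lemma Homeos_max:
  assumes f: "f \<in> Homeos" and h: "h \<in> Homeos"
  shows "(\<lambda>x. max (f x) (h x)) \<in> Homeos"
proof (rule HomeosI)
  fix x y :: real assume "x < y"
  then show "max (f x) (h x) < max (f y) (h y)"
    using f h by (smt (verit) Homeos_less)
next
  fix y
  show "\<exists>x. max (f x) (h x) = y"
  proof (cases "inv f y \<le> inv h y")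
    case True
    then have "h (inv f y) \<le> y" using h by (simp add: Homeos_le_inv_iff)
    then show ?thesis using f by (intro exI[of _ "inv f y"]) simp
  next
    case False
    then have "f (inv h y) \<le> y" using f by (metis Homeos_le_inv_iff linear)
    then show ?thesis using h by (intro exI[of _ "inv h y"]) simp
  qed
qed

lemma Homeos_reflect: "f \<in> Homeos \<Longrightarrow> (\<lambda>x. - f (- x)) \<in> Homeos"
proof (rule HomeosI)
  show "\<exists>x. - f (- x) = y" if "f \<in> Homeos" for y
    using that by (intro exI[of _ "- inv f (- y)"]) simp
qed (simp add: Homeos_order)

lemma Homeos_min: 
  assumes "f \<in> Homeos" "h \<in> Homeos" shows "(\<lambda>x. min (f x) (h x)) \<in> Homeos"
proof -
  have "(\<lambda>x. - max (- f (- (- x))) (- h (- (- x)))) \<in> Homeos"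
    using Homeos_reflect[OF Homeos_max[OF Homeos_reflect[OF assms(1)] Homeos_reflect[OF assms(2)]]]
    by simp
  moreover have "(\<lambda>x. - max (- f (- (- x))) (- h (- (- x)))) = (\<lambda>x. min (f x) (h x))"
    by (auto simp: fun_eq_iff)
  ultimately show ?thesis by simp
qed

lemma Homeos_no_fixed_point_sign:
  assumes f: "f \<in> Homeos" and nf: "\<And>x. x \<in> {s..t} \<Longrightarrow> f x \<noteq> x" and "f s > s" "x \<in> {s..t}"
  shows "f x > x"
proof (rule ccontr)
  assume "\<not> f x > x"
  then have "f x - x \<le> 0" "0 \<le> f s - s" "s \<le> x" using assms by auto
  moreover have "continuous_on {s..x} (\<lambda>x. f x - x)"
    using f by (intro continuous_intros Homeos_continuous_on)
  ultimately obtain y where "s \<le> y" "y \<le> x" "f y - y = 0"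
    using IVT2'[of "\<lambda>x. f x - x" x 0 s] by auto
  then show False using nf[of y] assms(4) by auto
qed

lemma Homeos_no_fixed_point_sign':
  assumes f: "f \<in> Homeos" and nf: "\<And>x. x \<in> {s..t} \<Longrightarrow> f x \<noteq> x" and "f s < s" "x \<in> {s..t}"
  shows "f x < x"
proof (rule ccontr)
  assume "\<not> f x < x"
  then have "0 \<le> f x - x" "f s - s \<le> 0" "s \<le> x" using assms by auto
  moreover have "continuous_on {s..x} (\<lambda>x. f x - x)"
    using f by (intro continuous_intros Homeos_continuous_on)
  ultimately obtain y where "s \<le> y" "y \<le> x" "f y - y = 0"
    using IVT'[of "\<lambda>x. f x - x" s 0 x] by auto
  then show False using nf[of y] assms(4) by auto
qed

lemma Homeos_iterates_unbounded:
  assumes f: "f \<in> Homeos" and gt: "\<And>x. x \<ge> s \<Longrightarrow> f x > x"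
  shows "\<exists>n. (f ^^ n) s \<ge> b"
proof (rule ccontr)
  assume "\<not> ?thesis"
  then have b: "(f ^^ n) s \<le> b" for n by (meson less_imp_le not_le)
  have ge: "(f ^^ n) s \<ge> s" for n
  proof (induction n)
    case (Suc n)
    then show ?case using gt[OF Suc] by simp
  qed simp
  then have inc: "incseq (\<lambda>n. (f ^^ n) s)"
    using gt[OF ge] by (intro incseq_SucI) (simp add: less_imp_le)
  obtain L where L: "(\<lambda>n. (f ^^ n) s) \<longlonglongrightarrow> L"
    using incseq_convergent[OF inc, of b] b by blast
  have "(\<lambda>n. f ((f ^^ n) s)) \<longlonglongrightarrow> f L"
    using f L by (intro isCont_tendsto_compose[of _ f]) auto
  moreover have "(\<lambda>n. f ((f ^^ n) s)) \<longlonglongrightarrow> L"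
    using LIMSEQ_Suc[OF L] by simp
  ultimately have "f L = L" using LIMSEQ_unique by blast
  moreover have "L \<ge> s" using L ge by (intro LIMSEQ_le_const[of _ L]) auto
  ultimately show False using gt[of L] by simp
qed


text \<open>Conjugation lemma\<close>

lemma extend_conjugacy:
  assumes A: "A \<in> Homeos" and D: "D \<in> Homeos" and T: "T \<in> Homeos"
    and Agt: "\<And>x. x \<ge> s \<Longrightarrow> A x > x" and Dgt: "\<And>y. y \<ge> T s \<Longrightarrow> D y > y"
    and eq: "\<And>x. x \<le> s \<Longrightarrow> T (A x) = D (T x)"
  obtains T' where "T' \<in> Homeos" "\<forall>x. T' (A x) = D (T' x)" "\<forall>x\<le>A s. T' x = T x"
proof -
  define F where "F n = (D ^^ n) \<circ> T \<circ> (inv A ^^ n)" for n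
  have FH: "F n \<in> Homeos" for n
    unfolding F_def using A D T by auto
  have invA: "(inv A ^^ n) ((A ^^ n) x) = x" for n x
    by (induction n arbitrary: x) (use A in \<open>auto simp: funpow_swap1\<close>)
  have AnH: "A ^^ n \<in> Homeos" "inv A ^^ n \<in> Homeos" for n using A by auto
  have step: "F (Suc n) x = F n x" if "x \<le> (A ^^ Suc n) s" for n x
  proof -
    define y where "y = (inv A ^^ n) x"
    have "y \<le> (inv A ^^ n) ((A ^^ n) (A s))"
      unfolding y_def using that AnH(2) by (simp add: Homeos_le funpow_swap1)
    then have "inv A y \<le> s" using A by (simp add: invA Homeos_inv_le_iff)
    from eq[OF this] A have "D (T (inv A y)) = T y" by simp
    moreover have "F (Suc n) x = (D ^^ n) (D (T (inv A y)))"
      by (simp add: F_def y_def funpow_swap1)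
    ultimately show ?thesis by (simp add: F_def y_def)
  qed
  have mono: "(A ^^ n) s \<le> (A ^^ k) s" if "n \<le> k" for n k
  proof -
    have ge: "(A ^^ n) s \<ge> s" for n
    proof (induction n)
      case (Suc n)
      then show ?case using Agt[OF Suc] by simp
    qed simp
    then have "incseq (\<lambda>n. (A ^^ n) s)"
      using Agt[OF ge] by (intro incseq_SucI) (simp add: less_imp_le)
    then show ?thesis using that by (rule incseqD)
  qed
  have stable: "F k x = F n x" if "x \<le> (A ^^ Suc n) s" "n \<le> k" for n k x
    using that(2)
  proof (induction k rule: dec_induct)
    case (step k)
    have "x \<le> (A ^^ Suc k) s" using that(1) mono[of "Suc n" "Suc k"] step by linarith
    then show ?case using \<open>\<And>x n. x \<le> (A ^^ Suc n) s \<Longrightarrow> F (Suc n) x = F n x\<close> step.IH by simp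
  qed simp
  have ex: "\<exists>n. x \<le> (A ^^ Suc n) s" for x
  proof -
    obtain n where "x \<le> (A ^^ n) s" using Homeos_iterates_unbounded[OF A Agt] by blast
    then show ?thesis using mono[of n "Suc n"] by (intro exI[of _ n]) linarith
  qed
  define N where "N x = (LEAST n. x \<le> (A ^^ Suc n) s)" for x
  have N: "x \<le> (A ^^ Suc (N x)) s" for x
    unfolding N_def using ex by (rule LeastI_ex)
  define T' where "T' x = F (N x) x" for x
  have T'eq: "T' x = F k x" if "x \<le> (A ^^ Suc k) s" for k x
  proof -
    have "N x \<le> k" unfolding N_def using that by (rule Least_le)
    then show ?thesis unfolding T'_def by (rule stable[OF N, symmetric])
  qed
  have T'H: "T' \<in> Homeos"
  proof (rule HomeosI)
    fix x y :: real assume xy: "x < y"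
    have "x \<le> (A ^^ Suc (N y)) s" "y \<le> (A ^^ Suc (N y)) s" using xy N[of y] by linarith+
    then have "T' x = F (N y) x" "T' y = F (N y) y" by (blast intro: T'eq)+
    then show "T' x < T' y" using xy by (simp add: FH Homeos_less)
  next
    fix y
    obtain n where n: "y \<le> (D ^^ n) (T s)" using Homeos_iterates_unbounded[OF D Dgt] by blast
    have n': "y \<le> (D ^^ Suc n) (T s)"
    proof -
      have ge: "(D ^^ n) (T s) \<ge> T s" for n
      proof (induction n)
        case (Suc n)
        then show ?case using Dgt[OF Suc] by simp
      qed simp
      show ?thesis using n Dgt[OF ge[of n]] by simp
    qed
    have "F n ((A ^^ Suc n) s) = (D ^^ n) (T (A s))"
      by (simp only: F_def comp_apply funpow_Suc_right invA)
    also have "\<dots> = (D ^^ Suc n) (T s)" by (simp only: eq[OF order_refl] funpow_Suc_right comp_apply)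
    finally have "inv (F n) y \<le> (A ^^ Suc n) s"
      using n' Homeos_inv_le_iff[OF FH] by presburger
    then have "T' (inv (F n) y) = F n (inv (F n) y)" by (rule T'eq)
    then show "\<exists>x. T' x = y" using FH[of n] by (metis Homeos_inv_right)
  qed
  moreover have "T' (A x) = D (T' x)" for x
  proof -
    have "A x \<le> (A ^^ Suc (Suc (N x))) s" using N[of x] A by (simp add: Homeos_le del: funpow.simps add: funpow.simps(2)[of "Suc (N x)"])
    then have "T' (A x) = F (Suc (N x)) (A x)" by (rule T'eq)
    also have "\<dots> = D (F (N x) x)" using A by (simp only: F_def comp_apply funpow_Suc_right Homeos_inv_left funpow_swap1)
    finally show ?thesis by (simp add: T'_def)
  qed
  moreover have "T' x = T x" if "x \<le> A s" for x
    using T'eq[of x 0] that by (simp add: F_def)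
  ultimately show ?thesis by (intro that[of T']) auto
qed


(* Dyn2 *)


lemma reroute_past:
  assumes a: "a \<in> Homeos" and t: "t \<in> Homeos" and h: "h \<in> Homeos" and h': "h' \<in> Homeos"
    and eq: "\<And>x. t (a x) = h (a (t x))"
    and nf: "\<And>x. x \<in> {s..max s (max (t s) (inv t s))} \<Longrightarrow> a x \<noteq> x"
    and agree: "\<And>y. y \<le> a (max s (t s)) \<Longrightarrow> h' y = h y"
  obtains a' t' where "a' \<in> Homeos" "t' \<in> Homeos" "\<forall>x. t' (a' x) = h' (a' (t' x))"
    "\<forall>x\<le>s. a' x = a x \<and> t' x = t x" "\<forall>x\<ge>s. a' x \<noteq> x"
proof -
  define s1 where "s1 = max s (t s)"
  have s1: "s \<le> s1" "t s \<le> s1" by (auto simp: s1_def)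
  have agree1: "h' y = h y" if "y \<le> a s1" for y using agree that by (simp add: s1_def)
  have nfa: "a x \<noteq> x" if "x \<in> {s..s1}" for x
    using nf that by (auto simp: s1_def)
  have nfh: "(h \<circ> a) y \<noteq> y" if y: "y \<in> {t s..s1}" for y
  proof
    assume "(h \<circ> a) y = y"
    then have "t (a (inv t y)) = t (inv t y)" using eq[of "inv t y"] t by simp
    then have "a (inv t y) = inv t y" using t by (metis Homeos_eq)
    moreover have "s \<le> inv t y" "inv t y \<le> inv t s1"
      using y t by (auto simp: Homeos_le_inv_iff Homeos_le)
    moreover have "inv t s1 \<le> max s (max (t s) (inv t s))"
      using t by (auto simp: s1_def max_def)
    ultimately show False using nf[of "inv t y"] by auto
  qed
  have ha: "h \<circ> a \<in> Homeos" using h a by auto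
  show ?thesis
  proof (cases "a s > s")
    case True
    have agt: "a x > x" if "x \<in> {s..s1}" for x
      using Homeos_no_fixed_point_sign[OF a nfa True that] .
    have hgt: "h (a y) > y" if "y \<in> {t s..s1}" for y
    proof -
      have "t (a s) > t s" using True t by (simp add: Homeos_less)
      then have "(h \<circ> a) (t s) > t s" using eq[of s] by simp
      from Homeos_no_fixed_point_sign[OF ha nfh this that] show ?thesis by simp
    qed
    define m where "m x = max x (inv h' x)" for x
    define c where "c = a s1 - m s1"
    have c: "c > 0"
    proof -
      have "s1 < a s1" "s1 < h' (a s1)" using agt[of s1] hgt[of s1] s1 agree1[of "a s1"] by auto
      then show ?thesis using h' by (simp add: c_def m_def Homeos_inv_less_iff)
    qed
    define a' where "a' x = (if x \<le> s1 then a x else m x + c)" for x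
    have m: "m \<in> Homeos" unfolding m_def using h' by (intro Homeos_max) auto
    have a': "a' \<in> Homeos"
      unfolding a'_def using a m by (intro Homeos_glue Homeos_add) (auto simp: c_def)
    have a'gt: "a' x > x" if "x \<ge> s" for x
      using that agt[of x] c by (auto simp: a'_def m_def max_def)
    have h'gt: "(h' \<circ> a') y > y" if "y \<ge> t s" for y
    proof (cases "y \<le> s1")
      case True
      then have "a y \<le> a s1" using a by (simp add: Homeos_le)
      then show ?thesis using hgt[of y] True that agree1[of "a y"] by (simp add: a'_def)
    next
      case False
      then have "inv h' y < a' y" using c by (simp add: a'_def m_def)
      then show ?thesis using h' by (simp add: Homeos_inv_less_iff)
    qed
    have "t (a' x) = (h' \<circ> a') (t x)" if "x \<le> s" for x
    proof -
      have tx: "t x \<le> s1" using that s1 t by (meson Homeos_le order_trans)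
      then have "a (t x) \<le> a s1" using a by (simp add: Homeos_le)
      then show ?thesis using tx that s1 eq[of x] agree1[of "a (t x)"] by (simp add: a'_def)
    qed
    note eq' = this
    obtain t' where t': "t' \<in> Homeos" "\<forall>x. t' (a' x) = (h' \<circ> a') (t' x)" "\<forall>x\<le>a' s. t' x = t x"
      by (rule extend_conjugacy[OF a' Homeos_comp[OF h' a'] t a'gt h'gt eq'])
    have "a' x \<noteq> x" if "x \<ge> s" for x using a'gt[OF that] by simp
    moreover have "t' x = t x" if "x \<le> s" for x
      using t'(3) a'gt[of s] that by (meson less_eq_real_def order_trans order_refl)
    moreover have "a' x = a x" if "x \<le> s" for x using that s1 by (simp add: a'_def)
    ultimately show ?thesis using t'(2) by (intro that[OF a' t'(1)]) simp_all
  next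
    case False
    then have lt: "a s < s" using nfa[of s] s1 by force
    have agt: "a x < x" if "x \<in> {s..s1}" for x
      using Homeos_no_fixed_point_sign'[OF a nfa lt that] .
    have hgt: "h (a y) < y" if "y \<in> {t s..s1}" for y
    proof -
      have "t (a s) < t s" using lt t by (simp add: Homeos_less)
      then have "(h \<circ> a) (t s) < t s" using eq[of s] by simp
      from Homeos_no_fixed_point_sign'[OF ha nfh this that] show ?thesis by simp
    qed
    define m where "m x = min x (inv h' x)" for x
    define c where "c = a s1 - m s1"
    have c: "c < 0"
    proof -
      have "s1 > a s1" "s1 > h' (a s1)" using agt[of s1] hgt[of s1] s1 agree1[of "a s1"] by auto
      then show ?thesis using h' by (simp add: c_def m_def Homeos_less_inv_iff)
    qed
    define a' where "a' x = (if x \<le> s1 then a x else m x + c)" for x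
    have m: "m \<in> Homeos" unfolding m_def using h' by (intro Homeos_min) auto
    have a': "a' \<in> Homeos"
      unfolding a'_def using a m by (intro Homeos_glue Homeos_add) (auto simp: c_def)
    have a'lt: "a' x < x" if "x \<ge> s" for x
      using that agt[of x] c by (auto simp: a'_def m_def min_def)
    have h'lt: "(h' \<circ> a') y < y" if "y \<ge> t s" for y
    proof (cases "y \<le> s1")
      case True
      then have "a y \<le> a s1" using a by (simp add: Homeos_le)
      then show ?thesis using hgt[of y] True that agree1[of "a y"] by (simp add: a'_def)
    next
      case False
      then have "inv h' y > a' y" using c by (simp add: a'_def m_def)
      then show ?thesis using h' by (simp add: Homeos_less_inv_iff)
    qed
    define d' where "d' = h' \<circ> a'"
    have d': "d' \<in> Homeos" using h' a' by (simp add: d'_def)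
    have as: "a' s = a s" using s1 by (simp add: a'_def)
    have intertwine: "t (a x) = d' (t x)" if "x \<le> s" for x
    proof -
      have tx: "t x \<le> s1" using that s1 t by (meson Homeos_le order_trans)
      then have "a (t x) \<le> a s1" using a by (simp add: Homeos_le)
      then show ?thesis using tx that s1 eq[of x] agree1[of "a (t x)"] by (simp add: d'_def a'_def)
    qed
    \<comment> \<open>Both maps move points down, so the conjugacy is extended for their inverses.\<close>
    have 1: "inv a' x > x" if "x \<ge> a s" for x
    proof -
      have "inv a' x \<ge> s" using that a' as by (simp add: Homeos_le_inv_iff)
      then show ?thesis using a'lt[of "inv a' x"] a' by simp
    qed
    have 2: "inv d' y > y" if "y \<ge> t (a s)" for y
    proof -
      have "inv d' y \<ge> t s" using that d' intertwine[of s] by (simp add: Homeos_le_inv_iff)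
      then show ?thesis using h'lt[of "inv d' y"] d' by (simp add: d'_def[symmetric])
    qed
    have 3: "t (inv a' x) = inv d' (t x)" if "x \<le> a s" for x
    proof -
      have le: "inv a' x \<le> s" using that a' as by (simp add: Homeos_inv_le_iff)
      then have "a' (inv a' x) = a (inv a' x)" using s1 by (simp add: a'_def)
      then have "t x = d' (t (inv a' x))" using intertwine[OF le] a' by simp
      then show ?thesis using d' by simp
    qed
    obtain t' where t': "t' \<in> Homeos" "\<forall>x. t' (inv a' x) = inv d' (t' x)"
      "\<forall>x\<le>inv a' (a s). t' x = t x"
      by (rule extend_conjugacy[OF Homeos_inv[OF a'] Homeos_inv[OF d'] t 1 2 3])
    have "t' (a' x) = d' (t' x)" for x
      using t'(2)[rule_format, of "a' x"] a' d' by simp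
    moreover have "inv a' (a s) = s" using as a' by (metis Homeos_inv_left)
    moreover have "a' x \<noteq> x" if "x \<ge> s" for x using a'lt[OF that] by simp
    moreover have "a' x = a x" if "x \<le> s" for x using that s1 by (simp add: a'_def)
    ultimately show ?thesis using t'(3) by (intro that[OF a' t'(1)]) (simp_all add: d'_def)
  qed
qed

definition commutator :: "('a \<Rightarrow> 'a) \<Rightarrow> ('a \<Rightarrow> 'a) \<Rightarrow> 'a \<Rightarrow> 'a" where
  "commutator a b = a \<circ> b \<circ> inv a \<circ> inv b"

lemma commutator_Homeos [simp, intro]:
  "\<lbrakk>a \<in> Homeos; b \<in> Homeos\<rbrakk> \<Longrightarrow> commutator a b \<in> Homeos"
  by (simp add: commutator_def)

lemma commutator_relation_iff:
  assumes "a \<in> Homeos" "b \<in> Homeos" "h \<in> Homeos"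
  shows "commutator a b \<circ> h = id \<longleftrightarrow> (\<forall>x. b (a x) = h (a (b x)))"
proof
  assume *: "commutator a b \<circ> h = id"
  show "\<forall>x. b (a x) = h (a (b x))"
  proof
    fix x
    have "a (b (inv a (inv b (h (a (b x)))))) = a (b x)"
      using fun_cong[OF *, of "a (b x)"] by (simp add: commutator_def)
    then have "inv a (inv b (h (a (b x)))) = x" using assms by (simp add: Homeos_eq)
    then show "b (a x) = h (a (b x))" using assms by (simp add: Homeos_inv_eq_iff)
  qed
next
  assume *: "\<forall>x. b (a x) = h (a (b x))"
  show "commutator a b \<circ> h = id"
  proof
    fix y
    have "b (a (inv b (inv a y))) = h y" using *[rule_format, of "inv b (inv a y)"] assms by simp
    then have "h y = b (a (inv b (inv a y)))" by simp
    then show "(commutator a b \<circ> h) y = id y" using assms by (simp add: commutator_def)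
  qed
qed

lemma commutator_bend:
  assumes "a \<in> Homeos" "b \<in> Homeos" "z \<in> Homeos" "z \<circ> b = b \<circ> z"
  shows "commutator (a \<circ> z) b = commutator a b"
proof
  fix x
  define y where "y = inv z (inv a (inv b x))"
  have "z (b y) = b (z y)" using fun_cong[OF assms(4), of y] by simp
  then show "commutator (a \<circ> z) b x = commutator a b x"
    using assms by (simp add: commutator_def Homeos_inv_comp y_def)
qed

lemma choose_reroute_point:
  fixes a b :: "real \<Rightarrow> real"
  assumes a: "a \<in> Homeos" and b: "b \<in> Homeos" and x: "x > M" "a x \<noteq> x \<or> b x \<noteq> x"
  shows "\<exists>s>M. (\<forall>y\<in>{s..max s (max (b s) (inv b s))}. a y \<noteq> y) \<or>
               (\<forall>y\<in>{s..max s (max (a s) (inv a s))}. b y \<noteq> y)"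
proof (cases "\<exists>s>M. (a s = s) \<noteq> (b s = s)")
  case True
  then obtain s where s: "s > M" "(a s = s) \<noteq> (b s = s)" by blast
  have "inv a s = s" if "a s = s" using that a by (simp add: Homeos_inv_eq_iff)
  moreover have "inv b s = s" if "b s = s" using that b by (simp add: Homeos_inv_eq_iff)
  ultimately show ?thesis using s by (intro exI[of _ s]) auto
next
  case False
  then have same: "a y = y \<longleftrightarrow> b y = y" if "y > M" for y using that by blast
  have "a y \<noteq> y" if y: "y \<in> {x..max x (max (b x) (inv b x))}" for y
  proof
    assume "a y = y"
    then have bfix: "b y = y" using same[of y] y x by auto
    have "x \<noteq> y" using x same[of x] \<open>a y = y\<close> by auto
    then have "x < y" using y by auto
    then have "b x < b y" "inv b x < inv b y" using b by (simp_all add: Homeos_less)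
    moreover have "inv b y = y" using bfix b by (simp add: Homeos_inv_eq_iff)
    ultimately show False using y \<open>x < y\<close> bfix by auto
  qed
  then show ?thesis using x by blast
qed

lemma reroute_pair:
  assumes a: "a \<in> Homeos" and b: "b \<in> Homeos" and h: "h \<in> Homeos"
    and rel: "commutator a b \<circ> h = id" and x: "x > M" "a x \<noteq> x \<or> b x \<noteq> x"
  shows "\<exists>s>M. \<exists>Y. \<forall>h'\<in>Homeos. (\<forall>x\<le>Y. h' x = h x) \<longrightarrow>
     (\<exists>a'\<in>Homeos. \<exists>b'\<in>Homeos. commutator a' b' \<circ> h' = id \<and>
        (\<forall>x\<le>s. a' x = a x \<and> b' x = b x) \<and> (\<forall>x\<ge>s. a' x \<noteq> x \<or> b' x \<noteq> x))"
proof -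
  from choose_reroute_point[OF a b x] obtain s where s: "s > M"
    and "(\<forall>y\<in>{s..max s (max (b s) (inv b s))}. a y \<noteq> y) \<or>
         (\<forall>y\<in>{s..max s (max (a s) (inv a s))}. b y \<noteq> y)" by blast
  from this(2) show ?thesis
  proof
    assume nf: "\<forall>y\<in>{s..max s (max (b s) (inv b s))}. a y \<noteq> y"
    have key: "\<exists>a'\<in>Homeos. \<exists>b'\<in>Homeos. commutator a' b' \<circ> h' = id \<and>
        (\<forall>x\<le>s. a' x = a x \<and> b' x = b x) \<and> (\<forall>x\<ge>s. a' x \<noteq> x \<or> b' x \<noteq> x)"
      if h': "h' \<in> Homeos" and agree: "\<And>x. x \<le> a (max s (b s)) \<Longrightarrow> h' x = h x" for h'
    proof -
      have eq: "b (a x) = h (a (b x))" for x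
        using rel commutator_relation_iff[OF a b h] by blast
      have nf': "a y \<noteq> y" if "y \<in> {s..max s (max (b s) (inv b s))}" for y
        using nf that by blast
      obtain a' b' where *: "a' \<in> Homeos" "b' \<in> Homeos" "\<forall>x. b' (a' x) = h' (a' (b' x))"
        "\<forall>x\<le>s. a' x = a x \<and> b' x = b x" "\<forall>x\<ge>s. a' x \<noteq> x"
        by (rule reroute_past[OF a b h h' eq nf' agree])
      then show ?thesis using commutator_relation_iff[OF *(1,2) h'] by blast
    qed
    show ?thesis
    proof (intro exI conjI ballI impI)
      show "s > M" by (rule s)
    qed (rule key, auto)
  next
    assume nf: "\<forall>y\<in>{s..max s (max (a s) (inv a s))}. b y \<noteq> y"
    define Y where "Y = inv h (b (max s (a s)))"
    have key: "\<exists>a'\<in>Homeos. \<exists>b'\<in>Homeos. commutator a' b' \<circ> h' = id \<and>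
        (\<forall>x\<le>s. a' x = a x \<and> b' x = b x) \<and> (\<forall>x\<ge>s. a' x \<noteq> x \<or> b' x \<noteq> x)"
      if h': "h' \<in> Homeos" and agree: "\<And>x. x \<le> Y \<Longrightarrow> h' x = h x" for h'
    proof -
      have eq: "a (b x) = inv h (b (a x))" for x
        using rel commutator_relation_iff[OF a b h] h by simp
      have agree': "inv h' y = inv h y" if "y \<le> b (max s (a s))" for y
      proof -
        have "h' (inv h y) = h (inv h y)" using agree[of "inv h y"] that h by (simp add: Y_def Homeos_le)
        then show ?thesis using h h' by (simp add: Homeos_inv_eq_iff)
      qed
      have nf': "b y \<noteq> y" if "y \<in> {s..max s (max (a s) (inv a s))}" for y
        using nf that by blast
      obtain a' b' where *: "a' \<in> Homeos" "b' \<in> Homeos" "\<forall>x. a' (b' x) = inv h' (b' (a' x))"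
        "\<forall>x\<le>s. b' x = b x \<and> a' x = a x" "\<forall>x\<ge>s. b' x \<noteq> x"
        by (rule reroute_past[OF b a Homeos_inv[OF h] Homeos_inv[OF h'] eq nf' agree'])
      have "b' (a' x) = h' (a' (b' x))" for x
        using *(3) h' by simp
      then show ?thesis using * commutator_relation_iff[OF *(1,2) h'] by blast
    qed
    show ?thesis
    proof (intro exI conjI ballI impI)
      show "s > M" by (rule s)
    qed (rule key, auto)
  qed
qed


(* Dyn3 *)


primrec surface_word :: "nat \<Rightarrow> (nat \<Rightarrow> 'a \<Rightarrow> 'a) \<Rightarrow> 'a \<Rightarrow> 'a" where
  "surface_word 0 w = id"
| "surface_word (Suc n) w = surface_word n w \<circ> commutator (w (2 * n)) (w (2 * n + 1))"

definition surface_rep :: "nat \<Rightarrow> (nat \<Rightarrow> real \<Rightarrow> real) \<Rightarrow> bool" where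
  "surface_rep g w \<longleftrightarrow> (\<forall>j. w j \<in> Homeos) \<and> (\<forall>j\<ge>2 * g. w j = id) \<and> surface_word g w = id"

definition fixed :: "(nat \<Rightarrow> real \<Rightarrow> real) \<Rightarrow> real set" where
  "fixed w = {x. \<forall>j. w j x = x}"

lemma surface_repD:
  assumes "surface_rep g w"
  shows "w j \<in> Homeos" "j \<ge> 2 * g \<Longrightarrow> w j = id" "surface_word g w = id"
  using assms by (auto simp: surface_rep_def)

lemma surface_word_Homeos [simp, intro]: "(\<And>j. w j \<in> Homeos) \<Longrightarrow> surface_word n w \<in> Homeos"
  by (induction n) auto

lemma surface_word_split:
  "surface_word (Suc n) w = commutator (w 0) (w 1) \<circ> surface_word n (\<lambda>j. w (j + 2))"
  by (induction n) (auto simp: fun_eq_iff)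

lemma surface_word_transport:
  assumes w: "\<And>j. w j \<in> Homeos" and v: "\<And>j. v j \<in> Homeos" and eq: "\<And>j x. w j (\<iota> x) = \<iota> (v j x)"
  shows "surface_word n w (\<iota> x) = \<iota> (surface_word n v x)"
proof -
  have inv: "inv (w j) (\<iota> x) = \<iota> (inv (v j) x)" for j x
    using eq[of j "inv (v j) x"] w v by (simp add: Homeos_inv_eq_iff)
  show ?thesis
    by (induction n arbitrary: x) (simp_all add: commutator_def eq inv)
qed

lemma surface_word_fixed:
  assumes w: "\<And>j. w j \<in> Homeos" and eq: "\<And>j. w j x = x"
  shows "surface_word n w x = x"
  using surface_word_transport[of w "\<lambda>_. id" "\<lambda>_. x" n] assms by simp

lemma surface_word_cong:
  assumes "\<And>i. i < n \<Longrightarrow> commutator (v (2 * i)) (v (2 * i + 1)) = commutator (w (2 * i)) (w (2 * i + 1))"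
  shows "surface_word n v = surface_word n w"
  using assms by (induction n) auto

lemma commutator_local:
  assumes "a \<in> Homeos" "b \<in> Homeos"
  shows "\<exists>S. \<forall>a'\<in>Homeos. \<forall>b'\<in>Homeos. (\<forall>x\<le>S. a' x = a x \<and> b' x = b x) \<longrightarrow>
           (\<forall>x\<le>Y. commutator a' b' x = commutator a b x)"
proof -
  define p where "p = inv b Y"
  define r where "r = inv a p"
  define S where "S = max p (max r (b r))"
  have "commutator a' b' x = commutator a b x"
    if H: "a' \<in> Homeos" "b' \<in> Homeos" and agree: "\<And>x. x \<le> S \<Longrightarrow> a' x = a x \<and> b' x = b x" and x: "x \<le> Y"
    for a' b' x
  proof -
    have 1: "inv b x \<le> p" using x assms by (simp add: p_def Homeos_le)
    then have b: "inv b' x = inv b x" using agree[of "inv b x"] assms H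
      by (simp add: Homeos_inv_eq_iff S_def)
    have 2: "inv a (inv b x) \<le> r" using 1 assms by (simp add: r_def Homeos_le)
    then have a: "inv a' (inv b x) = inv a (inv b x)" using agree[of "inv a (inv b x)"] assms H
      by (simp add: Homeos_inv_eq_iff S_def)
    have 3: "b (inv a (inv b x)) \<le> b r" using 2 assms by (simp add: Homeos_le)
    show ?thesis
      using agree[of "inv a (inv b x)"] agree[of "b (inv a (inv b x))"] 2 3
      by (simp add: commutator_def a b S_def)
  qed
  then show ?thesis by (intro exI[of _ S]) blast
qed

lemma surface_word_local:
  assumes "\<And>j. w j \<in> Homeos"
  shows "\<exists>S. \<forall>w'. (\<forall>j. w' j \<in> Homeos) \<longrightarrow> (\<forall>j. \<forall>x\<le>S. w' j x = w j x) \<longrightarrow>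
           (\<forall>x\<le>Y. surface_word n w' x = surface_word n w x)"
proof (induction n arbitrary: Y)
  case (Suc n)
  let ?c = "commutator (w (2 * n)) (w (2 * n + 1))"
  obtain S1 where S1: "\<And>w'. (\<forall>j. w' j \<in> Homeos) \<Longrightarrow> (\<forall>j. \<forall>x\<le>S1. w' j x = w j x) \<Longrightarrow>
           (\<forall>x\<le>?c Y. surface_word n w' x = surface_word n w x)"
    using Suc[of "?c Y"] by blast
  obtain S2 where S2: "\<forall>a'\<in>Homeos. \<forall>b'\<in>Homeos. (\<forall>x\<le>S2. a' x = w (2 * n) x \<and> b' x = w (2 * n + 1) x) \<longrightarrow>
           (\<forall>x\<le>Y. commutator a' b' x = ?c x)"
    using commutator_local[of "w (2 * n)" "w (2 * n + 1)" Y] assms by blast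
  have "surface_word (Suc n) w' x = surface_word (Suc n) w x"
    if H: "\<forall>j. w' j \<in> Homeos" and agree: "\<forall>j. \<forall>x\<le>max S1 S2. w' j x = w j x" and x: "x \<le> Y" for w' x
  proof -
    have c: "commutator (w' (2 * n)) (w' (2 * n + 1)) x = ?c x"
      using S2[rule_format, of "w' (2 * n)" "w' (2 * n + 1)" x] H agree x by simp
    have "?c x \<le> ?c Y" using x assms Homeos_le[of ?c] by simp
    then show ?thesis using S1[OF H, rule_format, of "?c x"] agree c by simp
  qed
  then show ?case by (intro exI[of _ "max S1 S2"]) blast
qed auto

lemma Homeos_affine: "k > 0 \<Longrightarrow> (\<lambda>x. c + (x - s) * k) \<in> Homeos"
proof (rule HomeosI)
  show "\<exists>x. c + (x - s) * k = y" if "k > 0" for y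
    using that by (intro exI[of _ "s + (y - c) / k"]) simp
qed simp

lemma Homeos_truncate:
  assumes f: "f \<in> Homeos" and S: "S < S'" "f S < S'"
  shows "\<exists>f'\<in>Homeos. (\<forall>x\<le>S. f' x = f x) \<and> (\<forall>x\<ge>S'. f' x = x)"
proof -
  define k where "k = (S' - f S) / (S' - S)"
  have k: "k > 0" using S by (simp add: k_def)
  have ke: "(S' - S) * k = S' - f S" using S by (simp add: k_def)
  define l where "l x = (if x \<le> S' then f S + (x - S) * k else x)" for x
  have l: "l \<in> Homeos"
    unfolding l_def by (rule Homeos_glue[OF Homeos_affine[OF k] Homeos_id(2)]) (use ke in simp)
  have "(\<lambda>x. if x \<le> S then f x else l x) \<in> Homeos"
    by (rule Homeos_glue[OF f l]) (use S in \<open>simp add: l_def\<close>)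
  then show ?thesis
    using S ke by (intro bexI[of _ "\<lambda>x. if x \<le> S then f x else l x"]) (auto simp: l_def)
qed

lemma surface_rep_bend:
  assumes w: "surface_rep g w" and z: "z \<in> Homeos" and com: "z \<circ> w (2 * i + 1) = w (2 * i + 1) \<circ> z"
    and i: "i < g"
  shows "surface_rep g (w(2 * i := w (2 * i) \<circ> z))"
proof -
  let ?v = "w(2 * i := w (2 * i) \<circ> z)"
  have odd: "2 * k + 1 \<noteq> 2 * i" for k by presburger
  have "surface_word g ?v = surface_word g w"
  proof (rule surface_word_cong)
    fix k
    show "commutator (?v (2 * k)) (?v (2 * k + 1)) = commutator (w (2 * k)) (w (2 * k + 1))"
      using commutator_bend[of "w (2 * i)" "w (2 * i + 1)" z] w z com odd[of k]
      by (cases "k = i") (auto simp: surface_repD)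
  qed
  then show ?thesis
    using w z i unfolding surface_rep_def by auto
qed

definition normal_right :: "(nat \<Rightarrow> real \<Rightarrow> real) \<Rightarrow> bool" where
  "normal_right w \<longleftrightarrow> (\<exists>S. \<forall>x\<ge>S. w 3 x = x \<and> (w 0 x \<noteq> x \<or> w 1 x \<noteq> x))"

definition normal_left :: "(nat \<Rightarrow> real \<Rightarrow> real) \<Rightarrow> bool" where
  "normal_left w \<longleftrightarrow> (\<exists>S. \<forall>x\<le>S. w 3 x = x \<and> (w 0 x \<noteq> x \<or> w 1 x \<noteq> x))"

lemma activate_first_handle:
  assumes w: "surface_rep g w" and g: "g \<ge> 1"
  obtains v where "surface_rep g v" "\<And>j x. x \<le> M \<Longrightarrow> v j x = w j x" "fixed v \<subseteq> fixed w"
    "\<exists>x>M. v 0 x \<noteq> x \<or> v 1 x \<noteq> x"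
proof (cases "\<exists>x>M. w 0 x \<noteq> x \<or> w 1 x \<noteq> x")
  case True
  then show ?thesis using that[of w] w by blast
next
  case False
  then have triv: "w 0 x = x" "w 1 x = x" if "x > M" for x using that by auto
  have H: "w j \<in> Homeos" for j using w by (rule surface_repD)
  define z where "z x = (if x \<le> M + 1 then x else M + 1 + (x - (M + 1)) * 2)" for x
  have z: "z \<in> Homeos" unfolding z_def by (rule Homeos_glue[OF Homeos_id(2) Homeos_affine]) auto
  have zgt: "z x > x" if "x > M + 1" for x using that by (simp add: z_def)
  have zid: "z x = x" if "x \<le> M + 1" for x using that by (simp add: z_def)
  have com: "z \<circ> w (2 * 0 + 1) = w (2 * 0 + 1) \<circ> z"
  proof
    fix x
    show "(z \<circ> w (2 * 0 + 1)) x = (w (2 * 0 + 1) \<circ> z) x"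
    proof (cases "x \<le> M + 1")
      case True
      then have "w 1 x \<le> w 1 (M + 1)" using H by (simp add: Homeos_le)
      then have "w 1 x \<le> M + 1" using triv(2)[of "M + 1"] by simp
      then show ?thesis using True by (simp add: zid)
    next
      case False
      then show ?thesis using triv(2)[of x] triv(2)[of "z x"] zgt[of x] by simp
    qed
  qed
  define v where "v = w(2 * 0 := w (2 * 0) \<circ> z)"
  have rep: "surface_rep g v"
    unfolding v_def using w z com g by (intro surface_rep_bend) auto
  have v0: "v 0 x = w 0 (z x)" "j \<noteq> 0 \<Longrightarrow> v j = w j" for x j by (auto simp: v_def)
  have v0': "v 0 x = z x" if "x > M + 1" for x
    using triv(1)[of "z x"] zgt[OF that] that by (simp add: v0)
  have agree: "v j x = w j x" if "x \<le> M + 1" for j x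
    using that by (cases "j = 0") (auto simp: v0 zid)
  have "fixed v \<subseteq> fixed w"
  proof
    fix x assume x: "x \<in> fixed v"
    then have "v 0 x = x" by (simp add: fixed_def)
    then have "x \<le> M + 1" using v0'[of x] zgt[of x] by fastforce
    then show "x \<in> fixed w" using x agree by (simp add: fixed_def)
  qed
  moreover have "v 0 (M + 2) \<noteq> M + 2" using v0'[of "M + 2"] zgt[of "M + 2"] by simp
  then have "\<exists>x>M. v 0 x \<noteq> x \<or> v 1 x \<noteq> x" by (intro exI[of _ "M + 2"]) auto
  ultimately show ?thesis using that[OF rep] agree by force
qed

lemma normalize_right_end:
  assumes w0: "surface_rep g w0" and g: "g \<ge> 1"
  obtains w where "surface_rep g w" "\<forall>j. \<forall>x\<le>M. w j x = w0 j x" "fixed w \<subseteq> fixed w0"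
    "normal_right w"
proof -
  obtain v where v: "surface_rep g v" "\<And>j x. x \<le> M \<Longrightarrow> v j x = w0 j x" "fixed v \<subseteq> fixed w0"
    and ex: "\<exists>x>M. v 0 x \<noteq> x \<or> v 1 x \<noteq> x"
    using activate_first_handle[OF w0 g, of M] by metis
  have H: "v j \<in> Homeos" for j using v(1) by (rule surface_repD)
  obtain n where n: "g = Suc n" using g by (cases g) auto
  define h where "h = surface_word n (\<lambda>j. v (j + 2))"
  have h: "h \<in> Homeos" unfolding h_def using H by auto
  have rel: "commutator (v 0) (v 1) \<circ> h = id"
    using surface_repD(3)[OF v(1)] unfolding n surface_word_split h_def .
  obtain x where "x > M" "v 0 x \<noteq> x \<or> v 1 x \<noteq> x" using ex by blast
  from reroute_pair[OF H H h rel this] obtain s Y where s: "s > M" and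
    mod: "\<forall>h'\<in>Homeos. (\<forall>x\<le>Y. h' x = h x) \<longrightarrow>
     (\<exists>a'\<in>Homeos. \<exists>b'\<in>Homeos. commutator a' b' \<circ> h' = id \<and>
        (\<forall>x\<le>s. a' x = v 0 x \<and> b' x = v 1 x) \<and> (\<forall>x\<ge>s. a' x \<noteq> x \<or> b' x \<noteq> x))" by blast
  obtain S0 where S0: "\<And>w'. (\<forall>j. w' j \<in> Homeos) \<Longrightarrow> (\<forall>j. \<forall>x\<le>S0. w' j x = v (j + 2) x) \<Longrightarrow>
           (\<forall>x\<le>Y. surface_word n w' x = h x)"
    using surface_word_local[where w="\<lambda>j. v (j + 2)" and n=n and Y=Y] H unfolding h_def by blast
  define S where "S = max S0 s"
  define S' where "S' = Max (insert S ((\<lambda>j. v j S) ` {..<2 * g})) + 1"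
  have S': "S < S'" "v j S < S'" for j
  proof -
    have "S \<le> Max (insert S ((\<lambda>j. v j S) ` {..<2 * g}))" by (intro Max_ge) auto
    then show 1: "S < S'" unfolding S'_def by linarith
    show "v j S < S'"
    proof (cases "j < 2 * g")
      case True
      then have "v j S \<le> Max (insert S ((\<lambda>j. v j S) ` {..<2 * g}))" by (intro Max_ge) auto
      then show ?thesis unfolding S'_def by linarith
    next
      case False
      then show ?thesis using 1 surface_repD(2)[OF v(1), of j] by simp
    qed
  qed
  have "\<exists>f\<in>Homeos. (\<forall>x\<le>S. f x = v j x) \<and> (\<forall>x\<ge>S'. f x = x) \<and> (j \<ge> 2 * g \<longrightarrow> f = id)" for j
  proof (cases "j \<ge> 2 * g")
    case True
    then show ?thesis using surface_repD(2)[OF v(1), of j] by auto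
  next
    case False
    then show ?thesis using Homeos_truncate[OF H S'(1) S'(2), of j] by auto
  qed
  then obtain f where f: "\<And>j. f j \<in> Homeos" "\<And>j x. x \<le> S \<Longrightarrow> f j x = v j x"
    "\<And>j x. x \<ge> S' \<Longrightarrow> f j x = x" "\<And>j. j \<ge> 2 * g \<Longrightarrow> f j = id" by metis
  define h' where "h' = surface_word n (\<lambda>j. f (j + 2))"
  have h': "h' \<in> Homeos" unfolding h'_def using f by auto
  have "\<forall>x\<le>Y. h' x = h x" unfolding h'_def using f by (intro S0) (auto simp: S_def)
  from mp[OF bspec[OF mod h'] this] obtain a b where ab: "a \<in> Homeos" "b \<in> Homeos" and
    ab': "commutator a b \<circ> h' = id \<and> (\<forall>x\<le>s. a x = v 0 x \<and> b x = v 1 x) \<and> (\<forall>x\<ge>s. a x \<noteq> x \<or> b x \<noteq> x)"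
    by (elim bexE) (rule that)
  have ab_word: "commutator a b \<circ> h' = id" using ab' by simp
  have ab_left: "a x = v 0 x" "b x = v 1 x" if "x \<le> s" for x using ab' that by simp_all
  have ab_right: "a x \<noteq> x \<or> b x \<noteq> x" if "x \<ge> s" for x using ab' that by simp
  define w where "w j = (if j = 0 then a else if j = 1 then b else f j)" for j
  have w': "w 0 = a" "w 1 = b" "w (Suc 0) = b" "\<And>j. w (j + 2) = f (j + 2)" "\<And>j. w (Suc (Suc j)) = f (Suc (Suc j))" "w 3 = f 3"
    by (auto simp: w_def)
  have rep: "surface_rep g w"
    unfolding surface_rep_def
  proof (intro conjI allI impI)
    show "w j \<in> Homeos" for j using ab f by (simp add: w_def)
    show "w j = id" if "j \<ge> 2 * g" for j using that g f by (simp add: w_def)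
    show "surface_word g w = id" unfolding n surface_word_split w' using ab_word by (simp add: h'_def)
  qed
  have agree: "w j x = v j x" if "x \<le> s" for j x
    using that ab_left f by (auto simp: w_def S_def)
  have moved: "w 0 x \<noteq> x \<or> w 1 x \<noteq> x" if "x \<ge> s" for x using ab_right[OF that] by (simp add: w_def)
  show ?thesis
  proof (rule that[OF rep])
    show "\<forall>j. \<forall>x\<le>M. w j x = w0 j x" using s agree v(2) by simp
    have "fixed w \<subseteq> fixed v"
    proof
      fix x assume x: "x \<in> fixed w"
      then have "x \<le> s" using moved[of x] by (force simp: fixed_def)
      then show "x \<in> fixed v" using x agree by (simp add: fixed_def)
    qed
    then show "fixed w \<subseteq> fixed w0" using v by blast
    show "normal_right w"
      unfolding normal_right_def using moved f(3) S' by (intro exI[of _ S']) (auto simp: w' S_def)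
  qed
qed

definition reflect :: "(nat \<Rightarrow> real \<Rightarrow> real) \<Rightarrow> nat \<Rightarrow> real \<Rightarrow> real" where
  "reflect w = (\<lambda>j x. - w j (- x))"

lemma surface_rep_reflect: "surface_rep g w \<Longrightarrow> surface_rep g (reflect w)"
proof -
  assume w: "surface_rep g w"
  have H: "reflect w j \<in> Homeos" for j
    unfolding reflect_def by (rule Homeos_reflect[OF surface_repD(1)[OF w, of j]])
  have tr: "surface_word g (reflect w) (- x) = - surface_word g w x" for x
    by (rule surface_word_transport[OF H surface_repD(1)[OF w]]) (simp add: reflect_def)
  have "surface_word g (reflect w) x = x" for x
    using tr[of "- x"] by (simp add: surface_repD(3)[OF w])
  then have "surface_word g (reflect w) = id" by (simp add: fun_eq_iff)
  moreover have "reflect w j = id" if "j \<ge> 2 * g" for j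
    using surface_repD(2)[OF w that] by (simp add: reflect_def fun_eq_iff)
  ultimately show ?thesis using H by (simp add: surface_rep_def)
qed

lemma reflect_reflect [simp]: "reflect (reflect w) = w" by (simp add: reflect_def)

lemma fixed_reflect: "fixed (reflect w) = uminus ` fixed w"
proof -
  have "x \<in> fixed (reflect w) \<longleftrightarrow> - x \<in> fixed w" for x
    unfolding fixed_def reflect_def mem_Collect_eq by (metis minus_minus)
  then show ?thesis by (metis (no_types, lifting) image_iff minus_minus subsetI subset_antisym)
qed

lemma normal_left_reflect: "normal_right (reflect w) \<Longrightarrow> normal_left w"
  unfolding normal_right_def normal_left_def reflect_def
proof -
  assume "\<exists>S. \<forall>x\<ge>S. - w 3 (- x) = x \<and> (- w 0 (- x) \<noteq> x \<or> - w 1 (- x) \<noteq> x)"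
  then obtain S where S: "\<And>x. x \<ge> S \<Longrightarrow> - w 3 (- x) = x \<and> (- w 0 (- x) \<noteq> x \<or> - w 1 (- x) \<noteq> x)" by blast
  have "w 3 x = x \<and> (w 0 x \<noteq> x \<or> w 1 x \<noteq> x)" if "x \<le> - S" for x
  proof -
    have "- x \<ge> S" using that by simp
    from S[OF this] show ?thesis by auto
  qed
  then show "\<exists>S. \<forall>x\<le>S. w 3 x = x \<and> (w 0 x \<noteq> x \<or> w 1 x \<noteq> x)" by blast
qed

lemma normalize_ends:
  assumes w0: "surface_rep g w0" and g: "g \<ge> 1"
  obtains w where "surface_rep g w" "\<forall>j. \<forall>x\<in>{- M..M}. w j x = w0 j x" "fixed w \<subseteq> fixed w0"
    "normal_right w" "normal_left w"
proof -
  obtain v where v: "surface_rep g v" "\<forall>j. \<forall>x\<le>M. v j x = w0 j x" "fixed v \<subseteq> fixed w0"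
    "normal_right v"
    by (rule normalize_right_end[where M=M, OF w0 g])
  obtain u where u: "surface_rep g u" "\<forall>j. \<forall>x\<le>M. u j x = reflect v j x" "fixed u \<subseteq> fixed (reflect v)"
    "normal_right u"
    by (rule normalize_right_end[where M=M, OF surface_rep_reflect[OF v(1)] g])
  have agree: "reflect u j x = v j x" if "x \<ge> - M" for j x
    using u(2)[rule_format, of "- x" j] that by (simp add: reflect_def)
  obtain S where S: "\<And>x. x \<ge> S \<Longrightarrow> v 3 x = x \<and> (v 0 x \<noteq> x \<or> v 1 x \<noteq> x)"
    using v(4) by (auto simp: normal_right_def)
  show ?thesis
  proof (rule that[of "reflect u"])
    show "surface_rep g (reflect u)" using u by (simp add: surface_rep_reflect)
    show "\<forall>j. \<forall>x\<in>{- M..M}. reflect u j x = w0 j x" using agree v(2) by simp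
    have "fixed (reflect u) \<subseteq> uminus ` uminus ` fixed v"
      using u(3) unfolding fixed_reflect by blast
    then show "fixed (reflect u) \<subseteq> fixed w0" using v(3) by (auto simp: image_image)
    show "normal_right (reflect u)"
      unfolding normal_right_def using S agree by (intro exI[of _ "max S (- M)"]) auto
    show "normal_left (reflect u)" using u(4) by (intro normal_left_reflect) simp
  qed
qed


(* Dyn4 *)


definition normal_at :: "(nat \<Rightarrow> real \<Rightarrow> real) \<Rightarrow> real \<Rightarrow> bool" where
  "normal_at w p \<longleftrightarrow> (\<exists>\<delta>>0. \<forall>y. y \<noteq> p \<and> \<bar>y - p\<bar> < \<delta> \<longrightarrow> w 3 y = y \<and> (w 0 y \<noteq> y \<or> w 1 y \<noteq> y))"

definition tame :: "nat \<Rightarrow> (nat \<Rightarrow> real \<Rightarrow> real) \<Rightarrow> bool" where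
  "tame g w \<longleftrightarrow> surface_rep g w \<and> normal_right w \<and> normal_left w \<and> (\<forall>p\<in>fixed w. normal_at w p)"

definition separated :: "real set \<Rightarrow> real \<Rightarrow> real \<Rightarrow> bool" where
  "separated C x y \<longleftrightarrow> (\<exists>c\<in>C. x \<le> c \<and> c \<le> y \<or> y \<le> c \<and> c \<le> x)"

lemma assemble_surface_rep:
  assumes C: "\<And>c j. c \<in> C \<Longrightarrow> w j c = c"
    and piece: "\<And>x. x \<notin> C \<Longrightarrow> \<exists>v \<iota>. surface_rep g v \<and> strict_mono \<iota> \<and> range \<iota> = {y. \<not> separated C x y} \<and>
                  (\<forall>j y. w j (\<iota> y) = \<iota> (v j y))"
  shows "surface_rep g w"
proof -
  have "\<forall>x. \<exists>v \<iota>. x \<notin> C \<longrightarrow> surface_rep g v \<and> strict_mono \<iota> \<and>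
          range \<iota> = {y. \<not> separated C x y} \<and> (\<forall>j y. w j (\<iota> y) = \<iota> (v j y))"
    using piece by blast
  then obtain V I where VI: "\<forall>x. x \<notin> C \<longrightarrow> surface_rep g (V x) \<and> strict_mono (I x) \<and>
          range (I x) = {y. \<not> separated C x y} \<and> (\<forall>j y. w j (I x y) = I x (V x j y))"
    by (simp only: choice_iff) blast
  have V: "surface_rep g (V x)" and mono: "strict_mono (I x)"
    and rng: "range (I x) = {y. \<not> separated C x y}" and eq: "w j (I x y) = I x (V x j y)"
    if "x \<notin> C" for x j y
    using VI that by simp_all
  have VH: "V x j \<in> Homeos" if "x \<notin> C" for x j using V[OF that] by (rule surface_repD)
  have self: "\<exists>a. x = I x a" if "x \<notin> C" for x
  proof -
    have "x \<in> {y. \<not> separated C x y}" using that by (force simp: separated_def)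
    then show ?thesis using rng[OF that] by (metis rangeE)
  qed
  have stay: "\<not> separated C x (w j x)" if x: "x \<notin> C" for x j
  proof -
    obtain a where "x = I x a" using self[OF x] by blast
    then have "w j x \<in> range (I x)" using eq[OF x, of j a] by (metis rangeI)
    then show ?thesis using rng[OF x] by simp
  qed
  have below: "w j x < c" if "c \<in> C" "x < c" for x c j
  proof (cases "x \<in> C")
    case True
    then show ?thesis using C that by simp
  next
    case False
    then show ?thesis using stay[OF False, of j] that by (force simp: separated_def)
  qed
  have above: "c < w j x" if "c \<in> C" "c < x" for x c j
  proof (cases "x \<in> C")
    case True
    then show ?thesis using C that by simp
  next
    case False
    then show ?thesis using stay[OF False, of j] that by (force simp: separated_def)
  qed
  have H: "w j \<in> Homeos" for j
  proof (rule HomeosI)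
    fix x y :: real assume xy: "x < y"
    show "w j x < w j y"
    proof (cases "separated C x y")
      case True
      then obtain c where c: "c \<in> C" "x \<le> c" "c \<le> y" using xy by (force simp: separated_def)
      have "w j x \<le> c" using c below[OF c(1), of x j] C[OF c(1)] by (cases "x = c") auto
      moreover have "c \<le> w j y" using c above[OF c(1), of y j] C[OF c(1)] by (cases "y = c") auto
      moreover have "w j x \<noteq> c \<or> w j y \<noteq> c"
        using xy c below[OF c(1), of x j] above[OF c(1), of y j] by force
      ultimately show ?thesis by linarith
    next
      case False
      then have x: "x \<notin> C" using xy by (force simp: separated_def)
      have "y \<in> range (I x)" using False rng[OF x] by simp
      then obtain b where b: "y = I x b" by blast
      obtain a where a: "x = I x a" using self[OF x] by blast
      have "a < b" using xy a b mono[OF x] by (metis strict_mono_less)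
      then have "I x (V x j a) < I x (V x j b)"
        using mono[OF x] VH[OF x, of j] by (simp add: strict_mono_less Homeos_less)
      then show ?thesis using eq[OF x] a b by metis
    qed
  next
    fix y
    show "\<exists>x. w j x = y"
    proof (cases "y \<in> C")
      case True
      then show ?thesis using C by blast
    next
      case False
      obtain a where a: "y = I y a" using self[OF False] by blast
      have "w j (I y (inv (V y j) a)) = I y a"
        using eq[OF False] VH[OF False, of j] by simp
      then show ?thesis using a by metis
    qed
  qed
  have "surface_word g w x = x" for x
  proof (cases "x \<in> C")
    case True
    then show ?thesis using C surface_word_fixed[of w x] H by simp
  next
    case False
    obtain a where a: "x = I x a" using self[OF False] by blast
    have "surface_word g w (I x a) = I x (surface_word g (V x) a)"
      by (rule surface_word_transport[of w "V x" "I x", OF H VH[OF False] eq[OF False]])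
    then show ?thesis using a surface_repD(3)[OF V[OF False]] by simp
  qed
  moreover have "w j x = x" if j: "j \<ge> 2 * g" for j x
  proof (cases "x \<in> C")
    case True
    then show ?thesis using C by simp
  next
    case False
    obtain a where a: "x = I x a" using self[OF False] by blast
    then show ?thesis using eq[OF False, of j a] surface_repD(2)[OF V[OF False] j] by simp
  qed
  ultimately show ?thesis
    using H by (simp add: surface_rep_def fun_eq_iff)
qed

lemma fixed_transport:
  assumes "strict_mono \<iota>" "\<And>j y. w j (\<iota> y) = \<iota> (v j y)"
  shows "\<iota> a \<in> fixed w \<longleftrightarrow> a \<in> fixed v"
  using assms by (simp add: fixed_def strict_mono_eq)

lemma normal_at_transport:
  assumes i: "strict_mono \<iota>" and eq: "\<And>j y. w j (\<iota> y) = \<iota> (v j y)"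
    and conv: "\<And>a b y. \<iota> a \<le> y \<Longrightarrow> y \<le> \<iota> b \<Longrightarrow> y \<in> range \<iota>"
    and n: "normal_at v a"
  shows "normal_at w (\<iota> a)"
proof -
  obtain d where d: "d > 0" "\<And>y. y \<noteq> a \<Longrightarrow> \<bar>y - a\<bar> < d \<Longrightarrow> v 3 y = y \<and> (v 0 y \<noteq> y \<or> v 1 y \<noteq> y)"
    using n unfolding normal_at_def by blast
  define e where "e = min (\<iota> (a + d) - \<iota> a) (\<iota> a - \<iota> (a - d))"
  have e: "e > 0" using d(1) i by (simp add: e_def strict_mono_less)
  have "w 3 y = y \<and> (w 0 y \<noteq> y \<or> w 1 y \<noteq> y)" if "y \<noteq> \<iota> a" "\<bar>y - \<iota> a\<bar> < e" for y
  proof -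
    have "\<iota> (a - d) < y" "y < \<iota> (a + d)" using that(2) by (auto simp: e_def)
    then obtain b where b: "y = \<iota> b" using conv[of "a - d" y "a + d"] by auto
    have "a - d < b" "b < a + d"
      using \<open>\<iota> (a - d) < y\<close> \<open>y < \<iota> (a + d)\<close> i by (simp_all add: b strict_mono_less)
    then have "v 3 b = b \<and> (v 0 b \<noteq> b \<or> v 1 b \<noteq> b)" using that(1) by (intro d(2)) (auto simp: b)
    then show ?thesis using i by (simp add: b eq strict_mono_eq)
  qed
  then show ?thesis unfolding normal_at_def using e by blast
qed

definition interval_chart :: "real \<Rightarrow> real \<Rightarrow> real \<Rightarrow> real" where
  "interval_chart u v x = u + (v - u) * (1/2 + arctan x / pi)"

lemma strict_mono_interval_chart: "u < v \<Longrightarrow> strict_mono (interval_chart u v)"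
  by (intro strict_monoI) (simp add: interval_chart_def arctan_less_iff divide_strict_right_mono)

lemma range_interval_chart:
  assumes "u < v" shows "range (interval_chart u v) = {u<..<v}"
proof (intro equalityI subsetI)
  fix y assume "y \<in> range (interval_chart u v)"
  then obtain x where y: "y = u + (v - u) * (1/2 + arctan x / pi)" by (auto simp: interval_chart_def)
  have "0 < 1/2 + arctan x / pi" "1/2 + arctan x / pi < 1"
    using arctan_bounded[of x] by (auto simp: field_simps)
  then have "0 < (v - u) * (1/2 + arctan x / pi)" "(v - u) * (1/2 + arctan x / pi) < (v - u) * 1"
    using assms by (intro mult_pos_pos mult_strict_left_mono; simp)+
  then show "y \<in> {u<..<v}" using y by simp
next
  fix y assume y: "y \<in> {u<..<v}"
  define r where "r = (y - u) / (v - u)"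
  have r: "0 < r" "r < 1" using y assms by (auto simp: r_def)
  have y_eq: "y = u + (v - u) * r" using assms by (simp add: r_def)
  define s where "s = (r - 1/2) * pi"
  have "(- (1/2)) * pi < s" "s < (1/2) * pi"
    unfolding s_def using r by (intro mult_strict_right_mono; simp)+
  then have "arctan (tan s) = s" by (intro arctan_tan) auto
  moreover have "1/2 + s / pi = r" by (simp add: s_def)
  ultimately have "interval_chart u v (tan s) = y" by (simp add: interval_chart_def y_eq)
  then show "y \<in> range (interval_chart u v)" by blast
qed

lemma surface_rep_id: "surface_rep g (\<lambda>_. id)"
  using surface_word_fixed[of "\<lambda>_. id" _ g] by (auto simp: surface_rep_def fun_eq_iff)

lemma tame_translation:
  assumes "g \<ge> 1"
  shows "tame g (\<lambda>j x. if j = 0 then x + 1 else x)"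
proof -
  have z: "(\<lambda>x. x + 1) \<in> Homeos" using Homeos_add[of "\<lambda>x. x" 1] by simp
  have "surface_rep g ((\<lambda>_. id)(2 * 0 := id \<circ> (\<lambda>x. x + 1)))"
    using surface_rep_bend[OF surface_rep_id z, of 0] assms by (simp add: comp_def)
  moreover have "(\<lambda>_. id)(2 * 0 := id \<circ> (\<lambda>x. x + 1)) = (\<lambda>(j::nat) x. if j = 0 then x + 1 else x :: real)"
    by (auto simp: fun_eq_iff)
  ultimately show ?thesis
    by (auto simp: tame_def normal_right_def normal_left_def fixed_def)
qed

definition approximable :: "nat \<Rightarrow> (nat \<Rightarrow> real \<Rightarrow> real) \<Rightarrow> real \<Rightarrow> real \<Rightarrow> real \<Rightarrow> bool" where
  "approximable g \<rho> \<epsilon> u v \<longleftrightarrow> u = v \<or>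
     (\<forall>\<iota>. strict_mono \<iota> \<and> range \<iota> = {u<..<v} \<longrightarrow>
        (\<exists>t. tame g t \<and> (\<forall>j x. \<bar>\<iota> (t j x) - \<rho> j (\<iota> x)\<bar> < \<epsilon>)))"

lemma surface_rep_interval_invariant:
  assumes "surface_rep g \<rho>" "u \<in> fixed \<rho>" "v \<in> fixed \<rho>" "x \<in> {u<..<v}"
  shows "\<rho> j x \<in> {u<..<v}"
proof -
  have "\<rho> j u = u" "\<rho> j v = v" using assms by (auto simp: fixed_def)
  then show ?thesis
    using assms(4) surface_repD(1)[OF assms(1), of j] by (metis Homeos_less greaterThanLessThan_iff)
qed

lemma approximable_short:
  assumes "g \<ge> 1" "surface_rep g \<rho>" "u \<in> fixed \<rho>" "v \<in> fixed \<rho>" "v - u < \<epsilon>"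
  shows "approximable g \<rho> \<epsilon> u v"
  unfolding approximable_def
proof (intro disjI2 allI impI exI conjI)
  fix \<iota> :: "real \<Rightarrow> real" and j :: nat and x :: real
  assume "strict_mono \<iota> \<and> range \<iota> = {u<..<v}"
  then have r: "\<iota> y \<in> {u<..<v}" for y by blast
  show "tame g (\<lambda>j x. if j = 0 then x + 1 else x)" using assms(1) by (rule tame_translation)
  show "\<bar>\<iota> (if j = 0 then x + 1 else x) - \<rho> j (\<iota> x)\<bar> < \<epsilon>"
    using r[of "if j = 0 then x + 1 else x"] surface_rep_interval_invariant[OF assms(2-4) r[of x], of j] assms(5)
    by (simp only: greaterThanLessThan_iff) linarith
qed

lemma push_to_right_end:
  assumes r: "surface_rep g \<rho>" and v: "v \<in> fixed \<rho>" and y: "y < v"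
  obtains e where "e < v" "\<forall>j. y < \<rho> j e"
proof -
  define e0 where "e0 = Max (insert y ((\<lambda>j. inv (\<rho> j) y) ` {..<2 * g}))"
  have lt: "inv (\<rho> j) y < v" for j
    using surface_repD(1)[OF r, of j] v y by (simp add: Homeos_inv_less_iff fixed_def)
  then have "e0 < v" unfolding e0_def using y by (subst Max_less_iff) auto
  then obtain e where e: "e0 < e" "e < v" using dense by blast
  have "y < \<rho> j e" for j
  proof (cases "j < 2 * g")
    case True
    then have "inv (\<rho> j) y \<le> e0" unfolding e0_def by (intro Max_ge) auto
    then have "inv (\<rho> j) y < e" using e by linarith
    then show ?thesis using surface_repD(1)[OF r, of j] by (simp add: Homeos_inv_less_iff)
  next
    case False
    have "y \<le> e0" unfolding e0_def by (intro Max_ge) auto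
    then show ?thesis using False e surface_repD(2)[OF r, of j] by simp
  qed
  then show ?thesis using that e by blast
qed

lemma push_to_left_end:
  assumes r: "surface_rep g \<rho>" and u: "u \<in> fixed \<rho>" and y: "u < y"
  obtains e where "u < e" "\<forall>j. \<rho> j e < y"
proof -
  have "- u \<in> fixed (reflect \<rho>)" using u by (simp add: fixed_reflect)
  then obtain e where e: "e < - u" "\<forall>j. - y < reflect \<rho> j e"
    using push_to_right_end[OF surface_rep_reflect[OF r], of "- u" "- y"] y by auto
  show ?thesis
    by (rule that[of "- e"]) (use e in \<open>auto simp: reflect_def\<close>)
qed

lemma approximable_gap:
  assumes g: "g \<ge> 1" and r: "surface_rep g \<rho>" and uv: "u \<in> fixed \<rho>" "v \<in> fixed \<rho>" "u < v"
    and nofix: "fixed \<rho> \<inter> {u<..<v} = {}" and eps: "\<epsilon> > 0"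
  shows "approximable g \<rho> \<epsilon> u v"
  unfolding approximable_def
proof (intro disjI2 allI impI)
  fix \<iota> :: "real \<Rightarrow> real"
  assume "strict_mono \<iota> \<and> range \<iota> = {u<..<v}"
  then have mono: "strict_mono \<iota>" and rng: "range \<iota> = {u<..<v}" by auto
  have in_rng: "\<iota> y \<in> {u<..<v}" for y using rng by blast
  have inj: "inj \<iota>" using mono by (rule strict_mono_imp_inj_on)
  define \<sigma> where "\<sigma> j x = inv \<iota> (\<rho> j (\<iota> x))" for j x
  have s: "\<iota> (\<sigma> j x) = \<rho> j (\<iota> x)" for j x
  proof -
    have "\<rho> j (\<iota> x) \<in> range \<iota>"
      using surface_rep_interval_invariant[OF r uv(1,2) in_rng] rng by simp
    then show ?thesis unfolding \<sigma>_def by (rule f_inv_into_f)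
  qed
  have H: "\<sigma> j \<in> Homeos" for j
  proof (rule HomeosI)
    fix x y :: real assume "x < y"
    then have "\<iota> (\<sigma> j x) < \<iota> (\<sigma> j y)"
      using mono surface_repD(1)[OF r, of j] by (simp add: s Homeos_less strict_mono_less)
    then show "\<sigma> j x < \<sigma> j y" using mono by (simp add: strict_mono_less)
  next
    fix y
    have inv_u: "inv (\<rho> j) u = u" "inv (\<rho> j) v = v"
      using uv surface_repD(1)[OF r, of j] by (auto simp: Homeos_inv_eq_iff fixed_def)
    have "inv (\<rho> j) (\<iota> y) \<in> {u<..<v}"
      using in_rng[of y] surface_repD(1)[OF r, of j] inv_u
      by (metis Homeos_inv Homeos_less greaterThanLessThan_iff)
    then obtain x where x: "\<iota> x = inv (\<rho> j) (\<iota> y)" using rng by (metis rangeE)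
    then have "\<iota> (\<sigma> j x) = \<iota> y" using surface_repD(1)[OF r, of j] by (simp add: s)
    then show "\<exists>x. \<sigma> j x = y" using inj by (meson injD)
  qed
  have "\<iota> (surface_word g \<sigma> x) = \<iota> x" for x
    using surface_word_transport[of \<rho> \<sigma> \<iota> g x] surface_repD[OF r] H s by simp
  then have "surface_word g \<sigma> = id" using inj by (auto simp: fun_eq_iff inj_eq)
  moreover have "\<sigma> j = id" if "j \<ge> 2 * g" for j
    using surface_repD(2)[OF r that] inj by (simp add: \<sigma>_def fun_eq_iff)
  ultimately have rep: "surface_rep g \<sigma>" using H by (simp add: surface_rep_def)
  have nofix': "fixed \<sigma> = {}"
  proof -
    have "a \<notin> fixed \<sigma>" for a
      using fixed_transport[of \<iota> \<rho> \<sigma> a, OF mono s[symmetric]] nofix in_rng[of a] by blast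
    then show ?thesis by blast
  qed
  obtain e1 where e1: "e1 < v" "\<forall>j. max u (v - \<epsilon>) < \<rho> j e1"
    using push_to_right_end[OF r uv(2), of "max u (v - \<epsilon>)"] uv eps by auto
  obtain e2 where e2: "u < e2" "\<forall>j. \<rho> j e2 < min v (u + \<epsilon>)"
    using push_to_left_end[OF r uv(1), of "min v (u + \<epsilon>)"] uv eps by auto
  have "u < e1"
    using e1(2)[rule_format, of 0] uv(1) surface_repD(1)[OF r, of 0]
    by (metis (mono_tags, lifting) Homeos_less fixed_def max_less_iff_conj mem_Collect_eq)
  then obtain M1 where M1: "\<iota> M1 = e1" using rng e1 by (metis greaterThanLessThan_iff rangeE)
  have "e2 < v"
    using e2(2)[rule_format, of 0] uv(2) surface_repD(1)[OF r, of 0]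
    by (metis (mono_tags, lifting) Homeos_less fixed_def min_less_iff_conj mem_Collect_eq)
  then obtain M2 where M2: "\<iota> M2 = e2" using rng e2 by (metis greaterThanLessThan_iff rangeE)
  define M where "M = max \<bar>M1\<bar> \<bar>M2\<bar>"
  have M: "M1 \<le> M" "- M \<le> M2" "0 \<le> M" unfolding M_def by linarith+
  obtain t where t: "surface_rep g t" "\<forall>j. \<forall>x\<in>{- M..M}. t j x = \<sigma> j x" "fixed t \<subseteq> fixed \<sigma>"
    "normal_right t" "normal_left t"
    by (rule normalize_ends[where M=M, OF rep g])
  have "tame g t" using t nofix' by (auto simp: tame_def)
  moreover have "\<bar>\<iota> (t j x) - \<rho> j (\<iota> x)\<bar> < \<epsilon>" for j x
  proof -
    have Hr: "\<rho> j \<in> Homeos" and Ht: "t j \<in> Homeos" using r t by (auto intro: surface_repD)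
    have b: "\<iota> (t j x) \<in> {u<..<v}" "\<rho> j (\<iota> x) \<in> {u<..<v}"
      using in_rng surface_rep_interval_invariant[OF r uv(1,2) in_rng] by auto
    consider "x \<in> {- M..M}" | "x > M" | "x < - M" by fastforce
    then show ?thesis
    proof cases
      case 1
      then show ?thesis using t(2) eps by (simp add: s)
    next
      case 2
      have "e1 \<le> \<iota> M" using M(1) mono by (simp add: strict_mono_less_eq flip: M1)
      then have l: "v - \<epsilon> < \<rho> j (\<iota> M)" using e1(2) Hr
        by (meson Homeos_le less_le_trans max_less_iff_conj)
      have "\<rho> j (\<iota> M) < \<rho> j (\<iota> x)" using 2 mono Hr by (simp add: Homeos_less strict_mono_less)
      moreover have "\<iota> (t j M) < \<iota> (t j x)" using 2 mono Ht by (simp add: Homeos_less strict_mono_less)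
      moreover have "\<iota> (t j M) = \<rho> j (\<iota> M)" using t(2) M by (simp add: s)
      ultimately show ?thesis using b l by (simp only: greaterThanLessThan_iff) linarith
    next
      case 3
      have "\<iota> (- M) \<le> e2" using M(2) mono by (simp add: strict_mono_less_eq flip: M2)
      then have l: "\<rho> j (\<iota> (- M)) < u + \<epsilon>" using e2(2) Hr
        by (meson Homeos_le le_less_trans min_less_iff_conj)
      have "\<rho> j (\<iota> x) < \<rho> j (\<iota> (- M))" using 3 mono Hr by (simp add: Homeos_less strict_mono_less)
      moreover have "\<iota> (t j x) < \<iota> (t j (- M))" using 3 mono Ht by (simp add: Homeos_less strict_mono_less)
      moreover have "\<iota> (t j (- M)) = \<rho> j (\<iota> (- M))" using t(2) M by (simp add: s)
      ultimately show ?thesis using b l by (simp only: greaterThanLessThan_iff) linarith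
    qed
  qed
  ultimately show "\<exists>t. tame g t \<and> (\<forall>j x. \<bar>\<iota> (t j x) - \<rho> j (\<iota> x)\<bar> < \<epsilon>)" by blast
qed


(* Dyn5 *)


lemma approximableE:
  assumes "approximable g \<rho> \<epsilon> u v" "u \<noteq> v" "strict_mono \<iota>" "range \<iota> = {u<..<v}"
  obtains t where "tame g t" "\<forall>j x. \<bar>\<iota> (t j x) - \<rho> j (\<iota> x)\<bar> < \<epsilon>"
proof -
  have "\<exists>t. tame g t \<and> (\<forall>j x. \<bar>\<iota> (t j x) - \<rho> j (\<iota> x)\<bar> < \<epsilon>)"
    using assms(1) unfolding approximable_def using assms(2-4) by simp
  then show ?thesis by (elim exE conjE) (rule that)
qed

lemma approximable_trans:
  assumes uy: "approximable g \<rho> \<epsilon> u y" and yv: "approximable g \<rho> \<epsilon> y v"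
    and le: "u \<le> y" "y \<le> v" and y: "y \<in> fixed \<rho>" and eps: "\<epsilon> > 0"
  shows "approximable g \<rho> \<epsilon> u v"
proof (cases "u = y \<or> y = v")
  case True
  then show ?thesis using uy yv by auto
next
  case False
  then have lt: "u < y" "y < v" using le by auto
  show ?thesis
    unfolding approximable_def
  proof (intro disjI2 allI impI)
    fix \<iota> :: "real \<Rightarrow> real"
    assume "strict_mono \<iota> \<and> range \<iota> = {u<..<v}"
    then have mono: "strict_mono \<iota>" and rng: "range \<iota> = {u<..<v}" by auto
    define c1 where "c1 = interval_chart u y"
    define c2 where "c2 = interval_chart y v"
    have c: "strict_mono c1" "range c1 = {u<..<y}" "strict_mono c2" "range c2 = {y<..<v}"
      unfolding c1_def c2_def using lt by (simp_all add: strict_mono_interval_chart range_interval_chart)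
    obtain t1 where t1: "tame g t1" "\<forall>j x. \<bar>c1 (t1 j x) - \<rho> j (c1 x)\<bar> < \<epsilon>"
      by (rule approximableE[OF uy _ c(1,2)]) (use lt in simp)
    obtain t2 where t2: "tame g t2" "\<forall>j x. \<bar>c2 (t2 j x) - \<rho> j (c2 x)\<bar> < \<epsilon>"
      by (rule approximableE[OF yv _ c(3,4)]) (use lt in simp)
    have "y \<in> range \<iota>" using rng lt by simp
    then obtain p where p: "\<iota> p = y" by blast
    define e1 where "e1 x = inv \<iota> (c1 x)" for x
    define e2 where "e2 x = inv \<iota> (c2 x)" for x
    have ie1: "\<iota> (e1 x) = c1 x" for x
    proof -
      have "c1 x \<in> {u<..<y}" using c(2) by blast
      then have "c1 x \<in> range \<iota>" using lt by (simp add: rng)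
      then show ?thesis unfolding e1_def by (rule f_inv_into_f)
    qed
    have ie2: "\<iota> (e2 x) = c2 x" for x
    proof -
      have "c2 x \<in> {y<..<v}" using c(4) by blast
      then have "c2 x \<in> range \<iota>" using lt by (simp add: rng)
      then show ?thesis unfolding e2_def by (rule f_inv_into_f)
    qed
    have m1: "strict_mono e1" 
    proof (rule strict_monoI)
      fix a b :: real assume "a < b"
      then have "\<iota> (e1 a) < \<iota> (e1 b)" using c(1) by (simp add: ie1 strict_mono_less)
      then show "e1 a < e1 b" using mono by (simp add: strict_mono_less)
    qed
    have m2: "strict_mono e2" 
    proof (rule strict_monoI)
      fix a b :: real assume "a < b"
      then have "\<iota> (e2 a) < \<iota> (e2 b)" using c(3) by (simp add: ie2 strict_mono_less)
      then show "e2 a < e2 b" using mono by (simp add: strict_mono_less)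
    qed
    have r1: "range e1 = {..<p}"
    proof (intro equalityI subsetI)
      fix x assume "x \<in> range e1"
      then obtain a where "x = e1 a" by blast
      moreover have "c1 a \<in> {u<..<y}" using c(2) by blast
      ultimately have "\<iota> x < \<iota> p" by (simp add: ie1 p)
      then show "x \<in> {..<p}" using mono by (simp add: strict_mono_less)
    next
      fix x assume "x \<in> {..<p}"
      then have "\<iota> x < y" using mono by (simp add: strict_mono_less flip: p)
      moreover have "\<iota> x \<in> {u<..<v}" using rng by blast
      ultimately have "\<iota> x < y" "u < \<iota> x" by simp_all
      then have "\<iota> x \<in> range c1" using c(2) by simp
      then obtain a where "\<iota> x = c1 a" by blast
      then have "\<iota> (e1 a) = \<iota> x" by (simp add: ie1)
      then have "e1 a = x" using mono by (simp add: strict_mono_eq)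
      then show "x \<in> range e1" by blast
    qed
    have r2: "range e2 = {p<..}"
    proof (intro equalityI subsetI)
      fix x assume "x \<in> range e2"
      then obtain a where "x = e2 a" by blast
      moreover have "c2 a \<in> {y<..<v}" using c(4) by blast
      ultimately have "\<iota> p < \<iota> x" by (simp add: ie2 p)
      then show "x \<in> {p<..}" using mono by (simp add: strict_mono_less)
    next
      fix x assume "x \<in> {p<..}"
      then have "y < \<iota> x" using mono by (simp add: strict_mono_less flip: p)
      moreover have "\<iota> x \<in> {u<..<v}" using rng by blast
      ultimately have "y < \<iota> x" "\<iota> x < v" by simp_all
      then have "\<iota> x \<in> range c2" using c(4) by simp
      then obtain a where "\<iota> x = c2 a" by blast
      then have "\<iota> (e2 a) = \<iota> x" by (simp add: ie2)
      then have "e2 a = x" using mono by (simp add: strict_mono_eq)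
      then show "x \<in> range e2" by blast
    qed
    define t where "t j x = (if x < p then e1 (t1 j (inv e1 x)) else if x = p then p else e2 (t2 j (inv e2 x)))" for j x
    have i1: "inv e1 (e1 x) = x" and i2: "inv e2 (e2 x) = x" for x
      using m1 m2 by (simp_all add: strict_mono_imp_inj_on)
    have te1: "t j (e1 x) = e1 (t1 j x)" for j x
    proof -
      have "e1 x < p" using r1 by blast
      then show ?thesis by (simp add: t_def i1)
    qed
    have te2: "t j (e2 x) = e2 (t2 j x)" for j x
    proof -
      have "p < e2 x" using r2 by blast
      then show ?thesis by (simp add: t_def i2)
    qed
    have tp: "t j p = p" for j by (simp add: t_def)
    have rep: "surface_rep g t"
    proof (rule assemble_surface_rep[where C="{p}"])
      show "t j c = c" if "c \<in> {p}" for c j using that tp by simp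
      fix x assume "x \<notin> {p}"
      then consider "x < p" | "p < x" by fastforce
      then show "\<exists>v \<iota>. surface_rep g v \<and> strict_mono \<iota> \<and> range \<iota> = {y. \<not> separated {p} x y} \<and>
                  (\<forall>j y. t j (\<iota> y) = \<iota> (v j y))"
      proof cases
        case 1
        then have "range e1 = {y. \<not> separated {p} x y}" unfolding r1 by (auto simp: separated_def)
        then show ?thesis using t1(1) m1 te1 by (auto simp: tame_def)
      next
        case 2
        then have "range e2 = {y. \<not> separated {p} x y}" unfolding r2 by (auto simp: separated_def)
        then show ?thesis using t2(1) m2 te2 by (auto simp: tame_def)
      qed
    qed
    have cases: "(\<exists>a. x = e1 a) \<or> x = p \<or> (\<exists>a. x = e2 a)" for x
    proof -
      have "x \<in> range e1 \<or> x = p \<or> x \<in> range e2" unfolding r1 r2 by auto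
      then show ?thesis by blast
    qed
    \<comment> \<open>the common shape of the three end conditions\<close>
    let ?N = "\<lambda>w y. w 3 y = y \<and> (w 0 y \<noteq> y \<or> w 1 y \<noteq> y)"
    have N1: "?N t (e1 a) \<longleftrightarrow> ?N t1 a" for a using m1 by (simp add: te1 strict_mono_eq)
    have N2: "?N t (e2 a) \<longleftrightarrow> ?N t2 a" for a using m2 by (simp add: te2 strict_mono_eq)
    obtain S1 where S1: "\<And>x. x \<ge> S1 \<Longrightarrow> ?N t1 x" using t1(1) by (auto simp: tame_def normal_right_def)
    obtain S1' where S1': "\<And>x. x \<le> S1' \<Longrightarrow> ?N t1 x" using t1(1) by (auto simp: tame_def normal_left_def)
    obtain S2 where S2: "\<And>x. x \<ge> S2 \<Longrightarrow> ?N t2 x" using t2(1) by (auto simp: tame_def normal_right_def)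
    obtain S2' where S2': "\<And>x. x \<le> S2' \<Longrightarrow> ?N t2 x" using t2(1) by (auto simp: tame_def normal_left_def)
    have e1p: "e1 a < p" and e2p: "p < e2 a" for a using r1 r2 by blast+
    have A1: "?N t x" if "e1 S1 \<le> x" "x < p" for x
    proof -
      have "x \<in> range e1" using that(2) by (simp add: r1)
      then obtain a where a: "x = e1 a" by blast
      with that(1) have "S1 \<le> a" using that(1) m1 by (simp add: strict_mono_less_eq)
      then show ?thesis using S1 N1 a by blast
    qed
    have A2: "?N t x" if "x \<le> e2 S2'" "p < x" for x
    proof -
      have "x \<in> range e2" using that(2) by (simp add: r2)
      then obtain a where a: "x = e2 a" by blast
      with that(1) have "a \<le> S2'" using that(1) m2 by (simp add: strict_mono_less_eq)
      then show ?thesis using S2' N2 a by blast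
    qed
    have nr: "normal_right t"
    proof -
      have "?N t x" if "x \<ge> e2 S2" for x
      proof -
        have "x \<in> range e2" using that e2p[of S2] by (simp add: r2)
        then obtain a where a: "x = e2 a" by blast
        then have "S2 \<le> a" using that m2 by (simp add: strict_mono_less_eq)
        then show ?thesis using S2 N2 a by blast
      qed
      then show ?thesis unfolding normal_right_def by blast
    qed
    have nl: "normal_left t"
    proof -
      have "?N t x" if "x \<le> e1 S1'" for x
      proof -
        have "x \<in> range e1" using that e1p[of S1'] by (simp add: r1)
        then obtain a where a: "x = e1 a" by blast
        then have "a \<le> S1'" using that m1 by (simp add: strict_mono_less_eq)
        then show ?thesis using S1' N1 a by blast
      qed
      then show ?thesis unfolding normal_left_def by blast
    qed
    have np: "normal_at t p"
    proof -
      define d where "d = min (p - e1 S1) (e2 S2' - p)"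
      have "d > 0" using e1p e2p by (simp add: d_def)
      moreover have "?N t y" if "y \<noteq> p" "\<bar>y - p\<bar> < d" for y
        using A1[of y] A2[of y] that by (cases "y < p") (auto simp: d_def)
      ultimately show ?thesis unfolding normal_at_def by blast
    qed
    have n1: "normal_at t (e1 a)" if "a \<in> fixed t1" for a
    proof (rule normal_at_transport[of e1 t t1, OF m1 te1])
      show "y \<in> range e1" if "e1 a \<le> y" "y \<le> e1 b" for a b y
        using that e1p[of b] unfolding r1 by simp
      show "normal_at t1 a" using that t1(1) by (simp add: tame_def)
    qed
    have n2: "normal_at t (e2 a)" if "a \<in> fixed t2" for a
    proof (rule normal_at_transport[of e2 t t2, OF m2 te2])
      show "y \<in> range e2" if "e2 a \<le> y" "y \<le> e2 b" for a b y
        using that e2p[of a] unfolding r2 by simp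
      show "normal_at t2 a" using that t2(1) by (simp add: tame_def)
    qed
    have "normal_at t x" if x: "x \<in> fixed t" for x
      using cases[of x]
    proof (elim disjE exE)
      fix a assume a: "x = e1 a"
      then show ?thesis using x n1 fixed_transport[of e1 t t1 a, OF m1 te1] by simp
    next
      fix a assume a: "x = e2 a"
      then show ?thesis using x n2 fixed_transport[of e2 t t2 a, OF m2 te2] by simp
    qed (use np in simp)
    then have "tame g t" using rep nr nl by (simp add: tame_def)
    moreover have "\<bar>\<iota> (t j x) - \<rho> j (\<iota> x)\<bar> < \<epsilon>" for j x
      using cases[of x]
    proof (elim disjE exE)
      fix a assume a: "x = e1 a"
      then show ?thesis using t1(2)[rule_format, of j a] by (simp add: te1 ie1)
    next
      fix a assume a: "x = e2 a"
      then show ?thesis using t2(2)[rule_format, of j a] by (simp add: te2 ie2)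
    next
      assume "x = p"
      then show ?thesis using tp[of j] p y eps by (simp add: fixed_def)
    qed
    ultimately show "\<exists>t. tame g t \<and> (\<forall>j x. \<bar>\<iota> (t j x) - \<rho> j (\<iota> x)\<bar> < \<epsilon>)" by blast
  qed
qed

lemma closed_fixed: 
  assumes "surface_rep g \<rho>" shows "closed (fixed \<rho>)"
proof -
  have "closed {x. \<rho> j x = x}" for j
    by (intro closed_Collect_eq Homeos_continuous_on continuous_on_id surface_repD[OF assms])
  then have "closed (\<Inter>j. {x. \<rho> j x = x})" by blast
  moreover have "fixed \<rho> = (\<Inter>j. {x. \<rho> j x = x})" by (auto simp: fixed_def)
  ultimately show ?thesis by simp
qed

lemma approximable_between_fixed_points:
  assumes g: "g \<ge> 1" and r: "surface_rep g \<rho>" and eps: "\<epsilon> > 0"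
  shows "u \<in> fixed \<rho> \<Longrightarrow> v \<in> fixed \<rho> \<Longrightarrow> u \<le> v \<Longrightarrow> v - u < real n * (\<epsilon> / 2) \<Longrightarrow> approximable g \<rho> \<epsilon> u v"
proof (induction n arbitrary: u)
  case (Suc n)
  have short: "approximable g \<rho> \<epsilon> a b" if "a \<in> fixed \<rho>" "b \<in> fixed \<rho>" "b - a < \<epsilon>" for a b
    using approximable_short[OF g r that] .
  show ?case
  proof (cases "v - u < \<epsilon>")
    case True
    then show ?thesis using short Suc.prems by blast
  next
    case False
    define m where "m = u + \<epsilon> / 2"
    define y1 where "y1 = Sup (fixed \<rho> \<inter> {u..m})"
    define y2 where "y2 = Inf (fixed \<rho> \<inter> {m..v})"
    have cl: "closed (fixed \<rho> \<inter> {u..m})" "closed (fixed \<rho> \<inter> {m..v})"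
      using closed_fixed[OF r] by auto
    have y1: "y1 \<in> fixed \<rho> \<inter> {u..m}"
      unfolding y1_def using Suc.prems eps by (intro closed_contains_Sup cl) (auto simp: m_def)
    have y2: "y2 \<in> fixed \<rho> \<inter> {m..v}"
      unfolding y2_def using Suc.prems eps False by (intro closed_contains_Inf cl) (auto simp: m_def)
    have gap: "fixed \<rho> \<inter> {y1<..<y2} = {}"
    proof -
      have False if x: "x \<in> fixed \<rho>" "y1 < x" "x < y2" for x
      proof (cases "x \<le> m")
        case True
        then have "x \<le> y1" unfolding y1_def using x y1 by (intro cSup_upper) auto
        then show False using x by simp
      next
        case False
        then have "y2 \<le> x" unfolding y2_def using x y2 by (intro cInf_lower) auto
        then show False using x by simp
      qed
      then show ?thesis by auto
    qed
    have 1: "approximable g \<rho> \<epsilon> u y1" using Suc.prems y1 eps by (intro short) (auto simp: m_def)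
    have 2: "approximable g \<rho> \<epsilon> y1 y2"
    proof (cases "y1 = y2")
      case False
      then show ?thesis using approximable_gap[OF g r _ _ _ gap eps] y1 y2 by auto
    qed (simp add: approximable_def)
    have "v - y2 < real n * (\<epsilon> / 2)"
      using Suc.prems(4) y2 by (simp add: m_def algebra_simps add_divide_distrib)
    then have 3: "approximable g \<rho> \<epsilon> y2 v" using Suc.IH[of y2] y2 Suc.prems by auto
    have "approximable g \<rho> \<epsilon> u y2"
      using approximable_trans[OF 1 2] y1 y2 eps by auto
    from approximable_trans[OF this 3] show ?thesis using y1 y2 eps by auto
  qed
qed (auto simp: approximable_def)


(* Dyn6 *)


lemma bend_off_fixed_points:
  assumes w: "surface_rep g w" and g: "g \<ge> 2" and z: "z \<in> Homeos"
    and moved: "\<And>y. z y \<noteq> y \<Longrightarrow> w 3 y = y \<and> (w 0 y \<noteq> y \<or> w 1 y \<noteq> y \<or> y \<in> fixed w)"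
    and all: "\<And>p. p \<in> fixed w \<Longrightarrow> z p \<noteq> p"
  shows "surface_rep g (w(2 := w 2 \<circ> z))" and "fixed (w(2 := w 2 \<circ> z)) = {}"
proof -
  let ?v = "w(2 := w 2 \<circ> z)"
  have H: "w j \<in> Homeos" for j using w by (rule surface_repD)
  have com: "z \<circ> w (2 * 1 + 1) = w (2 * 1 + 1) \<circ> z"
  proof
    fix y
    show "(z \<circ> w (2 * 1 + 1)) y = (w (2 * 1 + 1) \<circ> z) y"
    proof (cases "z y = y")
      case True
      have "z (w 3 y) = w 3 y"
      proof (rule ccontr)
        assume ne: "z (w 3 y) \<noteq> w 3 y"
        then have "w 3 (w 3 y) = w 3 y" using moved by blast
        then have "w 3 y = y" using H[of 3] by (simp add: Homeos_eq)
        then show False using ne True by simp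
      qed
      then show ?thesis using True by simp
    next
      case False
      then have "z (z y) \<noteq> z y" using z by (simp add: Homeos_eq)
      then have "w 3 (z y) = z y" "w 3 y = y" using moved False by blast+
      then show ?thesis by simp
    qed
  qed
  show "surface_rep g ?v"
    using surface_rep_bend[OF w z com] g by simp
  have False if x: "x \<in> fixed ?v" for x
  proof -
    have fx: "?v j x = x" for j using x by (simp only: fixed_def mem_Collect_eq)
    have v: "w j x = x" if "j \<noteq> 2" for j using fx[of j] that by simp
    have v2: "w 2 (z x) = x" using fx[of 2] by simp
    show False
    proof (cases "z x = x")
      case True
      then have "w j x = x" for j using v v2 by (cases "j = 2") auto
      then show False using all[of x] True by (simp add: fixed_def)
    next
      case False
      then have "x \<in> fixed w" using moved[OF False] v[of 0] v[of 1] by simp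
      then have "w 2 x = w 2 (z x)" using v2 by (simp add: fixed_def)
      then show False using False H[of 2] by (simp add: Homeos_eq)
    qed
  qed
  then show "fixed ?v = {}" by blast
qed

definition push_off :: "real set \<Rightarrow> real \<Rightarrow> real \<Rightarrow> real" where
  "push_off C \<epsilon> x = x + \<epsilon> * min 1 (infdist x C)"

lemma push_off_Homeos:
  assumes "0 \<le> \<epsilon>" "\<epsilon> < 1"
  shows "push_off C \<epsilon> \<in> Homeos"
proof (rule HomeosI)
  fix x y :: real assume xy: "x < y"
  have "\<bar>infdist x C - infdist y C\<bar> \<le> y - x"
    using infdist_triangle_abs[of x C y] xy by (simp add: dist_real_def)
  then have "min 1 (infdist x C) - min 1 (infdist y C) \<le> y - x" using xy by (auto simp: min_def)
  then have "\<epsilon> * (min 1 (infdist x C) - min 1 (infdist y C)) \<le> \<epsilon> * (y - x)"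
    using assms by (intro mult_left_mono) auto
  also have "\<dots> < 1 * (y - x)" using assms xy by (intro mult_strict_right_mono) auto
  finally show "push_off C \<epsilon> x < push_off C \<epsilon> y" by (simp add: push_off_def algebra_simps)
next
  fix y
  have cont: "continuous_on {y - 1..y} (push_off C \<epsilon>)"
    unfolding push_off_def by (intro continuous_intros)
  have "\<epsilon> * min 1 (infdist (y - 1) C) \<le> 1 * 1"
    using assms infdist_nonneg[of "y - 1" C] by (intro mult_mono) auto
  then have "push_off C \<epsilon> (y - 1) \<le> y" by (simp add: push_off_def)
  moreover have "y \<le> push_off C \<epsilon> y" using assms infdist_nonneg[of y C] by (simp add: push_off_def)
  ultimately show "\<exists>x. push_off C \<epsilon> x = y" using IVT'[OF _ _ _ cont] by fastforce
qed

lemma push_off_eq_iff: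
  assumes "C \<noteq> {}" "0 < \<epsilon>"
  shows "push_off C \<epsilon> x = x \<longleftrightarrow> x \<in> closure C"
  using assms infdist_nonneg[of x C] by (auto simp: push_off_def in_closure_iff_infdist_zero min_def)

definition regular_reps :: "nat \<Rightarrow> (nat \<Rightarrow> real \<Rightarrow> real) set" where
  "regular_reps g = {w. surface_rep g w \<and> fixed w = {} \<and> normal_right w \<and> normal_left w}"

lemma tendsto_fun:
  fixes f :: "'b \<Rightarrow> 'i \<Rightarrow> 'a::topological_space"
  assumes "\<And>i. ((\<lambda>n. f n i) \<longlongrightarrow> l i) F"
  shows "(f \<longlongrightarrow> l) F"
proof -
  have "limitin (product_topology (\<lambda>_. euclidean) UNIV) f l F"
    unfolding limitin_componentwise using assms by simp
  then show ?thesis by (simp add: euclidean_product_topology)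
qed

lemma in_closure_sequentially:
  fixes f :: "nat \<Rightarrow> 'a::topological_space"
  assumes "f \<longlonglongrightarrow> l" "\<And>n. f n \<in> S"
  shows "l \<in> closure S"
proof -
  have "f n \<in> closure S" for n using assms(2) closure_subset by blast
  then show ?thesis by (intro Lim_in_closed_set[OF closed_closure _ _ assms(1)]) simp_all
qed

lemma pointwise_limit_in_closure:
  fixes w :: "nat \<Rightarrow> real \<Rightarrow> real"
  assumes "\<And>n. f n \<in> S" "\<And>j x. (\<lambda>n. f n j x) \<longlonglongrightarrow> w j x"
  shows "w \<in> closure S"
  using assms by (intro in_closure_sequentially[of f]) (auto intro!: tendsto_fun)

lemma tame_in_closure_regular:
  assumes t: "tame g t" and g: "g \<ge> 2"
  shows "t \<in> closure (regular_reps g)"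
proof -
  have rep: "surface_rep g t" using t by (simp add: tame_def)
  let ?N = "\<lambda>w y. w 3 y = y \<and> (w 0 y \<noteq> y \<or> w 1 y \<noteq> y)"
  have "\<forall>p. \<exists>d. p \<in> fixed t \<longrightarrow> d > 0 \<and> (\<forall>y. y \<noteq> p \<and> \<bar>y - p\<bar> < d \<longrightarrow> ?N t y)"
    using t unfolding tame_def normal_at_def by blast
  then obtain d where d: "\<forall>p. p \<in> fixed t \<longrightarrow> d p > 0 \<and> (\<forall>y. y \<noteq> p \<and> \<bar>y - p\<bar> < d p \<longrightarrow> ?N t y)"
    unfolding choice_iff by blast
  obtain S where S: "\<And>x. x \<ge> S \<Longrightarrow> ?N t x" using t by (auto simp: tame_def normal_right_def)
  have S': "S \<notin> fixed t" using S[of S] by (auto simp: fixed_def)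
  define C where "C = insert S {y. \<forall>p\<in>fixed t. \<bar>y - p\<bar> \<ge> d p}"
  have C: "C \<noteq> {}" by (simp add: C_def)
  have off: "p \<notin> closure C" if p: "p \<in> fixed t" for p
  proof
    assume "p \<in> closure C"
    moreover define e where "e = min (d p) \<bar>S - p\<bar>"
    moreover have "e > 0" using d p S' by (auto simp: e_def)
    ultimately obtain y where y: "y \<in> C" "\<bar>y - p\<bar> < e"
      unfolding closure_approachable dist_real_def by blast
    then show False using p by (auto simp: C_def e_def)
  qed
  have near: "t 3 y = y \<and> (t 0 y \<noteq> y \<or> t 1 y \<noteq> y \<or> y \<in> fixed t)" if y: "y \<notin> C" for y
  proof -
    obtain p where p: "p \<in> fixed t" "\<bar>y - p\<bar> < d p" using y by (auto simp: C_def not_le)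
    show ?thesis
    proof (cases "y = p")
      case True
      then show ?thesis using p(1) by (simp add: fixed_def)
    next
      case False
      then show ?thesis using d p by blast
    qed
  qed
  define e where "e n = 1 / real (n + 2)" for n
  have e: "0 < e n" "e n < 1" for n by (auto simp: e_def)
  define f where "f n = t(2 := t 2 \<circ> push_off C (e n))" for n
  have z: "push_off C (e n) \<in> Homeos" for n using e[of n] by (intro push_off_Homeos) auto
  show ?thesis
  proof (rule pointwise_limit_in_closure[of f])
    fix n
    have m: "t 3 y = y \<and> (t 0 y \<noteq> y \<or> t 1 y \<noteq> y \<or> y \<in> fixed t)" if "push_off C (e n) y \<noteq> y" for y
    proof (rule near)
      show "y \<notin> C" using that push_off_eq_iff[OF C e(1)] closure_subset by blast
    qed
    have a: "push_off C (e n) p \<noteq> p" if "p \<in> fixed t" for p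
      using push_off_eq_iff[OF C e(1)] off[OF that] by simp
    from bend_off_fixed_points[OF rep g z m a]
    show "f n \<in> regular_reps g"
      using t by (simp add: f_def regular_reps_def tame_def normal_right_def normal_left_def)
  next
    fix j x
    have "(\<lambda>n. push_off C (e n) x) \<longlonglongrightarrow> x + 0 * min 1 (infdist x C)"
      unfolding push_off_def e_def by (intro tendsto_intros LIMSEQ_ignore_initial_segment lim_1_over_n)
    then have "(\<lambda>n. t 2 (push_off C (e n) x)) \<longlonglongrightarrow> t 2 x"
      using surface_repD(1)[OF rep, of 2] by (intro isCont_tendsto_compose[of _ "t 2"]) auto
    then show "(\<lambda>n. f n j x) \<longlonglongrightarrow> t j x" by (cases "j = 2") (auto simp: f_def)
  qed
qed

definition squeeze :: "real \<Rightarrow> real \<Rightarrow> real" where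
  "squeeze m x = (if x > m then m + (x - m) / (1 + (x - m)) else
                  if x < - m then - m - (- x - m) / (1 + (- x - m)) else x)"

lemma squeeze_id: "\<bar>x\<bar> \<le> m \<Longrightarrow> squeeze m x = x" by (auto simp: squeeze_def)

lemma squeeze_bounds:
  assumes "m \<ge> 0"
  shows "x > m \<Longrightarrow> m < squeeze m x \<and> squeeze m x < m + 1"
    and "x < - m \<Longrightarrow> - m - 1 < squeeze m x \<and> squeeze m x < - m"
proof -
  show "m < squeeze m x \<and> squeeze m x < m + 1" if "x > m"
    using that by (simp add: squeeze_def)
  assume x: "x < - m"
  define y where "y = - x - m"
  have y: "y > 0" using x by (simp add: y_def)
  have "squeeze m x = - m - y / (1 + y)"
    using x assms by (simp add: squeeze_def y_def)
  moreover have "0 < y / (1 + y)" "y / (1 + y) < 1" using y by auto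
  ultimately show "- m - 1 < squeeze m x \<and> squeeze m x < - m" by linarith
qed

lemma strict_mono_squeeze:
  assumes "m \<ge> 0" shows "strict_mono (squeeze m)"
proof (rule strict_monoI)
  have frac: "a / (1 + a) < b / (1 + b)" if "0 < a" "a < b" for a b :: real
    using that by (simp add: divide_simps) (simp add: algebra_simps)
  fix x y :: real assume xy: "x < y"
  consider "x > m" | "y < - m" | "x \<le> m" "y \<ge> - m" by linarith
  then show "squeeze m x < squeeze m y"
  proof cases
    case 1
    then show ?thesis using xy frac[of "x - m" "y - m"] by (simp add: squeeze_def)
  next
    case 2
    then have "(- y - m) / (1 + (- y - m)) < (- x - m) / (1 + (- x - m))"
      using xy frac[of "- y - m" "- x - m"] by simp
    then show ?thesis using xy 2 assms by (simp add: squeeze_def)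
  next
    case 3
    have "squeeze m x \<le> m" "x < - m \<or> squeeze m x = x"
      using 3 squeeze_bounds(2)[OF assms, of x] assms squeeze_id[of x m] by (force simp: abs_le_iff)+
    moreover have "- m \<le> squeeze m y" "y > m \<or> squeeze m y = y"
      using 3 squeeze_bounds(1)[OF assms, of y] assms squeeze_id[of y m] by (force simp: abs_le_iff)+
    ultimately show ?thesis
      using xy 3 squeeze_bounds(2)[OF assms, of x] squeeze_bounds(1)[OF assms, of y] assms by linarith
  qed
qed

lemma range_squeeze:
  assumes "m \<ge> 0" shows "range (squeeze m) = {- m - 1<..<m + 1}"
proof (intro equalityI subsetI)
  fix y assume "y \<in> range (squeeze m)"
  then obtain x where x: "y = squeeze m x" by blast
  consider "x > m" | "x < - m" | "\<bar>x\<bar> \<le> m" by linarith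
  then show "y \<in> {- m - 1<..<m + 1}"
    using squeeze_bounds[OF assms, of x] assms squeeze_id[of x m] x by cases auto
next
  fix y assume y: "y \<in> {- m - 1<..<m + 1}"
  consider "y > m" | "y < - m" | "\<bar>y\<bar> \<le> m" by linarith
  then show "y \<in> range (squeeze m)"
  proof cases
    case 1
    define x where "x = m + (y - m) / (1 - (y - m))"
    have "(x - m) * (1 - (y - m)) = y - m" "x > m" using 1 y by (simp_all add: x_def)
    then have "squeeze m x = y" by (simp add: squeeze_def divide_simps) (simp add: algebra_simps)
    then show ?thesis by blast
  next
    case 2
    define x where "x = - (m + (- y - m) / (1 - (- y - m)))"
    have "(- x - m) * (1 - (- y - m)) = - y - m" "x < - m" using 2 y by (simp_all add: x_def)
    then have "squeeze m x = y" using assms by (simp add: squeeze_def divide_simps) (simp add: algebra_simps)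
    then show ?thesis by blast
  next
    case 3
    then show ?thesis using squeeze_id[of y m] by (metis rangeI)
  qed
qed

lemma surface_rep_in_closure_tame:
  assumes r: "surface_rep g \<rho>" and g: "g \<ge> 1"
  shows "\<rho> \<in> closure {t. tame g t}"
proof -
  have "\<exists>t. tame g t \<and> (\<forall>j x. \<bar>squeeze m (t j x) - squeeze m (\<rho> j x)\<bar> < \<epsilon>)"
    if m: "m \<ge> 0" and eps: "\<epsilon> > 0" for m \<epsilon> :: real
  proof -
    define u v where "u = - m - 1" and "v = m + 1"
    have mono: "strict_mono (squeeze m)" and rng: "range (squeeze m) = {u<..<v}"
      unfolding u_def v_def using m by (auto simp: strict_mono_squeeze range_squeeze)
    define \<sigma> where "\<sigma> j y = (if y \<in> {u<..<v} then squeeze m (\<rho> j (inv (squeeze m) y)) else y)" for j y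
    have s: "\<sigma> j (squeeze m x) = squeeze m (\<rho> j x)" for j x
    proof -
      have "squeeze m x \<in> {u<..<v}" using rng by blast
      moreover have "inv (squeeze m) (squeeze m x) = x" using mono by (simp add: strict_mono_imp_inj_on)
      ultimately show ?thesis by (simp add: \<sigma>_def)
    qed
    have rep: "surface_rep g \<sigma>"
    proof (rule assemble_surface_rep[where C="- {u<..<v}"])
      show "\<sigma> j c = c" if "c \<in> - {u<..<v}" for c j using that by (auto simp: \<sigma>_def)
      fix x assume "x \<notin> - {u<..<v}"
      then have "{u<..<v} = {y. \<not> separated (- {u<..<v}) x y}"
        by (auto simp: separated_def not_less; force)
      then show "\<exists>w \<iota>. surface_rep g w \<and> strict_mono \<iota> \<and> range \<iota> = {y. \<not> separated (- {u<..<v}) x y} \<and>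
                  (\<forall>j y. \<sigma> j (\<iota> y) = \<iota> (w j y))"
        using r mono s rng by (intro exI[of _ \<rho>] exI[of _ "squeeze m"]) auto
    qed
    have fx: "u \<in> fixed \<sigma>" "v \<in> fixed \<sigma>" by (auto simp: fixed_def \<sigma>_def)
    obtain n where "real n > (v - u) / (\<epsilon> / 2)" using reals_Archimedean2 by blast
    then have "v - u < real n * (\<epsilon> / 2)" using eps by (simp add: field_simps)
    moreover have uv: "u \<le> v" "u \<noteq> v" using m by (auto simp: u_def v_def)
    ultimately have "approximable g \<sigma> \<epsilon> u v"
      using approximable_between_fixed_points[OF g rep eps fx] by blast
    then obtain t where "tame g t" "\<forall>j x. \<bar>squeeze m (t j x) - \<sigma> j (squeeze m x)\<bar> < \<epsilon>"
      by (rule approximableE[OF _ uv(2) mono rng])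
    then show ?thesis unfolding s by blast
  qed
  then have "\<forall>n. \<exists>t. tame g t \<and> (\<forall>j x. \<bar>squeeze (real n) (t j x) - squeeze (real n) (\<rho> j x)\<bar> < 1 / real (Suc n))"
    by simp
  then obtain f where f: "\<forall>n. tame g (f n) \<and> (\<forall>j x. \<bar>squeeze (real n) (f n j x) - squeeze (real n) (\<rho> j x)\<bar> < 1 / real (Suc n))"
    unfolding choice_iff by blast
  show ?thesis
  proof (rule pointwise_limit_in_closure[of f])
    show "f n \<in> {t. tame g t}" for n using f by simp
    fix j x
    obtain N where N: "\<bar>\<rho> j x\<bar> + 1 \<le> real N" using real_arch_simple by blast
    have "\<bar>f n j x - \<rho> j x\<bar> \<le> 1 / real (Suc n)" if n: "n \<ge> N" for n
    proof -
      have n': "\<bar>\<rho> j x\<bar> + 1 \<le> real n" using N n by linarith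
      have c: "\<bar>squeeze (real n) (f n j x) - \<rho> j x\<bar> < 1 / real (Suc n)"
        using f[THEN spec, of n, THEN conjunct2, THEN spec, of j, THEN spec, of x] squeeze_id[of "\<rho> j x" "real n"] n' by simp
      have "1 / real (Suc n) \<le> 1" by simp
      then have b: "\<bar>squeeze (real n) (f n j x)\<bar> < real n" using c n' by linarith
      have "\<bar>f n j x\<bar> \<le> real n"
        using squeeze_bounds[of "real n" "f n j x"] b by linarith
      then show ?thesis using c squeeze_id by simp
    qed
    then have "eventually (\<lambda>n. norm (f n j x - \<rho> j x) \<le> 1 / real (Suc n)) sequentially"
      unfolding eventually_sequentially by auto
    moreover have "(\<lambda>n. 1 / real (Suc n)) \<longlonglongrightarrow> 0" by (rule LIMSEQ_Suc[OF lim_1_over_n])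
    ultimately have "(\<lambda>n. f n j x - \<rho> j x) \<longlonglongrightarrow> 0" by (rule Lim_null_comparison)
    then show "(\<lambda>n. f n j x) \<longlonglongrightarrow> \<rho> j x" by (simp add: LIM_zero_iff)
  qed
qed

lemma surface_reps_subset_closure_regular:
  assumes "g \<ge> 2"
  shows "{\<rho>. surface_rep g \<rho>} \<subseteq> closure (regular_reps g)"
proof -
  have "{t. tame g t} \<subseteq> closure (regular_reps g)" using tame_in_closure_regular assms by blast
  then have "closure {t. tame g t} \<subseteq> closure (regular_reps g)" by (simp add: closure_minimal)
  then show ?thesis using surface_rep_in_closure_tame assms by fastforce
qed


(* Dyn7 *)


lemma monotone_pointwise_limit:
  fixes F :: "'b \<Rightarrow> real \<Rightarrow> real"
  assumes mono: "\<And>n. F n \<in> Homeos" and f: "f \<in> Homeos"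
    and lim: "\<And>q. ((\<lambda>n. F n (of_rat q)) \<longlongrightarrow> f (of_rat q)) G"
  shows "((\<lambda>n. F n x) \<longlongrightarrow> f x) G"
proof (rule order_tendstoI)
  fix a assume a: "a < f x"
  then have "inv f a < x" using f by (simp add: Homeos_inv_less_iff)
  then obtain q where q: "inv f a < of_rat q" "of_rat q < x" using of_rat_dense by blast
  then have "a < f (of_rat q)" using f by (simp add: Homeos_inv_less_iff)
  then have "eventually (\<lambda>n. a < F n (of_rat q)) G" using lim by (rule order_tendstoD(1)[rotated])
  then show "eventually (\<lambda>n. a < F n x) G"
  proof eventually_elim
    case (elim n)
    have "F n (of_rat q) < F n x" using mono[of n] q(2) by (simp add: Homeos_less)
    then show ?case using elim by linarith
  qed
next
  fix a assume a: "f x < a"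
  then have "x < inv f a" using f by (simp add: Homeos_less_inv_iff)
  then obtain q where q: "x < of_rat q" "of_rat q < inv f a" using of_rat_dense by blast
  then have "f (of_rat q) < a" using f by (simp add: Homeos_less_inv_iff)
  then have "eventually (\<lambda>n. F n (of_rat q) < a) G" using lim by (rule order_tendstoD(2)[rotated])
  then show "eventually (\<lambda>n. F n x < a) G"
  proof eventually_elim
    case (elim n)
    have "F n x < F n (of_rat q)" using mono[of n] q(1) by (simp add: Homeos_less)
    then show ?case using elim by linarith
  qed
qed

lemma tendsto_fun_component:
  fixes f :: "'b \<Rightarrow> 'i \<Rightarrow> 'a::topological_space"
  assumes "(f \<longlongrightarrow> l) F"
  shows "((\<lambda>n. f n i) \<longlongrightarrow> l i) F"
proof -
  have "limitin (product_topology (\<lambda>_. euclidean) UNIV) f l F"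
    using assms by (simp add: euclidean_product_topology)
  then show ?thesis unfolding limitin_componentwise by simp
qed

lemma countable_dense_subset:
  fixes S :: "(nat \<Rightarrow> real \<Rightarrow> real) set"
  assumes H: "\<forall>w\<in>S. \<forall>j. w j \<in> Homeos"
  obtains T where "countable T" "T \<subseteq> S" "S \<subseteq> closure T"
proof -
  define R where "R w = (\<lambda>p :: nat \<times> rat. w (fst p) (of_rat (snd p)) :: real)" for w :: "nat \<Rightarrow> real \<Rightarrow> real"
  obtain A where A: "countable A" "A \<subseteq> R ` S" "R ` S \<subseteq> closure A"
    by (rule separable)
  define T where "T = inv_into S R ` A"
  have T: "countable T" "T \<subseteq> S"
    using A unfolding T_def by (auto intro: inv_into_into)
  have "w \<in> closure T" if w: "w \<in> S" for w
  proof -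
    have "R w \<in> closure A" using A w by blast
    then obtain f where f: "\<forall>n. f n \<in> A" "f \<longlonglongrightarrow> R w"
      unfolding closure_sequential by blast
    define v where "v n = inv_into S R (f n)" for n
    have vT: "v n \<in> T" for n using f(1) by (simp add: v_def T_def)
    have Rv: "R (v n) = f n" for n
    proof -
      have "f n \<in> R ` S" using f(1) A(2) by blast
      then show ?thesis unfolding v_def by (rule f_inv_into_f)
    qed
    have q: "(\<lambda>n. v n j (of_rat q)) \<longlonglongrightarrow> w j (of_rat q)" for j q
    proof -
      have "(\<lambda>n. f n (j, q)) \<longlonglongrightarrow> R w (j, q)"
        using f(2) by (rule tendsto_fun_component)
      then show ?thesis unfolding Rv[symmetric] by (simp add: R_def)
    qed
    show ?thesis
    proof (rule pointwise_limit_in_closure[of v])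
      show "v n \<in> T" for n by (rule vT)
      have vH: "v n j \<in> Homeos" for n j using H T(2) vT by blast
      have wH: "w j \<in> Homeos" for j using H w by blast
      show "(\<lambda>n. v n j x) \<longlonglongrightarrow> w j x" for j x
        by (rule monotone_pointwise_limit[where F="\<lambda>n. v n j" and f="w j", OF vH wH q])
    qed
  qed
  then show ?thesis using that T by blast
qed

lemma extend_to_Homeos:
  assumes mono: "strict_mono \<iota>" and conv: "\<And>a b y. \<iota> a \<le> y \<Longrightarrow> y \<le> \<iota> b \<Longrightarrow> y \<in> range \<iota>" and m: "m \<ge> 0"
  obtains \<phi> where "\<phi> \<in> Homeos" "\<forall>x\<in>{- m..m}. \<phi> x = \<iota> x"
proof -
  define \<phi> where "\<phi> x = (if x < - m then \<iota> (- m) + (x + m) else if x \<le> m then \<iota> x else \<iota> m + (x - m))" for x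
  have "\<phi> \<in> Homeos"
  proof (rule HomeosI)
    fix x y :: real assume xy: "x < y"
    have "\<iota> a \<le> \<iota> b \<longleftrightarrow> a \<le> b" "\<iota> a < \<iota> b \<longleftrightarrow> a < b" for a b
      using mono by (simp_all add: strict_mono_less_eq strict_mono_less)
    then show "\<phi> x < \<phi> y"
      using xy m unfolding \<phi>_def by (smt (verit))
  next
    fix y
    consider "y < \<iota> (- m)" | "y > \<iota> m" | "\<iota> (- m) \<le> y" "y \<le> \<iota> m" by linarith
    then show "\<exists>x. \<phi> x = y"
    proof cases
      case 1
      then show ?thesis by (intro exI[of _ "y - \<iota> (- m) - m"]) (simp add: \<phi>_def)
    next
      case 2
      then show ?thesis using m by (intro exI[of _ "y - \<iota> m + m"]) (simp add: \<phi>_def)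
    next
      case 3
      then obtain x where x: "y = \<iota> x" using conv by blast
      then have "- m \<le> x" "x \<le> m" using 3 mono by (simp_all add: strict_mono_less_eq)
      then show ?thesis using x by (intro exI[of _ x]) (simp add: \<phi>_def)
    qed
  qed
  then show ?thesis by (rule that) (simp add: \<phi>_def)
qed

definition conjugates :: "(nat \<Rightarrow> real \<Rightarrow> real) \<Rightarrow> (nat \<Rightarrow> real \<Rightarrow> real) set" where
  "conjugates w = {\<lambda>j. \<psi> \<circ> w j \<circ> inv \<psi> | \<psi>. \<psi> \<in> Homeos}"

lemma regular_rep_normal_outside:
  assumes "w \<in> regular_reps g"
  obtains M where "M \<ge> m" "M \<ge> 0" "\<forall>x. \<bar>x\<bar> > M \<longrightarrow> w 3 x = x \<and> (w 0 x \<noteq> x \<or> w 1 x \<noteq> x)"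
proof -
  obtain S where S: "\<forall>x\<ge>S. w 3 x = x \<and> (w 0 x \<noteq> x \<or> w 1 x \<noteq> x)"
    using assms unfolding regular_reps_def normal_right_def by blast
  obtain S' where S': "\<forall>x\<le>S'. w 3 x = x \<and> (w 0 x \<noteq> x \<or> w 1 x \<noteq> x)"
    using assms unfolding regular_reps_def normal_left_def by blast
  show ?thesis
  proof (rule that[of "max (max m 0) (max \<bar>S\<bar> \<bar>S'\<bar>)"])
    show "\<forall>x. \<bar>x\<bar> > max (max m 0) (max \<bar>S\<bar> \<bar>S'\<bar>) \<longrightarrow> w 3 x = x \<and> (w 0 x \<noteq> x \<or> w 1 x \<noteq> x)"
    proof (intro allI impI)
      fix x assume x: "\<bar>x\<bar> > max (max m 0) (max \<bar>S\<bar> \<bar>S'\<bar>)"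
      then have "x \<ge> S \<or> x \<le> S'" by auto
      then show "w 3 x = x \<and> (w 0 x \<noteq> x \<or> w 1 x \<noteq> x)" using S S' by blast
    qed
  qed auto
qed

lemma floor_unit_interval: "x \<in> {real_of_int n<..<real_of_int n + 1} \<Longrightarrow> \<lfloor>x\<rfloor> = n \<and> x \<notin> \<int>"
proof -
  assume x: "x \<in> {real_of_int n<..<real_of_int n + 1}"
  then have "\<lfloor>x\<rfloor> = n" by (simp add: floor_unique)
  then show ?thesis using x by (auto elim!: Ints_cases)
qed

lemma separated_Ints:
  assumes "x \<notin> \<int>"
  shows "{y. \<not> separated \<int> x y} = {real_of_int \<lfloor>x\<rfloor><..<real_of_int \<lfloor>x\<rfloor> + 1}"
proof -
  let ?n = "\<lfloor>x\<rfloor>"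
  have x: "real_of_int ?n < x" "x < real_of_int ?n + 1"
    using assms Ints_of_int[of ?n] by (metis floor_correct less_eq_real_def, linarith)
  show ?thesis
  proof (intro equalityI subsetI)
    fix y assume y: "y \<in> {y. \<not> separated \<int> x y}"
    have "real_of_int ?n \<in> \<int>" "real_of_int (?n + 1) \<in> \<int>" by (rule Ints_of_int)+
    then have "\<not> (y \<le> real_of_int ?n)" "\<not> (real_of_int (?n + 1) \<le> y)"
      using y x unfolding separated_def by force+
    then show "y \<in> {real_of_int ?n<..<real_of_int ?n + 1}" by simp
  next
    fix y assume y: "y \<in> {real_of_int ?n<..<real_of_int ?n + 1}"
    have False if c: "c \<in> \<int>" "x \<le> c \<and> c \<le> y \<or> y \<le> c \<and> c \<le> x" for c
    proof -
      have "c \<in> {real_of_int ?n<..<real_of_int ?n + 1}" using c(2) x y unfolding greaterThanLessThan_iff by linarith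
      then show False using floor_unit_interval c(1) by blast
    qed
    then show "y \<in> {y. \<not> separated \<int> x y}" unfolding separated_def by blast
  qed
qed

theorem surface_rep_dense_conjugates:
  assumes g: "g \<ge> 2"
  shows "\<exists>\<theta>. surface_rep g \<theta> \<and> fixed \<theta> = {} \<and> {\<rho>. surface_rep g \<rho>} \<subseteq> closure (conjugates \<theta>)"
proof -
  have regH: "\<forall>w\<in>regular_reps g. \<forall>j. w j \<in> Homeos"
    by (simp add: regular_reps_def surface_rep_def)
  obtain T where T: "countable T" "T \<subseteq> regular_reps g" "regular_reps g \<subseteq> closure T"
    by (rule countable_dense_subset[OF regH])
  have "T \<noteq> {}"
  proof
    assume "T = {}"
    then have "regular_reps g = {}" using T(3) by simp
    then show False using surface_reps_subset_closure_regular[OF g] surface_rep_id[of g] by auto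
  qed
  define W where "W = from_nat_into T"
  have W: "range W = T" unfolding W_def by (rule range_from_nat_into[OF \<open>T \<noteq> {}\<close> T(1)])
  define V where "V n = W (fst (prod_decode (nat n)))" for n :: int
  define m where "m n = real (snd (prod_decode (nat n)))" for n :: int
  have Vreg: "V n \<in> regular_reps g" for n using W T(2) unfolding V_def by blast
  have Vrep: "surface_rep g (V n)" and Vfix: "fixed (V n) = {}" for n
    using Vreg[of n] by (auto simp: regular_reps_def)
  have "\<forall>n. \<exists>M. M \<ge> m n \<and> M \<ge> 0 \<and> (\<forall>x. \<bar>x\<bar> > M \<longrightarrow> V n 3 x = x \<and> (V n 0 x \<noteq> x \<or> V n 1 x \<noteq> x))"
    using regular_rep_normal_outside[OF Vreg] by metis
  then obtain M where M: "\<forall>n. M n \<ge> m n \<and> M n \<ge> 0 \<and> (\<forall>x. \<bar>x\<bar> > M n \<longrightarrow> V n 3 x = x \<and> (V n 0 x \<noteq> x \<or> V n 1 x \<noteq> x))"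
    unfolding choice_iff by blast
  define \<iota> where "\<iota> n = interval_chart (real_of_int n) (real_of_int n + 1)" for n
  have mono: "strict_mono (\<iota> n)" and rng: "range (\<iota> n) = {real_of_int n<..<real_of_int n + 1}" for n
    unfolding \<iota>_def by (simp_all add: strict_mono_interval_chart range_interval_chart)
  have in_rng: "\<iota> n a \<in> {real_of_int n<..<real_of_int n + 1}" for n a using rng by blast
  have fl: "\<lfloor>\<iota> n a\<rfloor> = n" "\<iota> n a \<notin> \<int>" for n a using floor_unit_interval[OF in_rng] by auto
  have chart: "\<exists>a. x = \<iota> \<lfloor>x\<rfloor> a" if "x \<notin> \<int>" for x
  proof -
    have "\<not> separated \<int> x x" using that by (force simp: separated_def)
    then have "x \<in> range (\<iota> \<lfloor>x\<rfloor>)" unfolding rng separated_Ints[OF that, symmetric] by simp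
    then show ?thesis by blast
  qed
  define \<theta>0 where "\<theta>0 j x = (if x \<in> \<int> then x else \<iota> \<lfloor>x\<rfloor> (V \<lfloor>x\<rfloor> j (inv (\<iota> \<lfloor>x\<rfloor>) x)))" for j x
  have t0: "\<theta>0 j (\<iota> n a) = \<iota> n (V n j a)" for j n a
    using mono[of n] by (simp add: \<theta>0_def fl strict_mono_imp_inj_on)
  have t0Z: "\<theta>0 j c = c" if "c \<in> \<int>" for j c using that by (simp add: \<theta>0_def)
  have rep0: "surface_rep g \<theta>0"
  proof (rule assemble_surface_rep[where C="\<int>"])
    show "\<theta>0 j c = c" if "c \<in> \<int>" for c j by (rule t0Z[OF that])
    fix x :: real assume x: "x \<notin> \<int>"
    show "\<exists>v \<iota>. surface_rep g v \<and> strict_mono \<iota> \<and> range \<iota> = {y. \<not> separated \<int> x y} \<and>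
                  (\<forall>j y. \<theta>0 j (\<iota> y) = \<iota> (v j y))"
      using Vrep mono t0 rng separated_Ints[OF x]
      by (intro exI[of _ "V \<lfloor>x\<rfloor>"] exI[of _ "\<iota> \<lfloor>x\<rfloor>"]) simp
  qed
  have fix0: "fixed \<theta>0 = \<int>"
  proof (intro equalityI subsetI)
    fix x assume x: "x \<in> fixed \<theta>0"
    show "x \<in> \<int>"
    proof (rule ccontr)
      assume "x \<notin> \<int>"
      then obtain a where a: "x = \<iota> \<lfloor>x\<rfloor> a" using chart by blast
      have "a \<in> fixed (V \<lfloor>x\<rfloor>)"
        using fixed_transport[of "\<iota> \<lfloor>x\<rfloor>" \<theta>0 "V \<lfloor>x\<rfloor>" a, OF mono t0] x a by simp
      then show False using Vfix by blast
    qed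
  next
    fix x :: real assume "x \<in> \<int>"
    then show "x \<in> fixed \<theta>0" using t0Z by (simp add: fixed_def)
  qed
  define C where "C = (\<Union>n. \<iota> n ` {- M n..M n})"
  have C0: "C \<noteq> {}" using M by (force simp: C_def)
  have off: "p \<notin> closure C" if p: "p \<in> \<int>" for p
  proof -
    obtain n where n: "p = real_of_int n" using p by (rule Ints_cases)
    let ?O = "{\<iota> (n - 1) (M (n - 1))<..<\<iota> n (- M n)}"
    have "p \<in> ?O" using in_rng[of "n - 1" "M (n - 1)"] in_rng[of n "- M n"] n by simp
    moreover have "?O \<inter> C = {}"
    proof -
      have False if y: "y \<in> ?O" "y = \<iota> k a" "a \<in> {- M k..M k}" for y k a
      proof -
        have fk: "\<lfloor>y\<rfloor> = k" "y \<notin> \<int>" using fl y(2) by auto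
        have "real_of_int n - 1 < y" "y < real_of_int n + 1"
          using y(1) in_rng[of "n - 1" "M (n - 1)"] in_rng[of n "- M n"] by auto
        then have "k = n - 1 \<or> k = n" using fk(1) by linarith
        then show False
        proof
          assume "k = n - 1"
          then have "M (n - 1) < a" using y(1,2) mono[of "n - 1"] by (simp add: strict_mono_less)
          then show False using y(3) \<open>k = n - 1\<close> by simp
        next
          assume "k = n"
          then have "a < - M n" using y(1,2) mono[of n] by (simp add: strict_mono_less)
          then show False using y(3) \<open>k = n\<close> by simp
        qed
      qed
      then show ?thesis unfolding C_def by blast
    qed
    moreover have "open ?O" by simp
    ultimately show ?thesis by (metis IntI empty_iff open_Int_closure_eq_empty)
  qed
  have near: "\<theta>0 3 y = y \<and> (\<theta>0 0 y \<noteq> y \<or> \<theta>0 1 y \<noteq> y \<or> y \<in> fixed \<theta>0)" if y: "y \<notin> C" for y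
  proof (cases "y \<in> \<int>")
    case True
    then show ?thesis using t0Z fix0 by simp
  next
    case False
    then obtain a where a: "y = \<iota> \<lfloor>y\<rfloor> a" using chart by blast
    let ?n = "\<lfloor>y\<rfloor>"
    have "a \<notin> {- M ?n..M ?n}" using y a unfolding C_def by blast
    then have "\<bar>a\<bar> > M ?n" by auto
    then have "V ?n 3 a = a \<and> (V ?n 0 a \<noteq> a \<or> V ?n 1 a \<noteq> a)" using M by blast
    then have "\<theta>0 3 (\<iota> ?n a) = \<iota> ?n a \<and> (\<theta>0 0 (\<iota> ?n a) \<noteq> \<iota> ?n a \<or> \<theta>0 1 (\<iota> ?n a) \<noteq> \<iota> ?n a)"
      using mono[of ?n] by (simp add: t0 strict_mono_eq)
    then have "\<theta>0 3 y = y \<and> (\<theta>0 0 y \<noteq> y \<or> \<theta>0 1 y \<noteq> y)" unfolding a[symmetric] .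
    then show ?thesis by blast
  qed
  define z where "z = push_off C (1/2)"
  have z: "z \<in> Homeos" unfolding z_def by (intro push_off_Homeos) auto
  have z_iff: "z x = x \<longleftrightarrow> x \<in> closure C" for x unfolding z_def by (rule push_off_eq_iff[OF C0]) simp
  define \<theta> where "\<theta> = \<theta>0(2 := \<theta>0 2 \<circ> z)"
  have m1: "\<theta>0 3 y = y \<and> (\<theta>0 0 y \<noteq> y \<or> \<theta>0 1 y \<noteq> y \<or> y \<in> fixed \<theta>0)" if "z y \<noteq> y" for y
    using near[of y] that closure_subset[of C] z_iff[of y] by blast
  have m2: "z p \<noteq> p" if "p \<in> fixed \<theta>0" for p using that off z_iff fix0 by simp
  have rep: "surface_rep g \<theta>" and nofix: "fixed \<theta> = {}"
    unfolding \<theta>_def by (rule bend_off_fixed_points[OF rep0 g z m1 m2]; assumption)+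
  have th: "\<theta> j x = \<theta>0 j x" if "x \<in> C" for j x
    using that z_iff[of x] closure_subset[of C] by (auto simp: \<theta>_def)
  have "W i \<in> closure (conjugates \<theta>)" for i
  proof -
    define n where "n k = int (prod_encode (i, k))" for k
    have n: "V (n k) = W i" "m (n k) = real k" for k by (simp_all add: n_def V_def m_def)
    have "\<exists>\<phi>. \<phi> \<in> Homeos \<and> (\<forall>x\<in>{- real k..real k}. \<phi> x = \<iota> (n k) x)" for k
    proof -
      have conv: "y \<in> range (\<iota> (n k))" if "\<iota> (n k) a \<le> y" "y \<le> \<iota> (n k) b" for a b y
        using that in_rng[of "n k" a] in_rng[of "n k" b] unfolding rng by auto
      obtain \<phi> where "\<phi> \<in> Homeos" "\<forall>x\<in>{- real k..real k}. \<phi> x = \<iota> (n k) x"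
        by (rule extend_to_Homeos[where \<iota>="\<iota> (n k)" and m="real k", OF mono conv]) auto
      then show ?thesis by blast
    qed
    then have "\<forall>k. \<exists>\<phi>. \<phi> \<in> Homeos \<and> (\<forall>x\<in>{- real k..real k}. \<phi> x = \<iota> (n k) x)"
      by blast
    then obtain \<phi> where \<phi>: "\<forall>k. \<phi> k \<in> Homeos \<and> (\<forall>x\<in>{- real k..real k}. \<phi> k x = \<iota> (n k) x)"
      unfolding choice_iff by blast
    have \<phi>H: "\<phi> k \<in> Homeos" for k using \<phi> by simp
    have \<phi>i: "\<phi> k x = \<iota> (n k) x" if "\<bar>x\<bar> \<le> real k" for k x using \<phi> that by (simp add: abs_le_iff)
    show ?thesis
    proof (rule pointwise_limit_in_closure[of "\<lambda>k j. inv (\<phi> k) \<circ> \<theta> j \<circ> inv (inv (\<phi> k))"])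
      show "(\<lambda>j. inv (\<phi> k) \<circ> \<theta> j \<circ> inv (inv (\<phi> k))) \<in> conjugates \<theta>" for k
        unfolding conjugates_def using \<phi>H by blast
      fix j x
      obtain N where N: "max \<bar>x\<bar> \<bar>W i j x\<bar> \<le> real N" using real_arch_simple by blast
      have "(inv (\<phi> k) \<circ> \<theta> j \<circ> inv (inv (\<phi> k))) x = W i j x" if k: "k \<ge> N" for k
      proof -
        have xk: "\<bar>x\<bar> \<le> real k" "\<bar>W i j x\<bar> \<le> real k" using N k by linarith+
        have "x \<in> {- M (n k)..M (n k)}" using xk(1) M n(2)[of k] by (metis abs_le_iff atLeastAtMost_iff minus_le_iff order_trans)
        then have "\<iota> (n k) x \<in> C" unfolding C_def by blast
        then have "\<theta> j (\<phi> k x) = \<phi> k (W i j x)"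
          using th t0 n \<phi>i xk by simp
        then show ?thesis using \<phi>H[of k] by simp
      qed
      then have "eventually (\<lambda>k. (inv (\<phi> k) \<circ> \<theta> j \<circ> inv (inv (\<phi> k))) x = W i j x) sequentially"
        unfolding eventually_sequentially by blast
      then show "(\<lambda>k. (inv (\<phi> k) \<circ> \<theta> j \<circ> inv (inv (\<phi> k))) x) \<longlonglongrightarrow> W i j x"
        by (rule tendsto_eventually)
    qed
  qed
  then have "T \<subseteq> closure (conjugates \<theta>)" using W by blast
  then have "closure T \<subseteq> closure (conjugates \<theta>)" by (simp add: closure_minimal)
  then have "regular_reps g \<subseteq> closure (conjugates \<theta>)" using T(3) by blast
  then have "closure (regular_reps g) \<subseteq> closure (conjugates \<theta>)" by (simp add: closure_minimal)
  then have "{\<rho>. surface_rep g \<rho>} \<subseteq> closure (conjugates \<theta>)"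
    using surface_reps_subset_closure_regular[OF g] by blast
  then show ?thesis using rep nofix by blast
qed


(* Topo1 *)


definition path_homotopic :: "'a topology \<Rightarrow> (real \<Rightarrow> 'a) \<Rightarrow> (real \<Rightarrow> 'a) \<Rightarrow> bool" where
  "path_homotopic X p q \<longleftrightarrow> homotopic_with (\<lambda>h. h 0 = p 0 \<and> h 1 = p 1) (top_of_set {0..1}) X p q"

lemma path_homotopic_ends:
  assumes "path_homotopic X p q"
  shows "pathin X p" "pathin X q" "q 0 = p 0" "q 1 = p 1"
  using homotopic_with_imp_continuous_maps[OF assms[unfolded path_homotopic_def]]
    homotopic_with_imp_property[OF assms[unfolded path_homotopic_def]]
  by (auto simp: pathin_def)

lemma path_homotopic_iff:
  "path_homotopic X p q \<longleftrightarrow>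
     (\<exists>h. continuous_map (top_of_set ({0..1::real} \<times> {0..1})) X h \<and> (\<forall>x. h (0, x) = p x) \<and> (\<forall>x. h (1, x) = q x) \<and>
          (\<forall>t\<in>{0..1}. h (t, 0) = p 0 \<and> h (t, 1) = p 1))"
  by (simp add: path_homotopic_def homotopic_with_def)

lemma path_homotopic_refl: "pathin X p \<Longrightarrow> path_homotopic X p p"
  by (simp add: path_homotopic_def pathin_def)

lemma path_homotopic_sym: "path_homotopic X p q \<Longrightarrow> path_homotopic X q p"
  using path_homotopic_ends[of X p q] homotopic_with_symD unfolding path_homotopic_def by fastforce

lemma path_homotopic_trans [trans]:
  "path_homotopic X p q \<Longrightarrow> path_homotopic X q r \<Longrightarrow> path_homotopic X p r"
  using path_homotopic_ends[of X p q] homotopic_with_trans unfolding path_homotopic_def by fastforce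

lemma path_homotopic_eq:
  assumes "pathin X p" "\<And>t. t \<in> {0..1} \<Longrightarrow> p t = q t"
  shows "path_homotopic X p q"
  unfolding path_homotopic_def
  by (rule homotopic_with_equal) (use assms in \<open>auto simp: pathin_def\<close>)

lemma path_homotopic_convex:
  fixes K :: "'b::real_normed_vector set"
  assumes f: "continuous_map (top_of_set K) X f" and K: "convex K"
    and r: "continuous_on {0..1} r" "r \<in> {0..1} \<rightarrow> K" and s: "continuous_on {0..1} s" "s \<in> {0..1} \<rightarrow> K"
    and ends: "r 0 = s 0" "r 1 = s 1"
  shows "path_homotopic X (\<lambda>t. f (r t)) (\<lambda>t. f (s t))"
  unfolding path_homotopic_iff
proof (intro exI[of _ "\<lambda>p. f ((1 - fst p) *\<^sub>R r (snd p) + fst p *\<^sub>R s (snd p))"] conjI allI ballI)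
  let ?H = "\<lambda>p. (1 - fst p) *\<^sub>R r (snd p) + fst p *\<^sub>R s (snd p)"
  have "continuous_on ({0..1::real} \<times> {0..1::real}) ?H"
    by (intro continuous_intros continuous_on_compose2[OF r(1)] continuous_on_compose2[OF s(1)]) auto
  moreover have "?H \<in> {0..1::real} \<times> {0..1::real} \<rightarrow> K"
    using r(2) s(2) by (auto intro!: convexD_alt[OF K, simplified])
  ultimately have "continuous_map (top_of_set ({0..1::real} \<times> {0..1::real})) (top_of_set K) ?H" by simp
  from continuous_map_compose[OF this f]
  show "continuous_map (top_of_set ({0..1::real} \<times> {0..1::real})) X (\<lambda>p. f (?H p))" by (simp add: comp_def)
qed (use ends in \<open>auto simp flip: scaleR_add_left\<close>)

lemma continuous_map_top_of_set_cases:
  assumes u: "continuous_on S u"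
    and f: "continuous_map (top_of_set {x \<in> S. u x \<le> (c::real)}) X f"
    and h: "continuous_map (top_of_set {x \<in> S. c \<le> u x}) X h"
    and eq: "\<And>x. x \<in> S \<Longrightarrow> u x = c \<Longrightarrow> f x = h x"
  shows "continuous_map (top_of_set S) X (\<lambda>x. if u x \<le> c then f x else h x)"
proof (rule continuous_map_cases_le)
  have "S \<inter> {x. x \<in> S \<and> u x \<le> c} = {x \<in> S. u x \<le> c}" "S \<inter> {x. x \<in> S \<and> c \<le> u x} = {x \<in> S. c \<le> u x}" by auto
  then show "continuous_map (subtopology (top_of_set S) {x \<in> topspace (top_of_set S). u x \<le> c}) X f"
    "continuous_map (subtopology (top_of_set S) {x \<in> topspace (top_of_set S). c \<le> u x}) X h"
    using f h by (simp_all add: subtopology_subtopology)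
qed (use u eq in auto)

lemma continuous_map_top_of_set_compose:
  assumes "continuous_map (top_of_set T) X f" "continuous_on S r" "r \<in> S \<rightarrow> T"
  shows "continuous_map (top_of_set S) X (\<lambda>x. f (r x))"
  using continuous_map_compose[of "top_of_set S" "top_of_set T" r X f] assms by (simp add: comp_def)

lemma path_homotopic_concat:
  assumes p: "path_homotopic X p p'" and q: "path_homotopic X q q'" and pq: "p 1 = q 0"
  shows "path_homotopic X (concat_paths p q) (concat_paths p' q')"
proof -
  obtain h where h: "continuous_map (top_of_set ({0..1::real} \<times> {0..1::real})) X h" "\<forall>x. h (0, x) = p x" "\<forall>x. h (1, x) = p' x"
    "\<forall>t\<in>{0..1}. h (t, 0) = p 0 \<and> h (t, 1) = p 1"
    using p unfolding path_homotopic_iff by blast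
  obtain k where k: "continuous_map (top_of_set ({0..1::real} \<times> {0..1::real})) X k" "\<forall>x. k (0, x) = q x" "\<forall>x. k (1, x) = q' x"
    "\<forall>t\<in>{0..1}. k (t, 0) = q 0 \<and> k (t, 1) = q 1"
    using q unfolding path_homotopic_iff by blast
  let ?H = "\<lambda>z. if snd z \<le> 1/2 then h (fst z, 2 * snd z) else k (fst z, 2 * snd z - 1)"
  have "continuous_map (top_of_set ({0..1::real} \<times> {0..1::real})) X ?H"
  proof (rule continuous_map_top_of_set_cases)
    show "continuous_map (top_of_set {x \<in> {0..1::real} \<times> {0..1::real}. snd x \<le> 1/2}) X (\<lambda>z. h (fst z, 2 * snd z))"
      by (rule continuous_map_top_of_set_compose[OF h(1)]) (auto intro!: continuous_intros)
    show "continuous_map (top_of_set {x \<in> {0..1::real} \<times> {0..1::real}. 1/2 \<le> snd x}) X (\<lambda>z. k (fst z, 2 * snd z - 1))"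
      by (rule continuous_map_top_of_set_compose[OF k(1)]) (auto intro!: continuous_intros)
    show "h (fst z, 2 * snd z) = k (fst z, 2 * snd z - 1)" if "z \<in> {0..1::real} \<times> {0..1::real}" "snd z = 1/2" for z
    proof -
      have "2 * snd z = 1" "fst z \<in> {0..1}" using that by auto
      then show ?thesis using h(4) k(4) pq by simp
    qed
  qed (auto intro!: continuous_intros)
  then show ?thesis
    unfolding path_homotopic_iff
    using h k by (intro exI[of _ ?H]) (auto simp: concat_paths_def)
qed

lemma pathin_concat:
  assumes "pathin X p" "pathin X q" "p 1 = q 0"
  shows "pathin X (concat_paths p q)"
  using path_homotopic_ends(1)[OF path_homotopic_concat[OF path_homotopic_refl path_homotopic_refl]] assms by blast

lemma concat_paths_0 [simp]: "concat_paths p q 0 = p 0"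
  and concat_paths_1 [simp]: "concat_paths p q 1 = q 1"
  by (simp_all add: concat_paths_def)

lemma path_homotopic_reparam:
  assumes p: "pathin X p" and r: "continuous_on {0..1} r" "r \<in> {0..1} \<rightarrow> {0..1}"
    and s: "continuous_on {0..1} s" "s \<in> {0..1} \<rightarrow> {0..1}" and "r 0 = s 0" "r 1 = s 1"
  shows "path_homotopic X (\<lambda>t. p (r t)) (\<lambda>t. p (s t))"
  using assms by (intro path_homotopic_convex[of "{0..1::real}"]) (auto simp: pathin_def)

lemma path_homotopic_assoc:
  assumes p: "pathin X p" and q: "pathin X q" and r: "pathin X r" and "p 1 = q 0" "q 1 = r 0"
  shows "path_homotopic X (concat_paths (concat_paths p q) r) (concat_paths p (concat_paths q r))"
proof -
  let ?s = "concat_paths p (concat_paths q r)"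
  define \<phi> where "\<phi> t = (if t \<le> 1/2 then (if t \<le> 1/4 then 2 * t else t + 1/4) else t / 2 + 1/2)" for t :: real
  have s: "pathin X ?s" using assms by (intro pathin_concat) auto
  have "continuous_on {0..1} \<phi>"
    unfolding \<phi>_def by (intro continuous_on_cases_1 continuous_intros continuous_on_subset[OF continuous_on_cases_1[of UNIV]]) (auto intro!: continuous_intros)
  then have "path_homotopic X (\<lambda>t. ?s (\<phi> t)) (\<lambda>t. ?s t)"
    using s by (intro path_homotopic_reparam) (auto simp: \<phi>_def)
  moreover have "?s (\<phi> t) = concat_paths (concat_paths p q) r t" for t
  proof -
    consider "t \<le> 1/4" | "1/4 < t" "t \<le> 1/2" | "1/2 < t" by linarith
    then show ?thesis by cases (auto simp: \<phi>_def concat_paths_def algebra_simps)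
  qed
  ultimately show ?thesis by simp
qed

lemma path_homotopic_const_concat:
  assumes "pathin X p" "p 0 = x"
  shows "path_homotopic X (concat_paths (\<lambda>_. x) p) p"
proof -
  have "continuous_on {0..1} (\<lambda>t::real. max 0 (2 * t - 1))" by (intro continuous_intros)
  then have "path_homotopic X (\<lambda>t. p (max 0 (2 * t - 1))) (\<lambda>t. p t)"
    using assms by (intro path_homotopic_reparam) auto
  moreover have "p (max 0 (2 * t - 1)) = concat_paths (\<lambda>_. x) p t" for t
    using assms by (cases "t \<le> 1/2") (simp_all add: concat_paths_def max_absorb1 max_absorb2)
  ultimately show ?thesis by simp
qed

lemma path_homotopic_concat_const:
  assumes "pathin X p" "p 1 = x"
  shows "path_homotopic X (concat_paths p (\<lambda>_. x)) p"
proof -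
  have "continuous_on {0..1} (\<lambda>t::real. min 1 (2 * t))" by (intro continuous_intros)
  then have "path_homotopic X (\<lambda>t. p (min 1 (2 * t))) (\<lambda>t. p t)"
    using assms by (intro path_homotopic_reparam) auto
  moreover have "p (min 1 (2 * t)) = concat_paths p (\<lambda>_. x) t" for t
    using assms by (cases "t \<le> 1/2") (simp_all add: concat_paths_def min_absorb1 min_absorb2)
  ultimately show ?thesis by simp
qed

lemma path_homotopic_reverse_concat:
  assumes p: "pathin X p"
  shows "path_homotopic X (concat_paths (\<lambda>t. p (1 - t)) p) (\<lambda>_. p 1)"
proof -
  have "continuous_on {0..1} (\<lambda>t::real. \<bar>1 - 2 * t\<bar>)" by (intro continuous_intros)
  then have "path_homotopic X (\<lambda>t. p \<bar>1 - 2 * t\<bar>) (\<lambda>t. p 1)"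
    using p by (intro path_homotopic_reparam) auto
  moreover have "p \<bar>1 - 2 * t\<bar> = concat_paths (\<lambda>t. p (1 - t)) p t" for t
    by (auto simp: concat_paths_def abs_if)
  ultimately show ?thesis by simp
qed

lemma pathin_reverse: "pathin X p \<Longrightarrow> pathin X (\<lambda>t. p (1 - t))"
  unfolding pathin_def by (rule continuous_map_top_of_set_compose) (auto intro!: continuous_intros)

lemma pathin_const': "x \<in> topspace X \<Longrightarrow> pathin X (\<lambda>_. x)"
  by (simp add: pathin_def)

abbreviation path_class :: "'a topology \<Rightarrow> 'a \<Rightarrow> (real \<Rightarrow> 'a) \<Rightarrow> (real \<Rightarrow> 'a) set" where
  "path_class X x p \<equiv> loop_homotopy X x `` {p}"

lemma loop_homotopy_iff:
  "(p, q) \<in> loop_homotopy X x \<longleftrightarrow> p \<in> loops X x \<and> path_homotopic X p q"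
proof
  assume "(p, q) \<in> loop_homotopy X x"
  then have *: "homotopic_with (\<lambda>h. h 0 = x \<and> h 1 = x) (top_of_set {0..1}) X p q"
    by (simp add: loop_homotopy_def)
  then have "p \<in> loops X x"
    using homotopic_with_imp_continuous_maps[OF *] homotopic_with_imp_property[OF *]
    by (simp add: loops_def pathin_def)
  then show "p \<in> loops X x \<and> path_homotopic X p q"
    using * by (simp add: path_homotopic_def loops_def)
next
  assume *: "p \<in> loops X x \<and> path_homotopic X p q"
  then have e: "p 0 = x" "p 1 = x" by (auto simp: loops_def)
  show "(p, q) \<in> loop_homotopy X x"
    using conjunct2[OF *] unfolding loop_homotopy_def path_homotopic_def e by simp
qed

lemma loops_path_homotopic: "p \<in> loops X x \<Longrightarrow> path_homotopic X p q \<Longrightarrow> q \<in> loops X x"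
  using path_homotopic_ends[of X p q] by (simp add: loops_def)

lemma equiv_loop_homotopy: "equiv (loops X x) (loop_homotopy X x)"
proof (rule equivI)
  show "loop_homotopy X x \<subseteq> loops X x \<times> loops X x"
    using loops_path_homotopic by (auto simp: loop_homotopy_iff)
  show "refl_on (loops X x) (loop_homotopy X x)"
    by (auto simp: refl_on_def loop_homotopy_iff loops_def intro: path_homotopic_refl)
  show "sym (loop_homotopy X x)"
    using loops_path_homotopic path_homotopic_sym by (auto simp: sym_def loop_homotopy_iff)
  show "trans (loop_homotopy X x)"
    using path_homotopic_trans by (fastforce simp: trans_def loop_homotopy_iff)
qed

lemma path_class_eq_iff:
  assumes "p \<in> loops X x" "q \<in> loops X x"
  shows "path_class X x p = path_class X x q \<longleftrightarrow> path_homotopic X p q"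
  using eq_equiv_class_iff[OF equiv_loop_homotopy assms] assms by (simp add: loop_homotopy_iff)

lemma path_class_in_carrier: "p \<in> loops X x \<Longrightarrow> path_class X x p \<in> carrier (fundamental_group X x)"
  by (auto simp: fundamental_group_def intro: quotientI)

lemma carrier_fundamental_groupE:
  assumes "A \<in> carrier (fundamental_group X x)"
  obtains p where "p \<in> loops X x" "A = path_class X x p"
  using assms by (auto simp: fundamental_group_def elim: quotientE)

lemma loops_concat: "p \<in> loops X x \<Longrightarrow> q \<in> loops X x \<Longrightarrow> concat_paths p q \<in> loops X x"
  by (auto simp: loops_def intro: pathin_concat)

lemma mult_path_class:
  assumes p: "p \<in> loops X x" and q: "q \<in> loops X x"
  shows "path_class X x p \<otimes>\<^bsub>fundamental_group X x\<^esub> path_class X x q = path_class X x (concat_paths p q)"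
proof -
  have all: "path_class X x (concat_paths p' q') = path_class X x (concat_paths p q)"
    if "p' \<in> path_class X x p" "q' \<in> path_class X x q" for p' q'
  proof -
    have "path_homotopic X p p'" "path_homotopic X q q'"
      using that by (auto simp: loop_homotopy_iff)
    then have "path_homotopic X (concat_paths p q) (concat_paths p' q')"
      using p q by (intro path_homotopic_concat) (auto simp: loops_def)
    moreover have "p' \<in> loops X x" "q' \<in> loops X x"
      using that loops_path_homotopic by (auto simp: loop_homotopy_iff)
    ultimately show ?thesis
      using p q by (metis loops_concat path_class_eq_iff)
  qed
  have mem: "p \<in> path_class X x p" "q \<in> path_class X x q"
    using p q by (auto simp: loop_homotopy_iff loops_def intro: path_homotopic_refl)
  have "(\<Union>p'\<in>path_class X x p. \<Union>q'\<in>path_class X x q. path_class X x (concat_paths p' q')) =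
        (\<Union>p'\<in>path_class X x p. \<Union>q'\<in>path_class X x q. path_class X x (concat_paths p q))"
    by (intro SUP_cong refl all)
  also have "\<dots> = path_class X x (concat_paths p q)"
    using mem unfolding UN_constant by (metis empty_iff)
  finally show ?thesis by (simp add: fundamental_group_def)
qed

lemma one_fundamental_group: "\<one>\<^bsub>fundamental_group X x\<^esub> = path_class X x (\<lambda>_. x)"
  by (simp add: fundamental_group_def)

lemma group_fundamental_group:
  assumes x: "x \<in> topspace X"
  shows "group (fundamental_group X x)"
proof (rule groupI)
  have cst: "(\<lambda>_. x) \<in> loops X x" using x by (simp add: loops_def pathin_const')
  show "\<one>\<^bsub>fundamental_group X x\<^esub> \<in> carrier (fundamental_group X x)"
    unfolding one_fundamental_group using cst by (rule path_class_in_carrier)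
  fix A assume "A \<in> carrier (fundamental_group X x)"
  then obtain p where p: "p \<in> loops X x" "A = path_class X x p" by (rule carrier_fundamental_groupE)
  have p': "pathin X p" "p 0 = x" "p 1 = x" using p by (auto simp: loops_def)
  show "\<one>\<^bsub>fundamental_group X x\<^esub> \<otimes>\<^bsub>fundamental_group X x\<^esub> A = A"
    unfolding one_fundamental_group p(2) mult_path_class[OF cst p(1)]
    using p path_homotopic_const_concat[OF p'(1,2)] loops_concat[OF cst p(1)] by (simp add: path_class_eq_iff)
  have r: "(\<lambda>t. p (1 - t)) \<in> loops X x" using p' by (simp add: loops_def pathin_reverse)
  show "\<exists>B\<in>carrier (fundamental_group X x). B \<otimes>\<^bsub>fundamental_group X x\<^esub> A = \<one>\<^bsub>fundamental_group X x\<^esub>"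
  proof (rule bexI[of _ "path_class X x (\<lambda>t. p (1 - t))"])
    show "path_class X x (\<lambda>t. p (1 - t)) \<otimes>\<^bsub>fundamental_group X x\<^esub> A = \<one>\<^bsub>fundamental_group X x\<^esub>"
      unfolding one_fundamental_group p(2) mult_path_class[OF r p(1)]
      using path_homotopic_reverse_concat[OF p'(1)] p' loops_concat[OF r p(1)] cst by (simp add: path_class_eq_iff)
  qed (rule path_class_in_carrier[OF r])
  fix B assume "B \<in> carrier (fundamental_group X x)"
  then obtain q where q: "q \<in> loops X x" "B = path_class X x q" by (rule carrier_fundamental_groupE)
  show "A \<otimes>\<^bsub>fundamental_group X x\<^esub> B \<in> carrier (fundamental_group X x)"
    unfolding p(2) q(2) mult_path_class[OF p(1) q(1)] by (intro path_class_in_carrier loops_concat p q)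
  fix C assume "C \<in> carrier (fundamental_group X x)"
  then obtain r where r: "r \<in> loops X x" "C = path_class X x r" by (rule carrier_fundamental_groupE)
  show "A \<otimes>\<^bsub>fundamental_group X x\<^esub> B \<otimes>\<^bsub>fundamental_group X x\<^esub> C = A \<otimes>\<^bsub>fundamental_group X x\<^esub> (B \<otimes>\<^bsub>fundamental_group X x\<^esub> C)"
    unfolding p(2) q(2) r(2)
    using p q r by (simp add: mult_path_class loops_concat path_class_eq_iff)
      (intro path_homotopic_assoc; simp add: loops_def)
qed


(* Topo2 *)




locale local_system = group G for G :: "('g, 'm) monoid_scheme" +
  fixes X :: "'a topology" and \<tau> :: "'a \<Rightarrow> 'a \<Rightarrow> 'g"
  assumes tau_closed [simp]: "x \<in> topspace X \<Longrightarrow> \<tau> x y \<in> carrier G"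
    and tau_local: "x \<in> topspace X \<Longrightarrow> \<exists>N. openin X N \<and> x \<in> N \<and>
          (\<forall>y\<in>N. \<exists>M. openin X M \<and> y \<in> M \<and> (\<forall>v\<in>M. \<tau> x v = \<tau> x y \<otimes>\<^bsub>G\<^esub> \<tau> y v))"
begin

lemma tau_refl: "x \<in> topspace X \<Longrightarrow> \<tau> x x = \<one>\<^bsub>G\<^esub>"
proof -
  assume x: "x \<in> topspace X"
  then have "\<tau> x x = \<tau> x x \<otimes>\<^bsub>G\<^esub> \<tau> x x" using tau_local[OF x] by blast
  then show ?thesis using x by simp
qed

definition parallel :: "'b::topological_space set \<Rightarrow> ('b \<Rightarrow> 'a) \<Rightarrow> ('b \<Rightarrow> 'g) \<Rightarrow> bool" where
  "parallel S f \<gamma> \<longleftrightarrow> (\<forall>s\<in>S. \<gamma> s \<in> carrier G) \<and>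
     (\<forall>a\<in>S. \<exists>U. open U \<and> a \<in> U \<and> (\<forall>s\<in>S \<inter> U. \<gamma> s = \<gamma> a \<otimes>\<^bsub>G\<^esub> \<tau> (f a) (f s)))"

lemma parallelD:
  assumes "parallel S f \<gamma>" "a \<in> S"
  shows "\<gamma> a \<in> carrier G" "\<exists>U. open U \<and> a \<in> U \<and> (\<forall>s\<in>S \<inter> U. \<gamma> s = \<gamma> a \<otimes>\<^bsub>G\<^esub> \<tau> (f a) (f s))"
  using assms unfolding parallel_def by auto

lemma parallel_subset: "parallel S f \<gamma> \<Longrightarrow> T \<subseteq> S \<Longrightarrow> parallel T f \<gamma>"
  unfolding parallel_def by (meson Int_mono order_refl subset_eq)

lemma parallel_cong:
  assumes "parallel S f \<gamma>" "\<And>s. s \<in> S \<Longrightarrow> f s = f' s \<and> \<gamma> s = \<gamma>' s"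
  shows "parallel S f' \<gamma>'"
  using assms unfolding parallel_def by (metis IntD1)

lemma parallel_left_mult:
  assumes p: "parallel S f \<gamma>" and c: "c \<in> carrier G" and f: "f \<in> S \<rightarrow> topspace X"
  shows "parallel S f (\<lambda>s. c \<otimes>\<^bsub>G\<^esub> \<gamma> s)"
  unfolding parallel_def
proof (intro conjI ballI)
  fix a assume a: "a \<in> S"
  then show "c \<otimes>\<^bsub>G\<^esub> \<gamma> a \<in> carrier G" using c parallelD(1)[OF p] by simp
  obtain U where U: "open U" "a \<in> U" "\<forall>s\<in>S \<inter> U. \<gamma> s = \<gamma> a \<otimes>\<^bsub>G\<^esub> \<tau> (f a) (f s)"
    using parallelD(2)[OF p a] by blast
  have "f a \<in> topspace X" using f a by blast
  then have "\<forall>s\<in>S \<inter> U. c \<otimes>\<^bsub>G\<^esub> \<gamma> s = c \<otimes>\<^bsub>G\<^esub> \<gamma> a \<otimes>\<^bsub>G\<^esub> \<tau> (f a) (f s)"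
    using U(3) c parallelD(1)[OF p a] by (simp add: m_assoc)
  then show "\<exists>U. open U \<and> a \<in> U \<and> (\<forall>s\<in>S \<inter> U. c \<otimes>\<^bsub>G\<^esub> \<gamma> s = c \<otimes>\<^bsub>G\<^esub> \<gamma> a \<otimes>\<^bsub>G\<^esub> \<tau> (f a) (f s))"
    using U by blast
qed

lemma parallel_compose:
  assumes p: "parallel S f \<gamma>" and r: "continuous_on T r" "r \<in> T \<rightarrow> S"
  shows "parallel T (\<lambda>t. f (r t)) (\<lambda>t. \<gamma> (r t))"
  unfolding parallel_def
proof (intro conjI ballI)
  fix a assume a: "a \<in> T"
  then have ra: "r a \<in> S" using r by blast
  then show "\<gamma> (r a) \<in> carrier G" using parallelD(1)[OF p] by blast
  obtain U where U: "open U" "r a \<in> U" "\<forall>s\<in>S \<inter> U. \<gamma> s = \<gamma> (r a) \<otimes>\<^bsub>G\<^esub> \<tau> (f (r a)) (f s)"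
    using parallelD(2)[OF p ra] by blast
  obtain V where V: "open V" "V \<inter> T = r -` U \<inter> T"
    using r(1) U(1) unfolding continuous_on_open_invariant by metis
  then show "\<exists>U. open U \<and> a \<in> U \<and> (\<forall>s\<in>T \<inter> U. \<gamma> (r s) = \<gamma> (r a) \<otimes>\<^bsub>G\<^esub> \<tau> (f (r a)) (f (r s)))"
    using U a r(2) by (intro exI[of _ V]) blast
qed

lemma parallel_ratio_constant:
  assumes S: "connected S" and p: "parallel S f \<gamma>" and q: "parallel S f \<delta>" and f: "f \<in> S \<rightarrow> topspace X"
  obtains c where "c \<in> carrier G" "\<forall>s\<in>S. \<delta> s = c \<otimes>\<^bsub>G\<^esub> \<gamma> s"
proof -
  let ?d = "\<lambda>s. \<delta> s \<otimes>\<^bsub>G\<^esub> m_inv G (\<gamma> s)"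
  have "?d constant_on S"
  proof (rule locally_constant_imp_constant[OF S])
    fix a assume a: "a \<in> S"
    obtain U where U: "open U" "a \<in> U" "\<forall>s\<in>S \<inter> U. \<gamma> s = \<gamma> a \<otimes>\<^bsub>G\<^esub> \<tau> (f a) (f s)"
      using parallelD(2)[OF p a] by blast
    obtain V where V: "open V" "a \<in> V" "\<forall>s\<in>S \<inter> V. \<delta> s = \<delta> a \<otimes>\<^bsub>G\<^esub> \<tau> (f a) (f s)"
      using parallelD(2)[OF q a] by blast
    have fa: "f a \<in> topspace X" using f a by blast
    have const: "?d s = ?d a" if s: "s \<in> S \<inter> (U \<inter> V)" for s
    proof -
      have "\<gamma> s = \<gamma> a \<otimes>\<^bsub>G\<^esub> \<tau> (f a) (f s)" "\<delta> s = \<delta> a \<otimes>\<^bsub>G\<^esub> \<tau> (f a) (f s)" using U V s by blast+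
      moreover have "\<gamma> a \<in> carrier G" "\<delta> a \<in> carrier G" "\<tau> (f a) (f s) \<in> carrier G"
        using parallelD(1)[OF p a] parallelD(1)[OF q a] fa by auto
      ultimately show ?thesis
        by (simp add: inv_mult_group m_assoc) (simp add: m_assoc[symmetric])
    qed
    show "\<exists>T. openin (top_of_set S) T \<and> a \<in> T \<and> (\<forall>s\<in>T. ?d s = ?d a)"
    proof (intro exI[of _ "S \<inter> (U \<inter> V)"] conjI ballI const)
      show "openin (top_of_set S) (S \<inter> (U \<inter> V))" by (intro openin_open_Int open_Int U V)
    qed (use U V a in auto)
  qed
  then obtain c where c: "\<forall>s\<in>S. ?d s = c" unfolding constant_on_def by blast
  show ?thesis
  proof (cases "S = {}")
    case True
    then show ?thesis using that[of "\<one>\<^bsub>G\<^esub>"] by simp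
  next
    case False
    then obtain a where "a \<in> S" by blast
    then have "c \<in> carrier G" using c parallelD(1)[OF p] parallelD(1)[OF q] by (metis inv_closed m_closed)
    moreover have "\<delta> s = c \<otimes>\<^bsub>G\<^esub> \<gamma> s" if "s \<in> S" for s
    proof -
      have "\<gamma> s \<in> carrier G" "\<delta> s \<in> carrier G" "?d s = c"
        using that c parallelD(1)[OF p] parallelD(1)[OF q] by auto
      then show ?thesis by (metis inv_solve_right m_closed inv_closed inv_inv)
    qed
    ultimately show ?thesis using that by blast
  qed
qed

lemma parallel_unique:
  assumes S: "connected S" and p: "parallel S f \<gamma>" and q: "parallel S f \<delta>" and f: "f \<in> S \<rightarrow> topspace X"
    and a: "a \<in> S" "\<gamma> a = \<delta> a" and s: "s \<in> S"
  shows "\<gamma> s = \<delta> s"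
proof -
  obtain c where c: "c \<in> carrier G" "\<forall>s\<in>S. \<delta> s = c \<otimes>\<^bsub>G\<^esub> \<gamma> s"
    by (rule parallel_ratio_constant[OF S p q f])
  have "c = \<one>\<^bsub>G\<^esub>" using c a parallelD(1)[OF p a(1)] by simp
  then show ?thesis using c s parallelD(1)[OF p s] by simp
qed

lemma parallel_union:
  assumes p: "parallel A f \<gamma>" and q: "parallel B f \<gamma>" and "closed A" "closed B"
  shows "parallel (A \<union> B) f \<gamma>"
  unfolding parallel_def
proof (intro conjI ballI)
  fix a assume a: "a \<in> A \<union> B"
  then show "\<gamma> a \<in> carrier G" using parallelD(1)[OF p] parallelD(1)[OF q] by blast
  have "\<exists>U. open U \<and> a \<in> U \<and> (\<forall>s\<in>A \<inter> U. \<gamma> s = \<gamma> a \<otimes>\<^bsub>G\<^esub> \<tau> (f a) (f s))"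
  proof (cases "a \<in> A")
    case True
    then show ?thesis by (rule parallelD(2)[OF p])
  next
    case False
    then show ?thesis using \<open>closed A\<close> by (intro exI[of _ "- A"]) auto
  qed
  moreover have "\<exists>U. open U \<and> a \<in> U \<and> (\<forall>s\<in>B \<inter> U. \<gamma> s = \<gamma> a \<otimes>\<^bsub>G\<^esub> \<tau> (f a) (f s))"
  proof (cases "a \<in> B")
    case True
    then show ?thesis by (rule parallelD(2)[OF q])
  next
    case False
    then show ?thesis using \<open>closed B\<close> by (intro exI[of _ "- B"]) auto
  qed
  ultimately obtain U V where "open U" "a \<in> U" "\<forall>s\<in>A \<inter> U. \<gamma> s = \<gamma> a \<otimes>\<^bsub>G\<^esub> \<tau> (f a) (f s)"
    "open V" "a \<in> V" "\<forall>s\<in>B \<inter> V. \<gamma> s = \<gamma> a \<otimes>\<^bsub>G\<^esub> \<tau> (f a) (f s)" by (elim exE conjE) (rule that)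
  then show "\<exists>U. open U \<and> a \<in> U \<and> (\<forall>s\<in>(A \<union> B) \<inter> U. \<gamma> s = \<gamma> a \<otimes>\<^bsub>G\<^esub> \<tau> (f a) (f s))"
    by (intro exI[of _ "U \<inter> V"]) auto
qed

lemma parallel_glue:
  assumes p: "parallel A f \<gamma>" and q: "parallel B f \<delta>" and cl: "closed A" "closed B"
    and con: "connected (A \<inter> B)" and f: "f \<in> A \<union> B \<rightarrow> topspace X"
  shows "\<exists>\<eta>. parallel (A \<union> B) f \<eta>"
proof -
  have "parallel (A \<inter> B) f \<gamma>" "parallel (A \<inter> B) f \<delta>" using p q by (auto intro: parallel_subset)
  then obtain c where c: "c \<in> carrier G" "\<forall>s\<in>A \<inter> B. \<gamma> s = c \<otimes>\<^bsub>G\<^esub> \<delta> s"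
    using parallel_ratio_constant[OF con] f by blast
  let ?\<eta> = "\<lambda>s. if s \<in> A then \<gamma> s else c \<otimes>\<^bsub>G\<^esub> \<delta> s"
  have "parallel A f ?\<eta>" using parallel_cong[OF p] by simp
  moreover have "parallel B f ?\<eta>"
    using parallel_cong[OF parallel_left_mult[OF q c(1)]] c(2) f by simp
  ultimately show ?thesis using parallel_union cl by blast
qed

lemma parallel_locally:
  assumes f: "continuous_map (top_of_set S) X f" and a: "a \<in> S"
  shows "\<exists>U \<gamma>. open U \<and> a \<in> U \<and> parallel (S \<inter> U) f \<gamma>"
proof -
  have fX: "f s \<in> topspace X" if "s \<in> S" for s
    using continuous_map_image_subset_topspace[OF f] that by auto
  obtain N where N: "openin X N" "f a \<in> N"
    "\<forall>y\<in>N. \<exists>M. openin X M \<and> y \<in> M \<and> (\<forall>v\<in>M. \<tau> (f a) v = \<tau> (f a) y \<otimes>\<^bsub>G\<^esub> \<tau> y v)"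
    using tau_local[OF fX[OF a]] by blast
  have pre: "\<exists>U. open U \<and> {s \<in> S. f s \<in> M} = S \<inter> U" if "openin X M" for M
    using openin_continuous_map_preimage[OF f that] by (simp add: openin_open)
  obtain U where U: "open U" "{s \<in> S. f s \<in> N} = S \<inter> U" using pre[OF N(1)] by blast
  have "parallel (S \<inter> U) f (\<lambda>s. \<tau> (f a) (f s))"
    unfolding parallel_def
  proof (intro conjI ballI)
    fix b assume b: "b \<in> S \<inter> U"
    show "\<tau> (f a) (f b) \<in> carrier G" using fX a by simp
    have "f b \<in> N" using b U by blast
    then obtain M where M: "openin X M" "f b \<in> M" "\<forall>v\<in>M. \<tau> (f a) v = \<tau> (f a) (f b) \<otimes>\<^bsub>G\<^esub> \<tau> (f b) v"
      using N(3) by blast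
    obtain V where V: "open V" "{s \<in> S. f s \<in> M} = S \<inter> V" using pre[OF M(1)] by blast
    show "\<exists>V. open V \<and> b \<in> V \<and> (\<forall>s\<in>S \<inter> U \<inter> V. \<tau> (f a) (f s) = \<tau> (f a) (f b) \<otimes>\<^bsub>G\<^esub> \<tau> (f b) (f s))"
      using V M b by (intro exI[of _ V]) blast
  qed
  then show ?thesis using U N(2) a by blast
qed

lemma parallel_square:
  fixes f :: "real \<times> real \<Rightarrow> 'a"
  assumes f: "continuous_map (top_of_set ({0..1} \<times> {0..1})) X f"
  shows "\<exists>\<gamma>. parallel ({0..1} \<times> {0..1}) f \<gamma>"
proof -
  let ?I = "{0..1::real}"
  have fX: "f \<in> ?I \<times> ?I \<rightarrow> topspace X"
    using continuous_map_image_subset_topspace[OF f] by auto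
  let ?Q = "\<lambda>x a b. \<exists>d>0. \<exists>\<gamma>. parallel (({x - d..x + d} \<inter> ?I) \<times> ({a..b} \<inter> ?I)) f \<gamma>"
  have strip: "?Q x 0 1" if x: "x \<in> ?I" for x
  proof (rule Bolzano[where P="?Q x"], goal_cases le trans local)
    case (trans a b c)
    then obtain d \<gamma> e \<delta> where d: "d > 0" "parallel (({x - d..x + d} \<inter> ?I) \<times> ({a..b} \<inter> ?I)) f \<gamma>"
      and e: "e > 0" "parallel (({x - e..x + e} \<inter> ?I) \<times> ({b..c} \<inter> ?I)) f \<delta>" by blast
    define m where "m = min d e"
    let ?A = "({x - m..x + m} \<inter> ?I) \<times> ({a..b} \<inter> ?I)" and ?B = "({x - m..x + m} \<inter> ?I) \<times> ({b..c} \<inter> ?I)"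
    have "parallel ?A f \<gamma>" by (rule parallel_subset[OF d(2)]) (auto simp: m_def)
    moreover have "parallel ?B f \<delta>" by (rule parallel_subset[OF e(2)]) (auto simp: m_def)
    moreover have "closed ?A" "closed ?B" by (intro closed_Times closed_Int closed_atLeastAtMost)+
    moreover have "?A \<inter> ?B = ({x - m..x + m} \<inter> ?I) \<times> ({b..b} \<inter> ?I)" using trans by auto
    moreover have "connected (({x - m..x + m} \<inter> ?I) \<times> ({b..b} \<inter> ?I))"
      by (intro convex_connected convex_Times convex_Int convex_real_interval)
    moreover have "f \<in> ?A \<union> ?B \<rightarrow> topspace X" using fX by auto
    ultimately have "\<exists>\<eta>. parallel (?A \<union> ?B) f \<eta>" by (intro parallel_glue) simp_all
    moreover have "?A \<union> ?B = ({x - m..x + m} \<inter> ?I) \<times> ({a..c} \<inter> ?I)" using trans by auto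
    moreover have "m > 0" using d e by (simp add: m_def)
    ultimately show ?case by auto
  next
    case le show ?case by simp
  next
    case (local y)
    then obtain U \<gamma> where U: "open U" "(x, y) \<in> U" "parallel (?I \<times> ?I \<inter> U) f \<gamma>"
      using parallel_locally[OF f, of "(x, y)"] x by auto
    obtain V W where VW: "open V" "open W" "x \<in> V" "y \<in> W" "V \<times> W \<subseteq> U"
      using open_prod_elim[OF U(1,2)] by (metis mem_Sigma_iff)
    obtain d where d: "d > 0" "cball x d \<subseteq> V" using VW open_contains_cball by blast
    obtain e where e: "e > 0" "ball y e \<subseteq> W" using VW open_contains_ball by blast
    have small: "?Q x a b" if "a \<le> y" "y \<le> b" "b - a < e" for a b
    proof (intro exI[of _ d] exI[of _ \<gamma>] conjI d(1))
      have "({x - d..x + d} \<inter> ?I) \<times> ({a..b} \<inter> ?I) \<subseteq> ?I \<times> ?I \<inter> V \<times> W"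
        using d(2) e(2) that by (auto simp: subset_eq dist_real_def abs_le_iff)
      then have "({x - d..x + d} \<inter> ?I) \<times> ({a..b} \<inter> ?I) \<subseteq> ?I \<times> ?I \<inter> U" using VW(5) by (meson Int_mono order_refl order_trans)
      then show "parallel (({x - d..x + d} \<inter> ?I) \<times> ({a..b} \<inter> ?I)) f \<gamma>" by (rule parallel_subset[OF U(3)])
    qed
    show ?case
    proof (rule exI[of _ e], intro conjI e(1) allI impI)
      fix a b assume "a \<le> y \<and> y \<le> b \<and> b - a < e"
      then show "?Q x a b" by (intro small) simp_all
    qed
  qed
  let ?R = "\<lambda>a b. \<exists>\<gamma>. parallel (({a..b} \<inter> ?I) \<times> ?I) f \<gamma>"
  have "?R 0 1"
  proof (rule Bolzano[where P="?R"], goal_cases le trans local)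
    case (trans a b c)
    obtain \<gamma> where g: "parallel (({a..b} \<inter> ?I) \<times> ?I) f \<gamma>" using trans(1) by blast
    obtain \<delta> where g': "parallel (({b..c} \<inter> ?I) \<times> ?I) f \<delta>" using trans(2) by blast
    let ?A = "({a..b} \<inter> ?I) \<times> ?I" and ?B = "({b..c} \<inter> ?I) \<times> ?I"
    have "closed ?A" "closed ?B" by (intro closed_Times closed_Int closed_atLeastAtMost)+
    moreover have "?A \<inter> ?B = ({b..b} \<inter> ?I) \<times> ?I" using trans by auto
    moreover have "connected (({b..b} \<inter> ?I) \<times> ?I)"
      by (intro convex_connected convex_Times convex_Int convex_real_interval)
    moreover have "f \<in> ?A \<union> ?B \<rightarrow> topspace X" using fX by auto
    ultimately have "\<exists>\<eta>. parallel (?A \<union> ?B) f \<eta>" using g g' by (intro parallel_glue) simp_all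
    moreover have "?A \<union> ?B = ({a..c} \<inter> ?I) \<times> ?I" using trans by auto
    ultimately show ?case by simp
  next
    case le show ?case by simp
  next
    case (local x)
    then obtain d \<gamma> where d: "d > 0" "parallel (({x - d..x + d} \<inter> ?I) \<times> ({0..1} \<inter> ?I)) f \<gamma>"
      using strip[of x] by auto
    have small: "parallel (({a..b} \<inter> ?I) \<times> ?I) f \<gamma>" if "a \<le> x" "x \<le> b" "b - a < d" for a b
      by (rule parallel_subset[OF d(2)]) (use that in auto)
    show ?case
    proof (rule exI[of _ d], intro conjI d(1) allI impI)
      fix a b assume "a \<le> x \<and> x \<le> b \<and> b - a < d"
      then show "?R a b" using small by (intro exI[of _ \<gamma>]) simp
    qed
  qed
  then show ?thesis by simp
qed

lemma pathin_space: "pathin X p \<Longrightarrow> p \<in> {0..1} \<rightarrow> topspace X"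
  using continuous_map_image_subset_topspace[of _ X p] by (force simp: pathin_def)

lemma parallel_path:
  assumes "pathin X p" obtains \<gamma> where "parallel {0..1} p \<gamma>" "\<gamma> 0 = \<one>\<^bsub>G\<^esub>"
proof -
  have "continuous_map (top_of_set ({0..1::real} \<times> {0..1})) X (\<lambda>z. p (snd z))"
    by (rule continuous_map_top_of_set_compose[of "{0..1}"])
      (use assms in \<open>auto simp: pathin_def intro!: continuous_intros\<close>)
  then obtain \<gamma> where "parallel ({0..1::real} \<times> {0..1}) (\<lambda>z. p (snd z)) \<gamma>"
    using parallel_square by blast
  moreover have "continuous_on {0..1} (\<lambda>t::real. (0::real, t))"
    by (intro continuous_on_Pair continuous_on_const continuous_on_id)
  ultimately have *: "parallel {0..1} p (\<lambda>t. \<gamma> (0, t))"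
    using parallel_compose[of "{0..1::real} \<times> {0..1}" "\<lambda>z. p (snd z)" \<gamma> "{0..1}" "\<lambda>t. (0, t)"] by auto
  then have c: "\<gamma> (0, 0) \<in> carrier G" using parallelD(1) by force
  have "parallel {0..1} p (\<lambda>t. m_inv G (\<gamma> (0, 0)) \<otimes>\<^bsub>G\<^esub> \<gamma> (0, t))"
    using c assms by (intro parallel_left_mult[OF *] pathin_space) auto
  then show ?thesis by (rule that) (use c in simp)
qed

definition holonomy :: "(real \<Rightarrow> 'a) \<Rightarrow> 'g" where
  "holonomy p = (THE c. \<exists>\<gamma>. parallel {0..1} p \<gamma> \<and> \<gamma> 0 = \<one>\<^bsub>G\<^esub> \<and> \<gamma> 1 = c)"

lemma holonomy_eqI:
  assumes p: "pathin X p" and g: "parallel {0..1} p \<gamma>" "\<gamma> 0 = \<one>\<^bsub>G\<^esub>"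
  shows "holonomy p = \<gamma> 1"
  unfolding holonomy_def
proof (rule the_equality)
  fix c assume "\<exists>\<delta>. parallel {0..1} p \<delta> \<and> \<delta> 0 = \<one>\<^bsub>G\<^esub> \<and> \<delta> 1 = c"
  then obtain \<delta> where d: "parallel {0..1} p \<delta>" "\<delta> 0 = \<one>\<^bsub>G\<^esub>" "\<delta> 1 = c" by blast
  have "\<delta> 1 = \<gamma> 1"
    using d g by (intro parallel_unique[OF _ d(1) g(1) pathin_space[OF p], of 0 1]) auto
  then show "c = \<gamma> 1" using d by simp
qed (use g in blast)

lemma holonomy_eq_left_mult:
  assumes p: "pathin X p" and g: "parallel {0..1} p \<gamma>"
  shows "\<gamma> 0 \<otimes>\<^bsub>G\<^esub> holonomy p = \<gamma> 1"
proof -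
  have c: "\<gamma> 0 \<in> carrier G" "\<gamma> 1 \<in> carrier G" using parallelD(1)[OF g] by auto
  have "holonomy p = m_inv G (\<gamma> 0) \<otimes>\<^bsub>G\<^esub> \<gamma> 1"
    by (rule holonomy_eqI[OF p parallel_left_mult[OF g]]) (use c pathin_space[OF p] in auto)
  then show ?thesis using c by (simp add: m_assoc[symmetric])
qed

lemma holonomy_closed: "pathin X p \<Longrightarrow> holonomy p \<in> carrier G"
  using parallel_path[of p] holonomy_eqI parallelD(1) by (metis atLeastAtMost_iff order_refl zero_le_one)

lemma parallel_along_constant:
  assumes g: "parallel {0..1::real} f \<gamma>" and f: "\<And>t. t \<in> {0..1} \<Longrightarrow> f t = x" and x: "x \<in> topspace X"
    and s: "s \<in> {0..1}"
  shows "\<gamma> s = \<gamma> 0"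
proof -
  have c: "\<gamma> 0 \<in> carrier G" using parallelD(1)[OF g] by auto
  have const: "parallel {0..1} f (\<lambda>_. \<gamma> 0)"
    unfolding parallel_def using c x tau_refl[OF x] f by (auto intro!: exI[of _ UNIV])
  show ?thesis
    by (rule parallel_unique[OF _ g const _ _ _ s, of 0]) (use f x in auto)
qed

lemma holonomy_homotopic:
  assumes "path_homotopic X p q"
  shows "holonomy p = holonomy q"
proof -
  note e = path_homotopic_ends[OF assms]
  obtain h where h: "continuous_map (top_of_set ({0..1::real} \<times> {0..1::real})) X h" "\<forall>x. h (0, x) = p x" "\<forall>x. h (1, x) = q x"
    "\<forall>t\<in>{0..1}. h (t, 0) = p 0 \<and> h (t, 1) = p 1"
    using assms unfolding path_homotopic_iff by blast
  obtain \<gamma> where g: "parallel ({0..1} \<times> {0..1}) h \<gamma>" using parallel_square[OF h(1)] by blast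
  have side: "parallel {0..1} (\<lambda>t. h (c t, d t)) (\<lambda>t. \<gamma> (c t, d t))"
    if "continuous_on {0..1} c" "continuous_on {0..1} d" "c \<in> {0..1} \<rightarrow> {0..1}" "d \<in> {0..1} \<rightarrow> {0..1}" for c d :: "real \<Rightarrow> real"
    using parallel_compose[OF g, of "{0..1}" "\<lambda>t. (c t, d t)"] that by (auto intro!: continuous_intros)
  have p01: "p 0 \<in> topspace X" "p 1 \<in> topspace X" using pathin_space[OF e(1)] by auto
  have "\<gamma> (1, 0) = \<gamma> (0, 0)"
    using parallel_along_constant[OF side[of "\<lambda>t. t" "\<lambda>_. 0"], of "p 0" 1] h(4) p01 by simp
  moreover have "\<gamma> (1, 1) = \<gamma> (0, 1)"
    using parallel_along_constant[OF side[of "\<lambda>t. t" "\<lambda>_. 1"], of "p 1" 1] h(4) p01 by simp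
  moreover have "\<gamma> (0, 0) \<otimes>\<^bsub>G\<^esub> holonomy p = \<gamma> (0, 1)"
    using holonomy_eq_left_mult[OF e(1), of "\<lambda>t. \<gamma> (0, t)"] side[of "\<lambda>_. 0" "\<lambda>t. t"] h(2) by simp
  moreover have "\<gamma> (1, 0) \<otimes>\<^bsub>G\<^esub> holonomy q = \<gamma> (1, 1)"
    using holonomy_eq_left_mult[OF e(2), of "\<lambda>t. \<gamma> (1, t)"] side[of "\<lambda>_. 1" "\<lambda>t. t"] h(3) by simp
  moreover have "\<gamma> (0, 0) \<in> carrier G" using parallelD(1)[OF g] by auto
  ultimately show ?thesis
    using holonomy_closed[OF e(1)] holonomy_closed[OF e(2)] by (metis Units_eq Units_l_cancel)
qed

lemma holonomy_concat:
  assumes p: "pathin X p" and q: "pathin X q" and pq: "p 1 = q 0"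
  shows "holonomy (concat_paths p q) = holonomy p \<otimes>\<^bsub>G\<^esub> holonomy q"
proof -
  obtain \<gamma> where g: "parallel {0..1} p \<gamma>" "\<gamma> 0 = \<one>\<^bsub>G\<^esub>" using parallel_path[OF p] by blast
  obtain \<delta> where d: "parallel {0..1} q \<delta>" "\<delta> 0 = \<one>\<^bsub>G\<^esub>" using parallel_path[OF q] by blast
  have g1: "\<gamma> 1 \<in> carrier G" using parallelD(1)[OF g(1)] by simp
  have d': "parallel {0..1} q (\<lambda>t. \<gamma> 1 \<otimes>\<^bsub>G\<^esub> \<delta> t)"
    by (rule parallel_left_mult[OF d(1) g1 pathin_space[OF q]])
  let ?\<eta> = "\<lambda>t. if t \<le> 1/2 then \<gamma> (2 * t) else \<gamma> 1 \<otimes>\<^bsub>G\<^esub> \<delta> (2 * t - 1)"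
  have "parallel {0..1/2} (\<lambda>t. p (2 * t)) (\<lambda>t. \<gamma> (2 * t))"
    by (rule parallel_compose[OF g(1)]) (auto intro!: continuous_intros)
  then have 1: "parallel {0..1/2} (concat_paths p q) ?\<eta>"
    by (rule parallel_cong) (auto simp: concat_paths_def)
  have "parallel {1/2..1} (\<lambda>t. q (2 * t - 1)) (\<lambda>t. \<gamma> 1 \<otimes>\<^bsub>G\<^esub> \<delta> (2 * t - 1))"
    by (rule parallel_compose[OF d']) (auto intro!: continuous_intros)
  then have 2: "parallel {1/2..1} (concat_paths p q) ?\<eta>"
  proof (rule parallel_cong)
    fix s :: real assume s: "s \<in> {1/2..1}"
    show "q (2 * s - 1) = concat_paths p q s \<and> \<gamma> 1 \<otimes>\<^bsub>G\<^esub> \<delta> (2 * s - 1) = ?\<eta> s"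
    proof (cases "s = 1/2")
      case True
      show ?thesis unfolding True using pq d(2) g1 by (simp add: concat_paths_def)
    next
      case False
      then show ?thesis using s by (simp add: concat_paths_def)
    qed
  qed
  have "parallel ({0..1/2} \<union> {1/2..1}) (concat_paths p q) ?\<eta>"
    by (rule parallel_union[OF 1 2]) auto
  moreover have "{0..1/2} \<union> {1/2..1} = {0..1::real}" by auto
  ultimately have "parallel {0..1} (concat_paths p q) ?\<eta>" by simp
  from holonomy_eqI[OF pathin_concat[OF p q pq] this]
  have "holonomy (concat_paths p q) = \<gamma> 1 \<otimes>\<^bsub>G\<^esub> \<delta> 1" using g(2) by simp
  then show ?thesis using holonomy_eqI[OF p g] holonomy_eqI[OF q d] by simp
qed

lemma holonomy_hom:
  "\<exists>\<Phi>\<in>hom (fundamental_group X x) G. \<forall>p\<in>loops X x. \<Phi> (path_class X x p) = holonomy p"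
proof -
  define \<Phi> where "\<Phi> A = holonomy (SOME p. p \<in> A)" for A
  have eq: "\<Phi> (path_class X x p) = holonomy p" if p: "p \<in> loops X x" for p
  proof -
    have "p \<in> path_class X x p"
      using p by (auto simp: loop_homotopy_iff loops_def intro: path_homotopic_refl)
    then have "(SOME r. r \<in> path_class X x p) \<in> path_class X x p"
      by (rule someI[of "\<lambda>r. r \<in> path_class X x p"])
    then have "(p, SOME r. r \<in> path_class X x p) \<in> loop_homotopy X x" by (rule Image_singleton_iff[THEN iffD1])
    then have "path_homotopic X p (SOME r. r \<in> path_class X x p)" unfolding loop_homotopy_iff by (rule conjunct2)
    then show ?thesis unfolding \<Phi>_def by (rule holonomy_homotopic[symmetric])
  qed
  have "\<Phi> \<in> hom (fundamental_group X x) G"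
  proof (rule homI)
    fix A assume "A \<in> carrier (fundamental_group X x)"
    then obtain p where p: "p \<in> loops X x" "A = path_class X x p" by (rule carrier_fundamental_groupE)
    then show "\<Phi> A \<in> carrier G" by (simp add: eq holonomy_closed loops_def)
    fix B assume "B \<in> carrier (fundamental_group X x)"
    then obtain q where q: "q \<in> loops X x" "B = path_class X x q" by (rule carrier_fundamental_groupE)
    show "\<Phi> (A \<otimes>\<^bsub>fundamental_group X x\<^esub> B) = \<Phi> A \<otimes>\<^bsub>G\<^esub> \<Phi> B"
      unfolding p(2) q(2) mult_path_class[OF p(1) q(1)] using p q
      by (simp add: eq loops_concat) (intro holonomy_concat; simp add: loops_def)
  qed
  then show ?thesis using eq by blast
qed

end


(* Topo3 *)


definition partner :: "nat \<Rightarrow> nat" where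
  "partner j = (if j mod 4 < 2 then j + 2 else j - 2)"

definition mirror :: "nat \<Rightarrow> real \<Rightarrow> real" where
  "mirror j s = real j + real (partner j) + 1 - s"

definition edge_pairs :: "nat \<Rightarrow> nat \<Rightarrow> (complex \<times> complex) set" where
  "edge_pairs g j =
     (\<lambda>s. (polygon_boundary g s, polygon_boundary g (mirror j s))) ` {real j..real j + 1}"

definition vertices :: "nat \<Rightarrow> complex set" where
  "vertices g = (\<lambda>n. polygon_boundary g (real n)) ` {..<4 * g}"

lemma partner_block:
  "partner (4 * k) = 4 * k + 2" "partner (4 * k + 1) = 4 * k + 3"
  "partner (4 * k + 2) = 4 * k" "partner (4 * k + 3) = 4 * k + 1"
  unfolding partner_def mod_mult_self4 by simp_all

lemma block_cases:
  fixes j :: nat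
  obtains k where "j = 4 * k" | k where "j = 4 * k + 1" | k where "j = 4 * k + 2" | k where "j = 4 * k + 3"
proof -
  have "j = 4 * (j div 4) + j mod 4" by simp
  moreover have "j mod 4 = 0 \<or> j mod 4 = 1 \<or> j mod 4 = 2 \<or> j mod 4 = 3" by linarith
  ultimately show ?thesis using that by (metis add_0_right)
qed

lemma partner_less: "j < 4 * g \<Longrightarrow> partner j < 4 * g"
  by (cases j rule: block_cases) (simp_all only: partner_block, presburger+)

lemma partner_partner: "partner (partner j) = j"
  by (cases j rule: block_cases) (simp_all only: partner_block)

lemma mirror_mirror: "mirror (partner j) (mirror j s) = s"
  by (simp add: mirror_def partner_partner)

lemma mirror_range: "s \<in> {real j..real j + 1} \<Longrightarrow> mirror j s \<in> {real (partner j)..real (partner j) + 1}"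
  by (simp add: mirror_def)

lemma edge_pairs_sym: "(z, w) \<in> edge_pairs g j \<Longrightarrow> (w, z) \<in> edge_pairs g (partner j)"
proof -
  assume "(z, w) \<in> edge_pairs g j"
  then obtain s where s: "s \<in> {real j..real j + 1}" "z = polygon_boundary g s" "w = polygon_boundary g (mirror j s)"
    by (auto simp: edge_pairs_def)
  show ?thesis
    unfolding edge_pairs_def
    by (rule image_eqI[of _ _ "mirror j s"]) (use s mirror_mirror mirror_range in simp_all)
qed

lemma side_pairing_iff: "side_pairing g z w \<longleftrightarrow> (\<exists>j<4 * g. j mod 4 < 2 \<and> (z, w) \<in> edge_pairs g j)"
proof
  assume "side_pairing g z w"
  then obtain k r t where *: "k < g" "r \<in> {0, 1::real}" "t \<in> {0..1}"
    "z = polygon_boundary g (4 * real k + r + t)" "w = polygon_boundary g (4 * real k + r + 2 + (1 - t))"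
    unfolding side_pairing_def by blast
  define j where "j = 4 * k + (if r = 0 then 0 else 1)"
  have j: "real j = 4 * real k + r" "j < 4 * g" "j mod 4 < 2" using * by (auto simp: j_def)
  have "(z, w) \<in> edge_pairs g j"
    unfolding edge_pairs_def
    by (rule image_eqI[of _ _ "real j + t"]) (use * j in \<open>auto simp: mirror_def partner_def algebra_simps\<close>)
  then show "\<exists>j<4 * g. j mod 4 < 2 \<and> (z, w) \<in> edge_pairs g j" using j by blast
next
  assume "\<exists>j<4 * g. j mod 4 < 2 \<and> (z, w) \<in> edge_pairs g j"
  then obtain j s where j: "j < 4 * g" "j mod 4 < 2" and s: "s \<in> {real j..real j + 1}"
    "z = polygon_boundary g s" "w = polygon_boundary g (mirror j s)"
    by (auto simp: edge_pairs_def)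
  define k r t where "k = j div 4" and "r = real (j mod 4)" and "t = s - real j"
  have jr: "real j = 4 * real k + r" 
  proof -
    have "real j = real (4 * k + j mod 4)" by (simp add: k_def)
    then show ?thesis by (simp only: r_def of_nat_add of_nat_mult of_nat_numeral)
  qed
  have "j mod 4 = 0 \<or> j mod 4 = 1" using j(2) by linarith
  then have "k < g" "r \<in> {0, 1}" "t \<in> {0..1}" using j s by (auto simp: k_def r_def t_def)
  moreover have "z = polygon_boundary g (4 * real k + r + t)" using s jr by (simp add: t_def)
  moreover have "mirror j s = 4 * real k + r + 2 + (1 - t)"
    using j(2) jr by (simp add: mirror_def partner_def t_def)
  ultimately show "side_pairing g z w" unfolding side_pairing_def using s(3) by metis
qed

lemma polygon_boundary_eq_iff:
  assumes "g \<ge> 1"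
  shows "polygon_boundary g s = polygon_boundary g u \<longleftrightarrow> (\<exists>n::int. s = u + 4 * real g * real_of_int n)"
proof -
  have "polygon_boundary g s = polygon_boundary g u \<longleftrightarrow>
      (\<exists>n::int. 2 * pi * s / (4 * real g) = 2 * pi * u / (4 * real g) + 2 * pi * n)"
    unfolding polygon_boundary_def sin_cos_eq_iff[symmetric] by (auto simp: complex_eq_iff)
  moreover have "2 * pi * s / (4 * real g) = 2 * pi * u / (4 * real g) + 2 * pi * n \<longleftrightarrow> s = u + 4 * real g * n" for n :: int
  proof -
    define c where "c = 2 * pi / (4 * real g)"
    have c: "c \<noteq> 0" "\<And>x. 2 * pi * x / (4 * real g) = c * x" "2 * pi * real_of_int n = c * (4 * real g * real_of_int n)"
      using assms by (simp_all add: c_def)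
    have "c * s = c * u + c * (4 * real g * n) \<longleftrightarrow> s = u + 4 * real g * n"
      using c(1) by (metis distrib_left mult_left_cancel)
    then show ?thesis unfolding c(2) c(3) .
  qed
  ultimately show ?thesis by simp
qed

lemma polygon_boundary_inj:
  assumes g: "g \<ge> 1" and eq: "polygon_boundary g s = polygon_boundary g u" and d: "\<bar>s - u\<bar> < 4 * real g"
  shows "s = u"
proof -
  obtain n :: int where n: "s = u + 4 * real g * n" using eq polygon_boundary_eq_iff[OF g] by blast
  have "\<bar>4 * real g * real_of_int n\<bar> < 4 * real g" using d n by simp
  then have "\<bar>real_of_int n\<bar> < 1" using g by (simp add: abs_mult)
  then have "n = 0" by linarith
  then show ?thesis using n by simp
qed

lemma polygon_boundary_period: "g \<ge> 1 \<Longrightarrow> polygon_boundary g (s + 4 * real g) = polygon_boundary g s"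
  unfolding polygon_boundary_eq_iff by (rule exI[of _ 1]) simp

lemma norm_polygon_boundary [simp]: "norm (polygon_boundary g s) = 1"
  by (simp add: polygon_boundary_def)

lemma continuous_polygon_boundary: "continuous_on A (polygon_boundary g)"
  unfolding polygon_boundary_def divide_inverse
  by (intro continuous_intros)

lemma vertices_iff:
  assumes g: "g \<ge> 1"
  shows "polygon_boundary g s \<in> vertices g \<longleftrightarrow> s \<in> \<int>"
proof
  assume "polygon_boundary g s \<in> vertices g"
  then obtain k where "polygon_boundary g s = polygon_boundary g (real k)" by (auto simp: vertices_def)
  then obtain n :: int where n: "s = real k + 4 * real g * n" using polygon_boundary_eq_iff[OF g] by blast
  show "s \<in> \<int>" unfolding n by (intro Ints_add Ints_mult) auto
next
  assume "s \<in> \<int>"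
  then obtain m where m: "s = real_of_int m" by (rule Ints_cases)
  define k where "k = nat (m mod (4 * int g))"
  have k: "int k = m mod (4 * int g)" "k < 4 * g" using g by (simp_all add: k_def nat_less_iff)
  have "m = int k + 4 * int g * (m div (4 * int g))" unfolding k(1) by simp
  then have "real_of_int m = real_of_int (int k + 4 * int g * (m div (4 * int g)))" by (rule arg_cong)
  then have "s = real k + 4 * real g * real_of_int (m div (4 * int g))"
    by (simp only: m of_int_add of_int_mult of_int_numeral of_int_of_nat_eq)
  then have "polygon_boundary g s = polygon_boundary g (real k)" using polygon_boundary_eq_iff[OF g] by blast
  then show "polygon_boundary g s \<in> vertices g" using k by (auto simp: vertices_def)
qed

lemma edge_pairs_vertices:
  assumes "g \<ge> 1" "(z, w) \<in> edge_pairs g j"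
  shows "z \<in> vertices g \<longleftrightarrow> w \<in> vertices g"
proof -
  obtain s where s: "z = polygon_boundary g s" "w = polygon_boundary g (mirror j s)"
    using assms(2) by (auto simp: edge_pairs_def)
  have "mirror j s \<in> \<int> \<longleftrightarrow> s \<in> \<int>"
  proof -
    have "mirror j s = real_of_int (int j + int (partner j) + 1) - s" by (simp add: mirror_def)
    then show ?thesis by (metis Ints_diff Ints_of_int diff_diff_eq2 add_diff_cancel_left')
  qed
  then show ?thesis by (simp add: s vertices_iff[OF assms(1)])
qed

lemma edge_pairs_dist:
  assumes "(z, z') \<in> edge_pairs g j" "(w, w') \<in> edge_pairs g j"
  shows "dist w' z' = dist w z"
proof -
  obtain s u where s: "z = polygon_boundary g s" "z' = polygon_boundary g (mirror j s)"
    "w = polygon_boundary g u" "w' = polygon_boundary g (mirror j u)"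
    using assms by (auto simp: edge_pairs_def)
  define c where "c = real j + real (partner j) + 1"
  have m: "polygon_boundary g (mirror j x) = polygon_boundary g c * cnj (polygon_boundary g x)" for x
    by (simp add: polygon_boundary_def mirror_def c_def cis_cnj cis_mult field_simps diff_divide_distrib add_divide_distrib)
  have "w' - z' = polygon_boundary g c * cnj (w - z)" unfolding s m by (simp add: algebra_simps)
  then show ?thesis by (simp add: dist_norm norm_mult del: complex_cnj_diff)
qed

definition glued :: "nat \<Rightarrow> complex \<Rightarrow> complex \<Rightarrow> bool" where
  "glued g z w \<longleftrightarrow> z = w \<or> (\<exists>j<4 * g. (z, w) \<in> edge_pairs g j) \<or> (z \<in> vertices g \<and> w \<in> vertices g)"

lemma edge_pairs_compose:
  assumes g: "g \<ge> 1" and zy: "(z, y) \<in> edge_pairs g i" "i < 4 * g" and yw: "(y, w) \<in> edge_pairs g j" "j < 4 * g"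
  shows "glued g z w"
proof (cases "y \<in> vertices g")
  case True
  then show ?thesis using edge_pairs_vertices[OF g] zy yw unfolding glued_def by blast
next
  case False
  obtain s where s: "s \<in> {real i..real i + 1}" "z = polygon_boundary g s" "y = polygon_boundary g (mirror i s)"
    using zy by (auto simp: edge_pairs_def)
  obtain u where u: "u \<in> {real j..real j + 1}" "y = polygon_boundary g u" "w = polygon_boundary g (mirror j u)"
    using yw by (auto simp: edge_pairs_def)
  have notint: "mirror i s \<notin> \<int>" "u \<notin> \<int>"
    using False unfolding s(3) vertices_iff[OF g] using False unfolding u(2) vertices_iff[OF g] by auto
  have r: "mirror i s \<in> {real (partner i)..real (partner i) + 1}" using s(1) by (rule mirror_range)
  have "real (partner i) + 1 \<le> 4 * real g" "real j + 1 \<le> 4 * real g"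
    using partner_less[OF zy(2)] yw(2) by linarith+
  moreover have "mirror i s \<noteq> real (partner i)" "u \<noteq> real j"
    using notint by auto
  moreover have "mirror i s \<noteq> real (partner i) + 1" "u \<noteq> real j + 1"
    using notint by (metis Ints_of_nat of_nat_Suc add.commute)+
  ultimately have "\<bar>mirror i s - u\<bar> < 4 * real g" and strict: "mirror i s \<in> {real (partner i)<..<real (partner i) + 1}"
    "u \<in> {real j<..<real j + 1}"
    using r u(1) by (auto simp: abs_less_iff)
  then have eq: "mirror i s = u"
    using polygon_boundary_inj[OF g] s(3) u(2) by metis
  then have "real j < real (partner i) + 1" "real (partner i) < real j + 1" using strict by auto
  then have "j = partner i" by linarith
  then have "w = z" using u(3) s(2) eq mirror_mirror[of i s] by simp
  then show ?thesis by (simp add: glued_def)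
qed

lemma glued_trans_edge:
  assumes g: "g \<ge> 1" and "glued g z y" and yw: "(y, w) \<in> edge_pairs g j" "j < 4 * g"
  shows "glued g z w"
proof -
  consider "z = y" | i where "i < 4 * g" "(z, y) \<in> edge_pairs g i" | "z \<in> vertices g" "y \<in> vertices g"
    using assms(2) unfolding glued_def by blast
  then show ?thesis
  proof cases
    case 1
    then show ?thesis using yw unfolding glued_def by blast
  next
    case 2
    then show ?thesis using edge_pairs_compose[OF g] yw by blast
  next
    case 3
    then show ?thesis using edge_pairs_vertices[OF g yw(1)] unfolding glued_def by blast
  qed
qed

lemma edge_pairs_equivclp:
  assumes "(z, w) \<in> edge_pairs g j" "j < 4 * g"
  shows "side_pairing g z w \<or> side_pairing g w z"
proof (cases "j mod 4 < 2")
  case True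
  then show ?thesis using assms side_pairing_iff by blast
next
  case False
  then have "partner j mod 4 < 2"
    by (cases j rule: block_cases) (simp_all only: partner_block, simp_all add: mod_mult_self4)
  then show ?thesis using edge_pairs_sym[OF assms(1)] partner_less[OF assms(2)] side_pairing_iff by blast
qed

lemma edge_pairs_start:
  "(polygon_boundary g (real j), polygon_boundary g (real (partner j) + 1)) \<in> edge_pairs g j"
  "(polygon_boundary g (real j + 1), polygon_boundary g (real (partner j))) \<in> edge_pairs g j"
  unfolding edge_pairs_def
  by (rule image_eqI[of _ _ "real j"], simp_all add: mirror_def)
     (rule image_eqI[of _ _ "real j + 1"], simp_all add: mirror_def)

lemma edge_pairs_corners:
  "(polygon_boundary g (real (4 * k)), polygon_boundary g (real (4 * k + 3))) \<in> edge_pairs g (4 * k)"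
  "(polygon_boundary g (real (4 * k + 3)), polygon_boundary g (real (4 * k + 2))) \<in> edge_pairs g (4 * k + 3)"
  "(polygon_boundary g (real (4 * k + 2)), polygon_boundary g (real (4 * k + 1))) \<in> edge_pairs g (4 * k + 2)"
  "(polygon_boundary g (real (4 * k + 1)), polygon_boundary g (real (4 * k + 4))) \<in> edge_pairs g (4 * k + 1)"
proof -
  have e: "real (4 * k + 2) + 1 = real (4 * k + 3)" "real (4 * k + 1) + 1 = real (4 * k + 2)"
    "real (4 * k) + 1 = real (4 * k + 1)" "real (4 * k + 3) + 1 = real (4 * k + 4)" by simp_all
  show "(polygon_boundary g (real (4 * k)), polygon_boundary g (real (4 * k + 3))) \<in> edge_pairs g (4 * k)"
    using edge_pairs_start(1)[of g "4 * k"] unfolding partner_block e .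
  show "(polygon_boundary g (real (4 * k + 3)), polygon_boundary g (real (4 * k + 2))) \<in> edge_pairs g (4 * k + 3)"
    using edge_pairs_start(1)[of g "4 * k + 3"] unfolding partner_block e .
  show "(polygon_boundary g (real (4 * k + 2)), polygon_boundary g (real (4 * k + 1))) \<in> edge_pairs g (4 * k + 2)"
    using edge_pairs_start(1)[of g "4 * k + 2"] unfolding partner_block e .
  show "(polygon_boundary g (real (4 * k + 1)), polygon_boundary g (real (4 * k + 4))) \<in> edge_pairs g (4 * k + 1)"
    using edge_pairs_start(1)[of g "4 * k + 1"] unfolding partner_block e .
qed

lemma vertices_equivclp:
  assumes g: "g \<ge> 1" and "z \<in> vertices g" "w \<in> vertices g"
  shows "equivclp (side_pairing g) z w"
proof -
  let ?b = "\<lambda>n. polygon_boundary g (real n)"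
  have e: "equivclp (side_pairing g) z w" if "(z, w) \<in> edge_pairs g j" "j < 4 * g" for z w j
    using edge_pairs_equivclp[OF that] by (metis equivclp_sym r_into_equivclp)
  have block: "equivclp (side_pairing g) (?b (4 * k)) (?b (4 * k + i))" if "k < g" "i \<le> 4" for k i
  proof -
    have l: "4 * k < 4 * g" "4 * k + 3 < 4 * g" "4 * k + 2 < 4 * g" "4 * k + 1 < 4 * g"
      using that by linarith+
    note E = e[OF edge_pairs_corners(1) l(1)] e[OF edge_pairs_corners(2) l(2)]
      e[OF edge_pairs_corners(3) l(3)] e[OF edge_pairs_corners(4) l(4)]
    note P = equivclp_trans[OF E(1) E(2)]
    note Q = equivclp_trans[OF P E(3)]
    have R: "equivclp (side_pairing g) (?b (4 * k)) (?b (4 * k + 0))" by simp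
    have "i = 0 \<or> i = 1 \<or> i = 2 \<or> i = 3 \<or> i = 4" using that(2) by arith
    then consider "i = 0" | "i = 1" | "i = 2" | "i = 3" | "i = 4" by blast
    then show ?thesis
      by cases (use R E(1) P Q equivclp_trans[OF Q E(4)] in \<open>simp_all only:\<close>)
  qed
  have base: "equivclp (side_pairing g) (?b 0) (?b (4 * k))" if "k \<le> g" for k
    using that
  proof (induction k)
    case (Suc k)
    have "?b (4 * Suc k) = ?b (4 * k + 4)" by (simp add: add.commute)
    then show ?case using Suc block[of k 4] by (metis Suc_le_lessD equivclp_trans less_imp_le order_refl)
  qed simp
  have all: "equivclp (side_pairing g) (?b 0) (?b n)" if "n < 4 * g" for n
  proof -
    have "equivclp (side_pairing g) (?b 0) (?b (4 * (n div 4)))" using that by (intro base) linarith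
    moreover have "equivclp (side_pairing g) (?b (4 * (n div 4))) (?b (4 * (n div 4) + n mod 4))"
      using that by (intro block) (auto simp: less_imp_le_nat)
    ultimately show ?thesis by (metis equivclp_trans mult_div_mod_eq)
  qed
  obtain m n where "m < 4 * g" "z = ?b m" "n < 4 * g" "w = ?b n"
    using assms(2,3) by (auto simp: vertices_def)
  then show ?thesis using all by (metis equivclp_sym equivclp_trans)
qed

lemma glued_iff_equivclp:
  assumes g: "g \<ge> 1"
  shows "equivclp (side_pairing g) z w \<longleftrightarrow> glued g z w"
proof
  assume "equivclp (side_pairing g) z w"
  then show "glued g z w"
  proof (induction rule: equivclp_induct)
    case base
    show ?case by (simp add: glued_def)
  next
    case (step y w)
    then obtain j where "j < 4 * g" "(y, w) \<in> edge_pairs g j \<or> (w, y) \<in> edge_pairs g j"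
      using side_pairing_iff by blast
    then have "\<exists>j<4 * g. (y, w) \<in> edge_pairs g j" using edge_pairs_sym partner_less by blast
    then show ?case using glued_trans_edge[OF g step.IH] by blast
  qed
next
  assume "glued g z w"
  then consider "z = w" | j where "j < 4 * g" "(z, w) \<in> edge_pairs g j" | "z \<in> vertices g" "w \<in> vertices g"
    unfolding glued_def by blast
  then show "equivclp (side_pairing g) z w"
  proof cases
    case 2
    then show ?thesis using edge_pairs_equivclp by (metis equivclp_sym r_into_equivclp)
  qed (use vertices_equivclp[OF g] in auto)
qed


(* Topo4 *)


definition close_pair :: "nat \<Rightarrow> complex \<Rightarrow> complex \<Rightarrow> complex \<Rightarrow> complex \<Rightarrow> bool" where
  "close_pair g z z' w w' \<longleftrightarrow> (z = z' \<and> w = w') \<or> (w = z \<and> w' = z') \<or>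
     (\<exists>j<4 * g. (z, z') \<in> edge_pairs g j \<and> (w, w') \<in> edge_pairs g j)"

lemma edge_pairs_norm: "(z, w) \<in> edge_pairs g j \<Longrightarrow> norm z = 1 \<and> norm w = 1"
  by (auto simp: edge_pairs_def)

lemma separated_points:
  fixes S :: "complex set"
  assumes "finite S"
  shows "\<exists>d>0. \<forall>a\<in>S. \<forall>b\<in>S. a \<noteq> b \<longrightarrow> d \<le> dist a b"
proof -
  let ?P = "{p \<in> S \<times> S. fst p \<noteq> snd p}" and ?T = "{p :: complex \<times> complex. fst p = snd p}"
  have "finite ?P" by (rule finite_subset[OF _ finite_cartesian_product[OF assms assms]]) auto
  moreover have "closed ?T" by (intro closed_Collect_eq continuous_intros)
  ultimately obtain d where d: "d > 0" "\<forall>x\<in>?P. \<forall>y\<in>?T. d \<le> dist x y"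
    using separate_compact_closed[of ?P ?T] by (auto simp: finite_imp_compact)
  have "d \<le> dist a b" if "a \<in> S" "b \<in> S" "a \<noteq> b" for a b
  proof -
    have "(a, b) \<in> ?P" "(b, b) \<in> ?T" using that by auto
    then have "d \<le> dist (a, b) (b, b)" using d(2) by blast
    then show ?thesis by (simp add: dist_Pair_Pair)
  qed
  then show ?thesis using d(1) by blast
qed

definition shrink :: "complex \<Rightarrow> complex \<Rightarrow> real \<Rightarrow> complex" where
  "shrink z w t = (if norm z = 1 then z * exp (of_real (1 - t) * Ln (w / z))
                   else of_real (1 - t) * w + of_real t * z)"

lemma ratio_near_one:
  fixes z w :: complex
  assumes z: "norm z = 1" and d: "dist w z < 1/2"
  shows "w \<noteq> 0" "w / z \<notin> \<real>\<^sub>\<le>\<^sub>0" "norm (w / z) = norm w"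
proof -
  have z0: "z \<noteq> 0" using z by auto
  have "w / z - 1 = (w - z) / z" using z0 by (simp add: diff_divide_distrib)
  then have "norm (w / z - 1) = norm (w - z) / norm z" by (simp only: norm_divide)
  then have "norm (w / z - 1) = norm (w - z)" unfolding z by simp
  then have n: "norm (w / z - 1) < 1/2" using d by (simp add: dist_norm)
  then have "\<bar>Re (w / z - 1)\<bar> < 1/2" using abs_Re_le_cmod[of "w / z - 1"] by linarith
  then have "\<bar>Re (w / z) - 1\<bar> < 1/2" by (simp only: minus_complex.sel one_complex.sel)
  then have re: "Re (w / z) > 0" by linarith
  then show "w / z \<notin> \<real>\<^sub>\<le>\<^sub>0" by (auto simp: complex_nonpos_Reals_iff)
  show "w \<noteq> 0" using re by auto
  show "norm (w / z) = norm w" using z by (simp add: norm_divide)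
qed

lemma shrink_in_disc:
  assumes z: "norm z \<le> 1" and w: "norm w \<le> 1" and d: "dist w z < 1/2" and t: "t \<in> {0..1}"
  shows "norm (shrink z w t) \<le> 1"
proof (cases "norm z = 1")
  case True
  note r = ratio_near_one[OF True d]
  have "w / z \<noteq> 0" using r(2) by auto
  then have "Re (of_real (1 - t) * Ln (w / z)) = (1 - t) * ln (norm w)" using r(3) by simp
  also have "\<dots> \<le> 0" using t w r(1) by (intro mult_nonneg_nonpos) auto
  finally show ?thesis using True by (simp add: shrink_def norm_mult norm_exp_eq_Re)
next
  case False
  have "(1 - t) *\<^sub>R w + t *\<^sub>R z \<in> cball 0 1"
    using t z w by (intro convexD_alt[OF convex_cball]) auto
  then show ?thesis using False by (simp add: shrink_def scaleR_conv_of_real)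
qed

lemma shrink_ends:
  assumes "dist w z < 1/2"
  shows "shrink z w 0 = w" "shrink z w 1 = z" "shrink z z t = z"
proof -
  have "exp (Ln (w / z)) = w / z \<and> z \<noteq> 0" if "norm z = 1"
  proof -
    have "w / z \<noteq> 0" using ratio_near_one(2)[OF that assms] by auto
    then show ?thesis using exp_Ln by auto
  qed
  then show "shrink z w 0 = w" by (auto simp: shrink_def)
  show "shrink z w 1 = z" by (simp add: shrink_def)
  show "shrink z z t = z" 
  proof (cases "norm z = 1")
    case True
    then have "z \<noteq> 0" by auto
    then show ?thesis using True by (simp add: shrink_def)
  qed (simp add: shrink_def algebra_simps)
qed

lemma continuous_shrink:
  "continuous_on ({w. dist w z < 1/2} \<times> {0..1}) (\<lambda>p. shrink z (fst p) (snd p))"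
proof (cases "norm z = 1")
  case True
  have "continuous_on ({w. dist w z < 1/2} \<times> {0..1::real}) (\<lambda>p. Ln (fst p / z))"
    using ratio_near_one(2)[OF True] True by (intro continuous_on_Ln' continuous_intros) auto
  then show ?thesis using True unfolding shrink_def by (auto intro!: continuous_intros)
next
  case False
  then show ?thesis unfolding shrink_def by (auto intro!: continuous_intros)
qed

lemma shrink_boundary:
  assumes g: "g \<ge> 1" and su: "\<bar>u - s\<bar> \<le> 1"
  shows "shrink (polygon_boundary g s) (polygon_boundary g u) t = polygon_boundary g (s + (1 - t) * (u - s))"
proof -
  define \<theta> where "\<theta> x = 2 * pi * x / (4 * real g)" for x
  have th: "polygon_boundary g x = exp (\<i> * of_real (\<theta> x))" for x
    by (simp add: polygon_boundary_def \<theta>_def cis_conv_exp)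
  have "\<bar>\<theta> (u - s)\<bar> = 2 * pi * \<bar>u - s\<bar> / (4 * real g)" by (simp add: \<theta>_def abs_mult)
  also have "\<dots> \<le> 2 * pi * 1 / (4 * 1)" using g su by (intro frac_le mult_left_mono) auto
  also have "\<dots> < pi" by simp
  finally have bd: "- pi < \<theta> (u - s)" "\<theta> (u - s) \<le> pi" by auto
  have lin: "\<theta> (x + c * y) = \<theta> x + c * \<theta> y" for x y c
    by (simp add: \<theta>_def add_divide_distrib algebra_simps)
  have diff: "\<theta> (u - s) = \<theta> u - \<theta> s" by (simp add: \<theta>_def diff_divide_distrib right_diff_distrib)
  have "exp (\<i> * of_real (\<theta> (u - s))) = polygon_boundary g u / polygon_boundary g s"
    unfolding th exp_diff[symmetric] diff by (simp add: right_diff_distrib)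
  then have "Ln (polygon_boundary g u / polygon_boundary g s) = \<i> * of_real (\<theta> (u - s))"
    by (rule Ln_unique) (use bd in simp_all)
  moreover have "polygon_boundary g (s + (1 - t) * (u - s)) =
      polygon_boundary g s * exp (of_real (1 - t) * (\<i> * of_real (\<theta> (u - s))))"
    unfolding th lin exp_add[symmetric] by (simp add: algebra_simps)
  ultimately show ?thesis by (simp add: shrink_def)
qed

locale glued_polygon =
  fixes g :: nat and X :: "'a topology" and q :: "complex \<Rightarrow> 'a"
  assumes g_pos: "g \<ge> 1"
    and quotient: "quotient_map (top_of_set (cball 0 1)) X q"
    and fibres: "\<And>z w. z \<in> cball 0 1 \<Longrightarrow> w \<in> cball 0 1 \<Longrightarrow> q z = q w \<longleftrightarrow> glued g z w"
begin

abbreviation disc :: "complex set" where "disc \<equiv> cball 0 1"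

lemma q_continuous: "continuous_map (top_of_set disc) X q"
  using quotient by (rule quotient_imp_continuous_map)

lemma q_image: "q ` disc = topspace X"
  using quotient_imp_surjective_map[OF quotient] by simp

lemma q_space: "z \<in> disc \<Longrightarrow> q z \<in> topspace X"
  using q_image by blast

lemma edge_pairs_disc:
  assumes "(z, w) \<in> edge_pairs g j" "j < 4 * g"
  shows "z \<in> disc" "w \<in> disc" "q z = q w"
proof -
  show "z \<in> disc" "w \<in> disc" using edge_pairs_norm[OF assms(1)] by auto
  then show "q z = q w" using assms fibres by (auto simp: glued_def)
qed

lemma finite_fibre: 
  assumes z: "z \<in> disc" shows "finite {w \<in> disc. q w = q z}"
proof -
  have sub: "{w \<in> disc. q w = q z} \<subseteq> {z} \<union> vertices g \<union> (\<Union>j<4 * g. {w. (z, w) \<in> edge_pairs g j})"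
  proof
    fix w assume "w \<in> {w \<in> disc. q w = q z}"
    then have "glued g z w" using z fibres[of z w] by auto
    then show "w \<in> {z} \<union> vertices g \<union> (\<Union>j<4 * g. {w. (z, w) \<in> edge_pairs g j})"
      unfolding glued_def by auto
  qed
  have "finite {w. (z, w) \<in> edge_pairs g j}" for j
  proof -
    have "w = w'" if "(z, w) \<in> edge_pairs g j" "(z, w') \<in> edge_pairs g j" for w w'
      using edge_pairs_dist[OF that(2,1)] by simp
    then have "{w. (z, w) \<in> edge_pairs g j} \<subseteq> {SOME w. (z, w) \<in> edge_pairs g j}"
      by (metis (mono_tags, lifting) mem_Collect_eq singletonI someI subsetI)
    then show ?thesis by (rule finite_subset) simp
  qed
  then have "finite ({z} \<union> vertices g \<union> (\<Union>j<4 * g. {w. (z, w) \<in> edge_pairs g j}))"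
    by (simp add: vertices_def)
  then show ?thesis by (rule finite_subset[OF sub])
qed

definition good_radius :: "'a \<Rightarrow> real \<Rightarrow> bool" where
  "good_radius x e \<longleftrightarrow> 0 < e \<and> e \<le> 1/2 \<and>
     (\<forall>z\<in>disc. \<forall>z'\<in>disc. q z = x \<and> q z' = x \<and> z \<noteq> z' \<longrightarrow> 2 * e \<le> dist z z') \<and>
     (\<forall>z\<in>disc. \<forall>w\<in>disc. \<forall>w'\<in>disc. q z = x \<and> dist w z < e \<and> q w = q w' \<longrightarrow>
        (\<exists>z'\<in>disc. q z' = x \<and> dist w' z' = dist w z \<and> close_pair g z z' w w'))"

lemma good_radius_exists:
  assumes x: "x \<in> topspace X"
  shows "\<exists>e. good_radius x e"
proof -
  define Z where "Z = {z \<in> disc. q z = x}"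
  obtain z0 where "z0 \<in> disc" "x = q z0" using x q_image by blast
  then have Zfin: "finite Z" using finite_fibre[of z0] unfolding Z_def by simp
  have "finite (Z \<union> vertices g)" using Zfin by (simp add: vertices_def)
  then obtain d1 where d1: "d1 > 0" "\<forall>a\<in>Z \<union> vertices g. \<forall>b\<in>Z \<union> vertices g. a \<noteq> b \<longrightarrow> d1 \<le> dist a b"
    using separated_points by blast
  define side where "side j = polygon_boundary g ` {real j..real j + 1}" for j
  let ?T = "\<Union>j<4 * g. side j \<times> {real j}" and ?P = "{p \<in> Z \<times> real ` {..<4 * g}. p \<notin> (\<Union>j<4 * g. side j \<times> {real j})}"
  have "compact (side j)" for j
    unfolding side_def by (intro compact_continuous_image continuous_polygon_boundary) simp
  then have closed: "closed ?T" by (intro compact_imp_closed compact_UN compact_Times) auto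
  have "?P \<subseteq> Z \<times> real ` {..<4 * g}" by blast
  then have "finite ?P" by (rule finite_subset) (use Zfin in simp)
  then have "compact ?P" by (rule finite_imp_compact)
  moreover have "?P \<inter> ?T = {}" by blast
  ultimately have "\<exists>d>0. \<forall>p\<in>?P. \<forall>r\<in>?T. d \<le> dist p r" using closed by (intro separate_compact_closed)
  then obtain d2 where d2: "d2 > 0" "\<forall>p\<in>?P. \<forall>r\<in>?T. d2 \<le> dist p r" by (elim exE conjE) (rule that)
  have side_near: "z \<in> side j" if z: "z \<in> Z" and j: "j < 4 * g" and w: "w \<in> side j" "dist w z < d2" for z w j
  proof (rule ccontr)
    assume "z \<notin> side j"
    then have "(z, real j) \<in> ?P" using z j by auto
    moreover have "(w, real j) \<in> ?T" using w j by blast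
    ultimately have "d2 \<le> dist (z, real j) (w, real j)" using d2(2) by blast
    then show False using w(2) by (simp add: dist_Pair_Pair dist_commute)
  qed
  define e where "e = min (1/2) (min (d1 / 2) (d2 / 2))"
  have e: "0 < e" "e \<le> 1/2" "2 * e \<le> d1" "e < d2" "e < d1" using d1(1) d2(1) by (auto simp: e_def min_def)
  have "\<exists>z'\<in>disc. q z' = x \<and> dist w' z' = dist w z \<and> close_pair g z z' w w'"
    if z: "z \<in> disc" "q z = x" and w: "w \<in> disc" "w' \<in> disc" and near: "dist w z < e" and qw: "q w = q w'" for z w w'
  proof -
    have "glued g w w'" using fibres w qw by blast
    then consider "w = w'" | j where "j < 4 * g" "(w, w') \<in> edge_pairs g j" | "w \<in> vertices g" "w' \<in> vertices g"
      unfolding glued_def by blast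
    then show ?thesis
    proof cases
      case 1
      then show ?thesis using z by (intro bexI[of _ z]) (auto simp: close_pair_def)
    next
      case 2
      have "w \<in> side j" using 2(2) by (auto simp: edge_pairs_def side_def)
      then have "z \<in> side j" using side_near[of z j w] z 2 near e by (auto simp: Z_def)
      then obtain s where s: "s \<in> {real j..real j + 1}" "z = polygon_boundary g s" by (auto simp: side_def)
      define z' where "z' = polygon_boundary g (mirror j s)"
      have zz': "(z, z') \<in> edge_pairs g j" using s by (auto simp: edge_pairs_def z'_def)
      show ?thesis
      proof (intro bexI[of _ z'] conjI)
        show "z' \<in> disc" "q z' = x" using edge_pairs_disc[OF zz' 2(1)] z by auto
        show "dist w' z' = dist w z" by (rule edge_pairs_dist[OF zz' 2(2)])
        show "close_pair g z z' w w'" using zz' 2 by (auto simp: close_pair_def)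
      qed
    next
      case 3
      have "w = z"
      proof (rule ccontr)
        assume "w \<noteq> z"
        then have "d1 \<le> dist w z" using d1(2) 3 z by (auto simp: Z_def)
        then show False using near e by linarith
      qed
      then show ?thesis using w qw z by (intro bexI[of _ w']) (auto simp: close_pair_def)
    qed
  qed
  moreover have "2 * e \<le> dist z z'" if "z \<in> disc" "z' \<in> disc" "q z = x" "q z' = x" "z \<noteq> z'" for z z'
    using d1(2) that e by (force simp: Z_def)
  ultimately have "good_radius x e" unfolding good_radius_def using e by blast
  then show ?thesis by blast
qed

definition around :: "'a \<Rightarrow> real \<Rightarrow> complex set" where
  "around x e = {w \<in> disc. \<exists>z\<in>disc. q z = x \<and> dist w z < e}"

lemma good_radiusD:
  assumes "good_radius x e"
  shows "0 < e" "e \<le> 1/2"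
    and "\<lbrakk>z \<in> disc; z' \<in> disc; q z = x; q z' = x; dist w z < e; dist w z' < e\<rbrakk> \<Longrightarrow> z = z'"
    and "\<lbrakk>z \<in> disc; w \<in> disc; w' \<in> disc; q z = x; dist w z < e; q w = q w'\<rbrakk> \<Longrightarrow>
        \<exists>z'\<in>disc. q z' = x \<and> dist w' z' = dist w z \<and> close_pair g z z' w w'"
proof -
  show "0 < e" "e \<le> 1/2" using assms by (simp_all add: good_radius_def)
  show "z = z'" if "z \<in> disc" "z' \<in> disc" "q z = x" "q z' = x" "dist w z < e" "dist w z' < e"
  proof (rule ccontr)
    assume "z \<noteq> z'"
    then have "2 * e \<le> dist z z'" using assms that unfolding good_radius_def by blast
    moreover have "dist z z' \<le> dist w z + dist w z'" by (metis dist_commute dist_triangle)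
    ultimately show False using that by linarith
  qed
  show "\<exists>z'\<in>disc. q z' = x \<and> dist w' z' = dist w z \<and> close_pair g z z' w w'"
    if "z \<in> disc" "w \<in> disc" "w' \<in> disc" "q z = x" "dist w z < e" "q w = q w'"
    using assms that unfolding good_radius_def by blast
qed

lemma good_radius_mono:
  assumes e: "good_radius x e" and d: "0 < d" "d \<le> e"
  shows "good_radius x d"
  unfolding good_radius_def
proof (intro conjI ballI impI d)
  show "d \<le> 1/2" using d(2) good_radiusD(2)[OF e] by linarith
  show "2 * d \<le> dist z z'" if "z \<in> disc" "z' \<in> disc" "q z = x \<and> q z' = x \<and> z \<noteq> z'" for z z'
  proof -
    have "2 * e \<le> dist z z'" using e that unfolding good_radius_def by blast
    then show ?thesis using d(2) by linarith
  qed
  show "\<exists>z'\<in>disc. q z' = x \<and> dist w' z' = dist w z \<and> close_pair g z z' w w'"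
    if "z \<in> disc" "w \<in> disc" "w' \<in> disc" "q z = x \<and> dist w z < d \<and> q w = q w'" for z w w'
    using that d(2) by (intro good_radiusD(4)[OF e]) auto
qed

lemma around_saturated:
  assumes "good_radius x e" "u \<in> disc"
  shows "q u \<in> q ` around x e \<longleftrightarrow> u \<in> around x e"
proof
  assume "q u \<in> q ` around x e"
  then obtain w z where w: "w \<in> disc" "q u = q w" "z \<in> disc" "q z = x" "dist w z < e" by (auto simp: around_def)
  then obtain z' where "z' \<in> disc" "q z' = x" "dist u z' = dist w z"
    using good_radiusD(4)[OF assms(1), of z w u] assms(2) by auto
  then show "u \<in> around x e" using assms(2) w(5) by (auto simp: around_def)
qed simp

lemma open_around: "openin (top_of_set disc) (around x e)"
proof -
  have "around x e = disc \<inter> (\<Union>z\<in>{z \<in> disc. q z = x}. ball z e)"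
    by (auto simp: around_def dist_commute)
  then show ?thesis by (simp add: openin_open_Int open_UN)
qed

lemma openin_around:
  assumes "good_radius x e" shows "openin X (q ` around x e)"
proof -
  have "{u \<in> topspace (top_of_set disc). q u \<in> q ` around x e} = around x e"
    using around_saturated[OF assms] by (auto simp: around_def)
  then have "openin (top_of_set disc) {u \<in> topspace (top_of_set disc). q u \<in> q ` around x e}"
    using open_around by (simp only:)
  moreover have "q ` around x e \<subseteq> topspace X" using q_image by (auto simp: around_def)
  ultimately show ?thesis
    using quotient unfolding quotient_map_def by blast
qed

lemma in_around: "x \<in> topspace X \<Longrightarrow> 0 < e \<Longrightarrow> x \<in> q ` around x e"
  using q_image by (force simp: around_def)

lemma q_closed_map: "closed_map (top_of_set disc) X q"
  unfolding closed_map_def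
proof (intro allI impI)
  fix C assume "closedin (top_of_set disc) C"
  then have C: "closed C" "C \<subseteq> disc" using closedin_closed_eq[of disc C] by auto
  have "openin X (topspace X - q ` C)"
  proof (subst openin_subopen, intro ballI)
    fix x assume x: "x \<in> topspace X - q ` C"
    obtain e where e: "good_radius x e" using good_radius_exists x by blast
    let ?Z = "{z \<in> disc. q z = x}"
    obtain z0 where "z0 \<in> disc" "x = q z0" using x q_image by blast
    then have "finite ?Z" using finite_fibre[of z0] by simp
    moreover have "?Z \<inter> C = {}" using x by auto
    ultimately obtain d where d: "d > 0" "\<forall>z\<in>?Z. \<forall>c\<in>C. d \<le> dist z c"
      using separate_compact_closed[of ?Z C] C by (auto simp: finite_imp_compact)
    define r where "r = min d e"
    have r: "good_radius x r" using good_radius_mono[OF e] d(1) good_radiusD(1)[OF e] by (simp add: r_def)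
    have disj: "q ` around x r \<inter> q ` C = {}"
    proof (rule equals0I)
      fix y assume y: "y \<in> q ` around x r \<inter> q ` C"
      then have "y \<in> q ` C" by simp
      then obtain c where c: "y = q c" "c \<in> C" by (rule imageE)
      have "q c \<in> q ` around x r" using y c(1) by simp
      then have "c \<in> around x r" using around_saturated[OF r] c(2) C(2) by blast
      then obtain z where "z \<in> ?Z" "dist c z < d" by (auto simp: around_def r_def)
      then show False using d(2) c(2) by (force simp: dist_commute)
    qed
    show "\<exists>T. openin X T \<and> x \<in> T \<and> T \<subseteq> topspace X - q ` C"
    proof (intro exI conjI)
      show "openin X (q ` around x r)" by (rule openin_around[OF r])
      show "x \<in> q ` around x r" using in_around[of x r] x good_radiusD(1)[OF r] by simp
      show "q ` around x r \<subseteq> topspace X - q ` C"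
        using openin_subset[OF openin_around[OF r]] disj by blast
    qed
  qed
  moreover have "q ` C \<subseteq> topspace X" using C(2) q_image by blast
  ultimately show "closedin X (q ` C)" by (simp add: closedin_def)
qed

lemma q_proper_map: "proper_map (top_of_set disc) X q"
  unfolding proper_map_def
proof (intro conjI ballI q_closed_map)
  fix y assume "y \<in> topspace X"
  then obtain z where "z \<in> disc" "y = q z" using q_image by blast
  then have "finite {x \<in> disc. q x = y}" using finite_fibre by simp
  then show "compactin (top_of_set disc) {x \<in> topspace (top_of_set disc). q x = y}"
    by (intro finite_imp_compactin) auto
qed

lemma quotient_map_cylinder:
  assumes e: "good_radius x e"
  shows "quotient_map (top_of_set (around x e \<times> {0..1::real}))
           (prod_topology (subtopology X (q ` around x e)) (top_of_set {0..1})) (\<lambda>(w, t). (q w, t))"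
proof (rule continuous_closed_imp_quotient_map)
  let ?W = "around x e"
  have pre: "{u \<in> topspace (top_of_set disc). q u \<in> q ` ?W} = ?W"
    using around_saturated[OF e] by (auto simp: around_def)
  have sub: "subtopology (top_of_set disc) ?W = top_of_set ?W"
  proof -
    have "disc \<inter> ?W = ?W" by (auto simp: around_def)
    then show ?thesis by (simp only: subtopology_subtopology)
  qed
  have p: "proper_map (top_of_set ?W) (subtopology X (q ` ?W)) q"
    using proper_map_restriction[OF q_proper_map pre] unfolding sub .
  have proper: "proper_map (prod_topology (top_of_set ?W) (top_of_set {0..1}))
      (prod_topology (subtopology X (q ` ?W)) (top_of_set {0..1::real})) (\<lambda>(w, t). (q w, id t))"
    unfolding proper_map_prod by (intro disjI2 conjI p proper_map_id)
  show "closed_map (top_of_set (?W \<times> {0..1})) (prod_topology (subtopology X (q ` ?W)) (top_of_set {0..1::real})) (\<lambda>(w, t). (q w, t))"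
    using proper_imp_closed_map[OF proper] by simp
  have "continuous_map (top_of_set ?W) (subtopology X (q ` ?W)) q"
    using continuous_map_from_subtopology[OF q_continuous, of ?W] unfolding sub
    by (simp add: continuous_map_in_subtopology)
  then have "continuous_map (prod_topology (top_of_set ?W) (top_of_set {0..1::real})) (prod_topology (subtopology X (q ` ?W)) (top_of_set {0..1})) (\<lambda>p. (q (fst p), snd p))"
    by (intro continuous_map_pairedI continuous_map_snd continuous_map_compose[OF continuous_map_fst, unfolded comp_def])
  then show "continuous_map (top_of_set (?W \<times> {0..1})) (prod_topology (subtopology X (q ` ?W)) (top_of_set {0..1::real})) (\<lambda>(w, t). (q w, t))"
    by (simp add: case_prod_unfold)
  have "q ` ?W \<subseteq> topspace X" using q_image by (auto simp: around_def)
  then show "(\<lambda>(w, t). (q w, t)) ` topspace (top_of_set (?W \<times> {0..1})) = topspace (prod_topology (subtopology X (q ` ?W)) (top_of_set {0..1::real}))"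
    by (auto simp: Int_absorb1)
qed

lemma shrink_close_pair:
  assumes c: "close_pair g z z' w w'" and q: "q z = q z'" and d: "dist w z < 1/2" "dist w' z' < 1/2" and t: "t \<in> {0..1}"
  shows "q (shrink z w t) = q (shrink z' w' t)"
proof -
  consider "z = z'" "w = w'" | "w = z" "w' = z'" | j where "j < 4 * g" "(z, z') \<in> edge_pairs g j" "(w, w') \<in> edge_pairs g j"
    using c unfolding close_pair_def by blast
  then show ?thesis
  proof cases
    case 1 then show ?thesis by simp
  next
    case 2
    then show ?thesis using q shrink_ends(3) d by metis
  next
    case 3
    obtain s where s: "s \<in> {real j..real j + 1}" "z = polygon_boundary g s" "z' = polygon_boundary g (mirror j s)"
      using 3(2) by (auto simp: edge_pairs_def)
    obtain u where u: "u \<in> {real j..real j + 1}" "w = polygon_boundary g u" "w' = polygon_boundary g (mirror j u)"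
      using 3(3) by (auto simp: edge_pairs_def)
    let ?m = "s + (1 - t) * (u - s)"
    have "(1 - t) *\<^sub>R u + t *\<^sub>R s \<in> {real j..real j + 1}"
      using convexD_alt[OF convex_closed_interval, of u "real j" "real j + 1" s t] s u t
      by (simp add: add.commute)
    then have m: "?m \<in> {real j..real j + 1}" by (simp add: algebra_simps)
    have "shrink z w t = polygon_boundary g ?m"
      unfolding s(2) u(2) using s(1) u(1) by (intro shrink_boundary[OF g_pos]) auto
    moreover have "shrink z' w' t = polygon_boundary g (mirror j s + (1 - t) * (mirror j u - mirror j s))"
      unfolding s(3) u(3) using s(1) u(1) by (intro shrink_boundary[OF g_pos]) (auto simp: mirror_def)
    moreover have "mirror j s + (1 - t) * (mirror j u - mirror j s) = mirror j ?m"
      by (simp add: mirror_def algebra_simps)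
    ultimately have "(shrink z w t, shrink z' w' t) \<in> edge_pairs g j"
      using m by (auto simp: edge_pairs_def)
    then show ?thesis using edge_pairs_disc 3(1) by blast
  qed
qed

lemma local_contraction:
  assumes x: "x \<in> topspace X"
  obtains N h where "openin X N" "x \<in> N"
    "continuous_map (prod_topology (subtopology X N) (top_of_set {0..1::real})) X h"
    "\<forall>y\<in>N. h (y, 0) = y \<and> h (y, 1) = x" "\<forall>t\<in>{0..1}. h (x, t) = x"
    "\<forall>y\<in>N. \<exists>r. continuous_on {0..1} r \<and> r \<in> {0..1} \<rightarrow> disc \<and> (\<forall>t\<in>{0..1}. q (r t) = h (y, t))"
proof -
  obtain e where e: "good_radius x e" using good_radius_exists x by blast
  note e' = good_radiusD[OF e]
  let ?W = "around x e" and ?I = "{0..1::real}"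
  have "\<forall>w. \<exists>z. w \<in> ?W \<longrightarrow> z \<in> disc \<and> q z = x \<and> dist w z < e" by (auto simp: around_def)
  then obtain c where c: "\<forall>w. w \<in> ?W \<longrightarrow> c w \<in> disc \<and> q (c w) = x \<and> dist w (c w) < e"
    unfolding choice_iff by blast
  have c_eq: "c w = z" if "w \<in> ?W" "z \<in> disc" "q z = x" "dist w z < e" for w z
    using c that e'(3)[of "c w" z w] by blast
  have half: "dist w z < 1/2" if "dist w z < e" for w z using that e'(2) by linarith
  have WD: "w \<in> disc" if "w \<in> ?W" for w using that by (simp add: around_def)
  define H where "H p = q (shrink (c (fst p)) (fst p) (snd p))" for p
  have in_disc: "shrink z w t \<in> disc" if "z \<in> disc" "w \<in> disc" "dist w z < e" "t \<in> ?I" for z w t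
    using shrink_in_disc[of z w t, OF _ _ half[OF that(3)] that(4)] that(1,2) by simp
  have Hq: "H (w, t) = H (w', t)" if w: "w \<in> ?W" "w' \<in> ?W" "q w = q w'" and t: "t \<in> ?I" for w w' t
  proof -
    have cw: "c w \<in> disc" "q (c w) = x" "dist w (c w) < e" using c w by auto
    obtain z' where z': "z' \<in> disc" "q z' = x" "dist w' z' = dist w (c w)" "close_pair g (c w) z' w w'"
      using e'(4)[OF cw(1) WD[OF w(1)] WD[OF w(2)] cw(2,3) w(3)] by blast
    have "c w' = z'" by (rule c_eq[OF w(2) z'(1,2)]) (use z'(3) cw(3) in simp)
    moreover have "q (shrink (c w) w t) = q (shrink z' w' t)"
      by (rule shrink_close_pair[OF z'(4) _ half[OF cw(3)] half t]) (use cw z' in simp_all)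
    ultimately show ?thesis by (simp add: H_def)
  qed
  have Hcont: "continuous_map (top_of_set (?W \<times> ?I)) X H"
  proof (rule pasting_lemma[where I="{z \<in> disc. q z = x}" and T="\<lambda>z. (?W \<inter> ball z e) \<times> ?I"
        and f="\<lambda>z p. q (shrink z (fst p) (snd p))"])
    fix z assume z: "z \<in> {z \<in> disc. q z = x}"
    have "(?W \<inter> ball z e) \<times> ?I = (?W \<times> ?I) \<inter> (ball z e \<times> UNIV)" by auto
    then show "openin (top_of_set (?W \<times> ?I)) ((?W \<inter> ball z e) \<times> ?I)"
      by (simp add: openin_open_Int open_Times)
    have "continuous_on ((?W \<inter> ball z e) \<times> ?I) (\<lambda>p. shrink z (fst p) (snd p))"
      by (rule continuous_on_subset[OF continuous_shrink]) (use half in \<open>auto simp: dist_commute\<close>)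
    then have "continuous_map (top_of_set ((?W \<inter> ball z e) \<times> ?I)) X (\<lambda>p. q (shrink z (fst p) (snd p)))"
      by (rule continuous_map_top_of_set_compose[OF q_continuous])
        (use z in_disc WD in \<open>auto simp: dist_commute simp del: mem_cball\<close>)
    moreover have "(?W \<times> ?I) \<inter> ((?W \<inter> ball z e) \<times> ?I) = (?W \<inter> ball z e) \<times> ?I" by auto
    ultimately show "continuous_map (subtopology (top_of_set (?W \<times> ?I)) ((?W \<inter> ball z e) \<times> ?I)) X (\<lambda>p. q (shrink z (fst p) (snd p)))"
      by (simp add: subtopology_subtopology)
  next
    fix z z' p assume a: "z \<in> {z \<in> disc. q z = x}" "z' \<in> {z \<in> disc. q z = x}"
      "p \<in> topspace (top_of_set (?W \<times> ?I)) \<inter> (?W \<inter> ball z e) \<times> ?I \<inter> (?W \<inter> ball z' e) \<times> ?I"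
    then have "dist (fst p) z < e" "dist (fst p) z' < e" by (auto simp: dist_commute)
    then have "z = z'" using a(1,2) e'(3)[of z z' "fst p"] by blast
    then show "q (shrink z (fst p) (snd p)) = q (shrink z' (fst p) (snd p))" by simp
  next
    fix p assume "p \<in> topspace (top_of_set (?W \<times> ?I))"
    then have p: "fst p \<in> ?W" "snd p \<in> ?I" by auto
    then show "\<exists>z. z \<in> {z \<in> disc. q z = x} \<and> p \<in> (?W \<inter> ball z e) \<times> ?I \<and> H p = q (shrink z (fst p) (snd p))"
      using c by (intro exI[of _ "c (fst p)"]) (auto simp: H_def dist_commute mem_Times_iff)
  qed
  define h where "h p = H (SOME w. w \<in> ?W \<and> q w = fst p, snd p)" for p
  have hH: "h (q w, t) = H (w, t)" if "w \<in> ?W" "t \<in> ?I" for w t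
  proof -
    have "(SOME w'. w' \<in> ?W \<and> q w' = q w) \<in> ?W \<and> q (SOME w'. w' \<in> ?W \<and> q w' = q w) = q w"
      by (rule someI[where P="\<lambda>w'. w' \<in> ?W \<and> q w' = q w"]) (use that in simp)
    then show ?thesis unfolding h_def fst_conv snd_conv by (intro Hq) (use that in simp_all)
  qed
  have h_shrink: "h (q w, t) = q (shrink (c w) w t)" if "w \<in> ?W" "t \<in> ?I" for w t
    using hH[OF that] by (simp add: H_def)
  have "continuous_map (top_of_set (?W \<times> ?I)) X (h \<circ> (\<lambda>(w, t). (q w, t)))"
    by (rule continuous_map_eq[OF Hcont]) (auto simp: hH)
  then have hcont: "continuous_map (prod_topology (subtopology X (q ` ?W)) (top_of_set ?I)) X h"
    by (rule continuous_compose_quotient_map[OF quotient_map_cylinder[OF e]])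
  show ?thesis
  proof (rule that[OF openin_around[OF e] in_around[OF x e'(1)] hcont])
    have cw: "c w \<in> disc" "q (c w) = x" "dist w (c w) < e" "dist w (c w) < 1/2" if "w \<in> ?W" for w
      using c that half by auto
    show "\<forall>y\<in>q ` ?W. h (y, 0) = y \<and> h (y, 1) = x"
      using h_shrink shrink_ends cw by auto
    have "x \<in> q ` disc" unfolding q_image by (rule x)
    then obtain z0 where z0': "x = q z0" "z0 \<in> disc" by (rule imageE)
    then have z0: "z0 \<in> disc" "q z0 = x" by simp_all
    have z0W: "z0 \<in> ?W" using z0 e'(1) by (auto simp: around_def)
    have "c z0 = z0" by (rule c_eq[OF z0W z0]) (use e'(1) in simp)
    then show "\<forall>t\<in>?I. h (x, t) = x"
      using h_shrink[OF z0W] z0 shrink_ends(3)[of z0 z0] by simp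
    show "\<forall>y\<in>q ` ?W. \<exists>r. continuous_on ?I r \<and> r \<in> ?I \<rightarrow> disc \<and> (\<forall>t\<in>?I. q (r t) = h (y, t))"
    proof
      fix y assume "y \<in> q ` ?W"
      then obtain w where w: "y = q w" "w \<in> ?W" by (rule imageE)
      have "continuous_on ?I (\<lambda>t. shrink (c w) (fst (w, t)) (snd (w, t)))"
        by (rule continuous_on_compose2[OF continuous_shrink])
          (use cw[OF w(2)] in \<open>auto intro!: continuous_on_Pair continuous_on_const continuous_on_id\<close>)
      then show "\<exists>r. continuous_on ?I r \<and> r \<in> ?I \<rightarrow> disc \<and> (\<forall>t\<in>?I. q (r t) = h (y, t))"
        using in_disc[OF cw(1)[OF w(2)] WD[OF w(2)] cw(3)[OF w(2)]] h_shrink[OF w(2)] w(1)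
        by (intro exI[of _ "shrink (c w) w"]) (simp del: mem_cball)
    qed
  qed
qed

end


(* Topo5 *)


locale based_polygon = glued_polygon +
  fixes z0 :: complex
  assumes base: "z0 \<in> cball 0 1"
begin

abbreviation pi1 :: "(real \<Rightarrow> 'a) set monoid" where "pi1 \<equiv> fundamental_group X (q z0)"

lemma group_pi1: "group pi1"
  by (rule group_fundamental_group[OF q_space[OF base]])

lemma pathin_disc:
  "continuous_on {0..1} r \<Longrightarrow> r \<in> {0..1} \<rightarrow> disc \<Longrightarrow> pathin X (\<lambda>t. q (r t))"
  unfolding pathin_def by (rule continuous_map_top_of_set_compose[OF q_continuous])

definition seg :: "complex \<Rightarrow> complex \<Rightarrow> real \<Rightarrow> 'a" where
  "seg z w = (\<lambda>t. q (linepath z w t))"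

lemma linepath_disc: "z \<in> disc \<Longrightarrow> w \<in> disc \<Longrightarrow> t \<in> {0..1} \<Longrightarrow> linepath z w t \<in> disc"
  unfolding linepath_def by (rule convexD_alt[OF convex_cball]) auto

lemma seg_ends [simp]: "seg z w 0 = q z" "seg z w 1 = q w"
  by (simp_all add: seg_def linepath_def)

lemma seg_refl: "seg z z = (\<lambda>_. q z)"
  by (simp add: seg_def)

lemma pathin_seg: "z \<in> disc \<Longrightarrow> w \<in> disc \<Longrightarrow> pathin X (seg z w)"
  unfolding seg_def using linepath_disc by (intro pathin_disc continuous_on_linepath) blast

text \<open>Concatenating with a path that lies in the disc amounts to concatenating in the disc.\<close>

lemma concat_seg_homotopic:
  assumes r: "continuous_on {0..1} r" "r \<in> {0..1} \<rightarrow> disc" and u: "u \<in> disc"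
  shows "path_homotopic X (concat_paths (\<lambda>t. q (r t)) (seg (r 1) u)) (seg (r 0) u)"
proof -
  have r01: "r 0 \<in> disc" "r 1 \<in> disc" using r(2) by auto
  have "path (r +++ linepath (r 1) u)"
    by (rule path_join_imp) (use r(1) in \<open>auto simp: path_def pathfinish_def\<close>)
  then have c: "continuous_on {0..1} (r +++ linepath (r 1) u)" by (simp add: path_def)
  have in_disc: "(r +++ linepath (r 1) u) \<in> {0..1} \<rightarrow> disc"
  proof
    fix t :: real assume t: "t \<in> {0..1}"
    show "(r +++ linepath (r 1) u) t \<in> disc"
    proof (cases "t \<le> 1/2")
      case True
      then have "2 * t \<in> {0..1}" using t by auto
      then show ?thesis using True r(2) unfolding joinpaths_def by (simp only: if_True) blast
    next
      case False
      then have "2 * t - 1 \<in> {0..1}" using t by auto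
      then show ?thesis using False linepath_disc[OF r01(2) u] unfolding joinpaths_def by (simp only: if_False)
    qed
  qed
  have "path_homotopic X (\<lambda>t. q ((r +++ linepath (r 1) u) t)) (\<lambda>t. q (linepath (r 0) u t))"
    by (rule path_homotopic_convex[OF q_continuous convex_cball c in_disc continuous_on_linepath])
      (use linepath_disc[OF r01(1) u] in \<open>auto simp: joinpaths_def linepath_def simp del: mem_cball\<close>)
  moreover have "q ((r +++ linepath (r 1) u) t) = concat_paths (\<lambda>t. q (r t)) (seg (r 1) u) t" for t
    by (simp add: joinpaths_def concat_paths_def seg_def)
  ultimately show ?thesis by (simp add: seg_def)
qed

lemma seg_concat:
  assumes "z \<in> disc" "w \<in> disc" "u \<in> disc"
  shows "path_homotopic X (concat_paths (seg z w) (seg w u)) (seg z u)"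
  using concat_seg_homotopic[of "linepath z w" u] linepath_disc[OF assms(1,2)] assms(3)
  by (simp add: seg_def linepath_def Pi_iff continuous_on_linepath[unfolded linepath_def] del: mem_cball)

lemma cancel_detour:
  assumes P: "pathin X P" "P 1 = q z" and E: "pathin X E" "E 0 = q z" and z: "z \<in> disc"
  shows "path_homotopic X (concat_paths (concat_paths P (seg z z0)) (concat_paths (seg z0 z) E)) (concat_paths P E)"
proof -
  have s: "pathin X (seg z z0)" "pathin X (seg z0 z)" using z base by (simp_all add: pathin_seg)
  have sE: "pathin X (concat_paths (seg z0 z) E)" using s E by (intro pathin_concat) auto
  have retrace: "path_homotopic X (concat_paths (seg z z0) (seg z0 z)) (\<lambda>_. q z)"
    using seg_concat[OF z base z] by (simp add: seg_refl)
  have "path_homotopic X (concat_paths (concat_paths (seg z z0) (seg z0 z)) E) (concat_paths (\<lambda>_. q z) E)"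
    by (rule path_homotopic_concat[OF retrace path_homotopic_refl[OF E(1)]]) (use E in simp)
  also have "path_homotopic X \<dots> E" by (rule path_homotopic_const_concat[OF E])
  finally have 1: "path_homotopic X (concat_paths (concat_paths (seg z z0) (seg z0 z)) E) E" .
  have "path_homotopic X (concat_paths (seg z z0) (concat_paths (seg z0 z) E))
      (concat_paths (concat_paths (seg z z0) (seg z0 z)) E)"
    by (rule path_homotopic_sym[OF path_homotopic_assoc]) (use s E in auto)
  also note 1
  finally have 2: "path_homotopic X (concat_paths (seg z z0) (concat_paths (seg z0 z) E)) E" .
  have "path_homotopic X (concat_paths (concat_paths P (seg z z0)) (concat_paths (seg z0 z) E))
      (concat_paths P (concat_paths (seg z z0) (concat_paths (seg z0 z) E)))"
    by (rule path_homotopic_assoc) (use P s sE in auto)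
  also have "path_homotopic X \<dots> (concat_paths P E)"
    by (rule path_homotopic_concat[OF path_homotopic_refl[OF P(1)] 2]) (use P in simp)
  finally show ?thesis .
qed

definition glue_loop :: "complex \<Rightarrow> complex \<Rightarrow> real \<Rightarrow> 'a" where
  "glue_loop z w = concat_paths (seg z0 z) (seg w z0)"

definition glue_class :: "complex \<Rightarrow> complex \<Rightarrow> (real \<Rightarrow> 'a) set" where
  "glue_class z w = path_class X (q z0) (glue_loop z w)"

lemma glue_loop_loops:
  assumes "z \<in> disc" "w \<in> disc" "q z = q w"
  shows "glue_loop z w \<in> loops X (q z0)"
  unfolding loops_def glue_loop_def using assms base by (auto intro!: pathin_concat pathin_seg)

lemma glue_class_closed:
  "z \<in> disc \<Longrightarrow> w \<in> disc \<Longrightarrow> q z = q w \<Longrightarrow> glue_class z w \<in> carrier pi1"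
  unfolding glue_class_def by (intro path_class_in_carrier glue_loop_loops)

lemma glue_class_mult:
  assumes D: "z \<in> disc" "w \<in> disc" "u \<in> disc" and qz: "q z = q w" "q w = q u"
  shows "glue_class z w \<otimes>\<^bsub>pi1\<^esub> glue_class w u = glue_class z u"
proof -
  have L: "glue_loop z w \<in> loops X (q z0)" "glue_loop w u \<in> loops X (q z0)" "glue_loop z u \<in> loops X (q z0)"
    using D qz by (auto intro!: glue_loop_loops)
  have "path_homotopic X (concat_paths (glue_loop z w) (glue_loop w u)) (glue_loop z u)"
    unfolding glue_loop_def using D qz base by (intro cancel_detour pathin_seg) simp_all
  then show ?thesis
    unfolding glue_class_def mult_path_class[OF L(1,2)] path_class_eq_iff[OF loops_concat[OF L(1,2)] L(3)] .
qed

lemma glue_class_refl: "z \<in> disc \<Longrightarrow> glue_class z z = \<one>\<^bsub>pi1\<^esub>"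
proof -
  assume z: "z \<in> disc"
  have "path_homotopic X (glue_loop z z) (\<lambda>_. q z0)"
    unfolding glue_loop_def using seg_concat[OF base z base] by (simp add: seg_refl)
  moreover have "(\<lambda>_. q z0) \<in> loops X (q z0)" using q_space[OF base] by (simp add: loops_def pathin_const')
  ultimately show ?thesis
    unfolding glue_class_def one_fundamental_group using glue_loop_loops[OF z z refl] by (simp add: path_class_eq_iff)
qed

lemma glue_class_inv:
  assumes "z \<in> disc" "w \<in> disc" "q z = q w"
  shows "glue_class w z = m_inv pi1 (glue_class z w)"
proof -
  interpret group pi1 by (rule group_pi1)
  have "glue_class w z \<otimes>\<^bsub>pi1\<^esub> glue_class z w = \<one>\<^bsub>pi1\<^esub>"
    using assms by (simp add: glue_class_mult glue_class_refl)
  then show ?thesis using assms by (intro inv_equality[symmetric] glue_class_closed) auto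
qed

definition edge_class :: "nat \<Rightarrow> (real \<Rightarrow> 'a) set" where
  "edge_class j = glue_class (polygon_boundary g (real j)) (polygon_boundary g (mirror j (real j)))"

lemma edge_class_eq:
  assumes zw: "(z, w) \<in> edge_pairs g j" and j: "j < 4 * g"
  shows "glue_class z w = edge_class j"
proof -
  let ?b = "polygon_boundary g"
  obtain s where s: "s \<in> {real j..real j + 1}" "z = ?b s" "w = ?b (mirror j s)"
    using zw by (auto simp: edge_pairs_def)
  define m where "m \<tau> = (1 - \<tau>) * s + \<tau> * real j" for \<tau> :: real
  have m: "m \<tau> \<in> {real j..real j + 1}" if "\<tau> \<in> {0..1}" for \<tau>
    using convexD_alt[OF convex_closed_interval, of s "real j" "real j + 1" "real j" \<tau>] s(1) that by (simp add: m_def)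
  have pair: "(?b (m \<tau>), ?b (mirror j (m \<tau>))) \<in> edge_pairs g j" if "\<tau> \<in> {0..1}" for \<tau>
    using m[OF that] by (auto simp: edge_pairs_def)
  note D = edge_pairs_disc[OF pair j]
  let ?H = "\<lambda>p. if snd p \<le> 1/2 then q (linepath z0 (?b (m (fst p))) (2 * snd p))
                else q (linepath (?b (mirror j (m (fst p)))) z0 (2 * snd p - 1))"
  have mc: "continuous_on S (\<lambda>p. ?b (m (fst p)))" "continuous_on S (\<lambda>p. ?b (mirror j (m (fst p))))" for S :: "(real \<times> real) set"
    unfolding m_def mirror_def
    by (rule continuous_on_compose2[OF continuous_polygon_boundary[of UNIV]]; auto intro!: continuous_intros)+
  have "continuous_map (top_of_set ({0..1::real} \<times> {0..1::real})) X ?H"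
  proof (rule continuous_map_top_of_set_cases)
    show "continuous_map (top_of_set {x \<in> {0..1::real} \<times> {0..1::real}. snd x \<le> 1/2}) X (\<lambda>p. q (linepath z0 (?b (m (fst p))) (2 * snd p)))"
    proof (rule continuous_map_top_of_set_compose[OF q_continuous])
      show "(\<lambda>p. linepath z0 (?b (m (fst p))) (2 * snd p)) \<in> {x \<in> {0..1::real} \<times> {0..1::real}. snd x \<le> 1/2} \<rightarrow> disc"
        using D base by (intro Pi_I linepath_disc) auto
    qed (auto simp: linepath_def intro!: continuous_intros mc)
    show "continuous_map (top_of_set {x \<in> {0..1::real} \<times> {0..1::real}. 1/2 \<le> snd x}) X (\<lambda>p. q (linepath (?b (mirror j (m (fst p)))) z0 (2 * snd p - 1)))"
    proof (rule continuous_map_top_of_set_compose[OF q_continuous])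
      show "(\<lambda>p. linepath (?b (mirror j (m (fst p)))) z0 (2 * snd p - 1)) \<in> {x \<in> {0..1::real} \<times> {0..1::real}. 1/2 \<le> snd x} \<rightarrow> disc"
        using D base by (intro Pi_I linepath_disc) auto
    qed (auto simp: linepath_def intro!: continuous_intros mc)
    show "q (linepath z0 (?b (m (fst p))) (2 * snd p)) = q (linepath (?b (mirror j (m (fst p)))) z0 (2 * snd p - 1))"
      if "p \<in> {0..1::real} \<times> {0..1::real}" "snd p = 1/2" for p
    proof -
      have "2 * snd p = 1" "fst p \<in> {0..1}" using that by auto
      then show ?thesis using D(3)[of "fst p"] by (simp add: linepath_def)
    qed
  qed (auto intro!: continuous_intros)
  then have "path_homotopic X (glue_loop (?b (m 0)) (?b (mirror j (m 0)))) (glue_loop (?b (m 1)) (?b (mirror j (m 1))))"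
    unfolding path_homotopic_iff
    by (intro exI[of _ ?H]) (auto simp: glue_loop_def concat_paths_def seg_def linepath_def)
  moreover have "m 0 = s" "m 1 = real j" by (simp_all add: m_def)
  ultimately show ?thesis
    unfolding glue_class_def edge_class_def s(2,3)
    using glue_loop_loops[OF D(1-3)[of 0]] glue_loop_loops[OF D(1-3)[of 1]] by (simp add: path_class_eq_iff)
qed

lemma edge_class_closed:
  assumes "j < 4 * g" shows "edge_class j \<in> carrier pi1"
proof -
  have "(polygon_boundary g (real j), polygon_boundary g (mirror j (real j))) \<in> edge_pairs g j"
    by (auto simp: edge_pairs_def)
  from edge_pairs_disc[OF this assms] show ?thesis unfolding edge_class_def by (rule glue_class_closed)
qed

lemma edge_class_partner:
  assumes j: "j < 4 * g" shows "edge_class (partner j) = m_inv pi1 (edge_class j)"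
proof -
  have e: "(polygon_boundary g (real j), polygon_boundary g (mirror j (real j))) \<in> edge_pairs g j"
    by (auto simp: edge_pairs_def)
  show ?thesis
    using glue_class_inv[OF edge_pairs_disc[OF e j]] edge_class_eq[OF e j]
      edge_class_eq[OF edge_pairs_sym[OF e] partner_less[OF j]] by simp
qed

lemma glue_class_in_subgroup:
  assumes H: "subgroup H pi1" and e: "\<And>j. j < 4 * g \<Longrightarrow> edge_class j \<in> H"
    and z: "z \<in> disc" and w: "w \<in> disc" and qz: "q z = q w"
  shows "glue_class z w \<in> H"
proof -
  have "equivclp (side_pairing g) z w" using fibres[OF z w] qz glued_iff_equivclp[OF g_pos] by blast
  then have "w \<in> disc \<and> q z = q w \<and> glue_class z w \<in> H"
  proof (induction rule: equivclp_induct)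
    case base
    show ?case using z subgroup.one_closed[OF H] by (simp add: glue_class_refl)
  next
    case (step y w)
    have "glued g y w" using glued_iff_equivclp[OF g_pos] step.hyps by (metis equivclp_sym r_into_equivclp)
    obtain j where j: "j < 4 * g" "(y, w) \<in> edge_pairs g j"
      using step.hyps side_pairing_iff edge_pairs_sym partner_less by blast
    note D = edge_pairs_disc[OF j(2,1)]
    have "glue_class z w = glue_class z y \<otimes>\<^bsub>pi1\<^esub> glue_class y w"
      using z D step.IH by (simp add: glue_class_mult)
    also have "\<dots> \<in> H"
      using step.IH e[OF j(1)] edge_class_eq[OF j(2,1)] subgroup.m_closed[OF H] by simp
    finally show ?case using D step.IH by simp
  qed
  then show ?thesis by simp
qed

lemma edge_classes_generate:
  assumes H: "subgroup H pi1" and e: "\<And>j. j < 4 * g \<Longrightarrow> edge_class j \<in> H"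
  shows "carrier pi1 \<subseteq> H"
proof
  fix A assume "A \<in> carrier pi1"
  then obtain p where p: "p \<in> loops X (q z0)" and A: "A = path_class X (q z0) p"
    by (rule carrier_fundamental_groupE)
  have pp: "pathin X p" "p 0 = q z0" "p 1 = q z0" using p by (auto simp: loops_def)
  define pre where "pre t = (\<lambda>s. p (t * s))" for t :: real
  have pre: "pathin X (pre t)" if "t \<in> {0..1}" for t
    unfolding pathin_def pre_def using that
    by (intro continuous_map_top_of_set_compose[OF pp(1)[unfolded pathin_def]])
      (auto intro!: continuous_intros mult_le_one)
  have pre01: "pre t 0 = q z0" "pre t 1 = p t" for t using pp by (simp_all add: pre_def)
  define E where "E t z = path_class X (q z0) (concat_paths (pre t) (seg z z0))" for t z
  have El: "concat_paths (pre t) (seg z z0) \<in> loops X (q z0)" if "t \<in> {0..1}" "z \<in> disc" "q z = p t" for t z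
    using that base pre pre01 unfolding loops_def by (auto intro!: pathin_concat pathin_seg)
  have move: "E t z \<otimes>\<^bsub>pi1\<^esub> glue_class z w = E t w"
    if t: "t \<in> {0..1}" and z: "z \<in> disc" "q z = p t" and w: "w \<in> disc" "q w = p t" for t z w
  proof -
    have L: "glue_loop z w \<in> loops X (q z0)" using z w by (intro glue_loop_loops) auto
    have "path_homotopic X (concat_paths (concat_paths (pre t) (seg z z0)) (glue_loop z w)) (concat_paths (pre t) (seg w z0))"
      unfolding glue_loop_def using z w base pre[OF t] pre01 by (intro cancel_detour pathin_seg) simp_all
    then show ?thesis
      unfolding E_def glue_class_def mult_path_class[OF El[OF t z] L]
        path_class_eq_iff[OF loops_concat[OF El[OF t z] L] El[OF t w]] .
  qed
  define P where "P t \<longleftrightarrow> (\<forall>z\<in>disc. q z = p t \<longrightarrow> E t z \<in> H)" for t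
  have P_iff: "P t \<longleftrightarrow> E t z \<in> H" if t: "t \<in> {0..1}" and z: "z \<in> disc" "q z = p t" for t z
  proof
    assume Ez: "E t z \<in> H"
    have "E t w \<in> H" if w: "w \<in> disc" "q w = p t" for w
      using move[OF t z w] Ez glue_class_in_subgroup[OF H e z(1) w(1)] z w subgroup.m_closed[OF H] by metis
    then show "P t" by (simp add: P_def)
  qed (use z in \<open>simp add: P_def\<close>)
  have "P constant_on {0..1}"
  proof (rule locally_constant_imp_constant)
    show "connected {0..1::real}" by simp
    fix a :: real assume a: "a \<in> {0..1}"
    then have pa: "p a \<in> topspace X"
      using pp(1) continuous_map_image_subset_topspace by (force simp: pathin_def)
    obtain N h where N: "openin X N" "p a \<in> N"
      and h: "continuous_map (prod_topology (subtopology X N) (top_of_set {0..1::real})) X h"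
      and ends: "\<forall>y\<in>N. h (y, 0) = y \<and> h (y, 1) = p a" and centre: "\<forall>t\<in>{0..1}. h (p a, t) = p a"
      and lift: "\<forall>y\<in>N. \<exists>r. continuous_on {0..1} r \<and> r \<in> {0..1} \<rightarrow> disc \<and> (\<forall>t\<in>{0..1}. q (r t) = h (y, t))"
      by (rule local_contraction[OF pa])
    have "openin (top_of_set {0..1}) {t \<in> {0..1}. p t \<in> N}"
      using openin_continuous_map_preimage[of "top_of_set {0..1}" X p N] pp(1) N(1) by (simp add: pathin_def)
    then obtain d where d: "d > 0" "\<And>t. t \<in> {0..1} \<Longrightarrow> dist t a < d \<Longrightarrow> p t \<in> N"
      using a N(2) unfolding openin_euclidean_subtopology_iff by force
    have near: "P t = P a" if t: "t \<in> {0..1}" "dist t a < d" for t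
    proof -
      define \<sigma> where "\<sigma> u = p (a + u * (t - a))" for u
      have seg_in: "a + u * (t - a) \<in> {0..1}" "dist (a + u * (t - a)) a < d" if "u \<in> {0..1}" for u
      proof -
        have "(1 - u) *\<^sub>R a + u *\<^sub>R t \<in> {0..1}"
          using convexD_alt[OF convex_closed_interval, of a 0 1 t u] a t that by simp
        then show "a + u * (t - a) \<in> {0..1}" by (simp add: algebra_simps)
        have "\<bar>u * (t - a)\<bar> \<le> 1 * \<bar>t - a\<bar>" unfolding abs_mult using that by (intro mult_right_mono) auto
        then show "dist (a + u * (t - a)) a < d" using t(2) by (simp add: dist_real_def)
      qed
      then have \<sigma>N: "\<sigma> u \<in> N" if "u \<in> {0..1}" for u using d(2) that by (simp add: \<sigma>_def)
      have ptN: "p t \<in> N" using d(2) t by blast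
      then obtain r where r: "continuous_on {0..1} r" "r \<in> {0..1} \<rightarrow> disc" "\<forall>s\<in>{0..1}. q (r s) = h (p t, s)"
        using lift by blast
      have rz: "r 0 \<in> disc" "q (r 0) = p t" "r 1 \<in> disc" "q (r 1) = p a"
        using r(2,3) ends ptN by auto
      define c where "c s = q (r (1 - s))" for s
      have rc: "continuous_on {0..1} (\<lambda>s. r (1 - s))" "(\<lambda>s. r (1 - s)) \<in> {0..1} \<rightarrow> disc"
        using r(2) by (auto intro!: continuous_on_compose2[OF r(1)] continuous_intros)
      have c: "pathin X c" unfolding c_def by (rule pathin_disc[OF rc])
      have \<sigma>p: "pathin X \<sigma>"
        unfolding pathin_def \<sigma>_def
      proof (rule continuous_map_top_of_set_compose[OF pp(1)[unfolded pathin_def]])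
        show "(\<lambda>u. a + u * (t - a)) \<in> {0..1} \<rightarrow> {0..1}" using seg_in(1) by blast
      qed (intro continuous_intros)
      \<comment> \<open>the contraction sweeps out a square with the path on one side and the lifted track on another\<close>
      define F where "F v = h (\<sigma> (fst v), 1 - snd v)" for v
      have F: "continuous_map (top_of_set ({0..1::real} \<times> {0..1::real})) X F"
      proof -
        have 1: "continuous_map (top_of_set ({0..1::real} \<times> {0..1::real})) (subtopology X N) (\<lambda>v. \<sigma> (fst v))"
          unfolding continuous_map_in_subtopology
          using continuous_map_top_of_set_compose[OF \<sigma>p[unfolded pathin_def], of "{0..1::real} \<times> {0..1::real}" fst] \<sigma>N
          by (fastforce intro!: continuous_intros)
        have 2: "continuous_map (top_of_set ({0..1::real} \<times> {0..1::real})) (top_of_set {0..1}) (\<lambda>v. 1 - snd v)"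
          by (auto intro!: continuous_intros)
        show ?thesis
          using continuous_map_compose[OF continuous_map_pairedI[OF 1 2] h] by (simp add: F_def[abs_def] comp_def)
      qed
      let ?r1 = "\<lambda>u::real. (max 0 (2 * u - 1), min 1 (2 * u))" and ?r2 = "\<lambda>u::real. (min 1 (2 * u), max 0 (2 * u - 1))"
      have sq: "path_homotopic X (\<lambda>u. F (?r1 u)) (\<lambda>u. F (?r2 u))"
        by (rule path_homotopic_convex[OF F]) (auto intro!: convex_Times continuous_intros)
      have f1: "F (?r1 u) = concat_paths (\<lambda>_. p a) \<sigma> u" if "u \<in> {0..1}" for u
        using that centre ends \<sigma>N[of "2 * u - 1"]
        by (cases "u \<le> 1/2") (simp_all add: F_def concat_paths_def max_absorb1 max_absorb2 min_absorb1 min_absorb2, simp add: \<sigma>_def)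
      have f2: "F (?r2 u) = concat_paths (\<lambda>_. p a) c u" if "u \<in> {0..1}" for u
      proof (cases "u \<le> 1/2")
        case True
        then show ?thesis using that ends \<sigma>N[of "2 * u"] by (simp add: F_def concat_paths_def max_absorb1 min_absorb2)
      next
        case False
        then show ?thesis using that r(3) by (simp add: F_def concat_paths_def max_absorb2 min_absorb1 c_def \<sigma>_def)
      qed
      have \<sigma>0: "\<sigma> 0 = p a" and c0: "c 0 = p a" and c1: "c 1 = p t" and \<sigma>1: "\<sigma> 1 = p t"
        using rz by (simp_all add: \<sigma>_def c_def)
      have "path_homotopic X (concat_paths (\<lambda>_. p a) \<sigma>) (\<lambda>u. F (?r1 u))"
        by (rule path_homotopic_eq[OF pathin_concat[OF pathin_const'[OF pa] \<sigma>p]]) (simp_all add: \<sigma>0 f1)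
      also note sq
      also have "path_homotopic X (\<lambda>u. F (?r2 u)) (concat_paths (\<lambda>_. p a) c)"
        by (rule path_homotopic_sym, rule path_homotopic_eq[OF pathin_concat[OF pathin_const'[OF pa] c]]) (simp_all add: c0 f2)
      finally have 3: "path_homotopic X (concat_paths (\<lambda>_. p a) \<sigma>) (concat_paths (\<lambda>_. p a) c)" .
      have "path_homotopic X \<sigma> c"
        by (rule path_homotopic_trans[OF path_homotopic_sym[OF path_homotopic_const_concat[OF \<sigma>p \<sigma>0]]
              path_homotopic_trans[OF 3 path_homotopic_const_concat[OF c c0]]])
      then have 4: "path_homotopic X (concat_paths (pre a) \<sigma>) (concat_paths (pre a) c)"
        using path_homotopic_refl[OF pre[OF a]] by (intro path_homotopic_concat) (auto simp: pre01 \<sigma>0)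
      let ?\<rho> = "\<lambda>s. a * min 1 (2 * s) + max 0 (2 * s - 1) * (t - a)"
      have \<rho>: "?\<rho> s \<in> {0..1}" if "s \<in> {0..1}" for s
      proof (cases "s \<le> 1/2")
        case True
        then show ?thesis using that a by (simp add: max_absorb1 min_absorb2 mult_le_one)
      next
        case False
        then show ?thesis using that seg_in(1)[of "2 * s - 1"] by (simp add: max_absorb2 min_absorb1)
      qed
      have "path_homotopic X (\<lambda>s. p (t * s)) (\<lambda>s. p (?\<rho> s))"
      proof (rule path_homotopic_reparam[OF pp(1)])
        show "(\<lambda>s. t * s) \<in> {0..1} \<rightarrow> {0..1}" using t(1) by (auto intro: mult_le_one)
        show "?\<rho> \<in> {0..1} \<rightarrow> {0..1}" using \<rho> by blast
      qed (auto intro!: continuous_intros)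
      moreover have "p (?\<rho> s) = concat_paths (pre a) \<sigma> s" for s
        by (cases "s \<le> 1/2") (simp_all add: concat_paths_def pre_def \<sigma>_def max_absorb1 max_absorb2 min_absorb1 min_absorb2)
      ultimately have "path_homotopic X (pre t) (concat_paths (pre a) \<sigma>)" by (simp add: pre_def)
      then have 5: "path_homotopic X (pre t) (concat_paths (pre a) c)" using 4 by (rule path_homotopic_trans)
      have s: "pathin X (seg (r 0) z0)" "pathin X (seg (r 1) z0)" using rz base by (simp_all add: pathin_seg)
      have 6: "path_homotopic X (concat_paths c (seg (r 0) z0)) (seg (r 1) z0)"
        using concat_seg_homotopic[OF rc base] by (simp add: c_def[abs_def])
      have "path_homotopic X (concat_paths (pre t) (seg (r 0) z0)) (concat_paths (concat_paths (pre a) c) (seg (r 0) z0))"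
        using 5 path_homotopic_refl[OF s(1)] by (rule path_homotopic_concat) (use rz pre01 in simp)
      also have "path_homotopic X \<dots> (concat_paths (pre a) (concat_paths c (seg (r 0) z0)))"
        using pre[OF a] c s(1) by (rule path_homotopic_assoc) (use rz pre01 c0 c1 in simp_all)
      also have "path_homotopic X \<dots> (concat_paths (pre a) (seg (r 1) z0))"
        using path_homotopic_refl[OF pre[OF a]] 6 by (rule path_homotopic_concat) (use pre01 c0 in simp)
      finally have "E t (r 0) = E a (r 1)"
        unfolding E_def path_class_eq_iff[OF El[OF t(1) rz(1,2)] El[OF a rz(3,4)]] .
      then show "P t = P a" using P_iff[OF t(1) rz(1,2)] P_iff[OF a rz(3,4)] by simp
    qed
    show "\<exists>T. openin (top_of_set {0..1}) T \<and> a \<in> T \<and> (\<forall>t\<in>T. P t = P a)"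
    proof (intro exI conjI ballI)
      show "openin (top_of_set {0..1}) ({0..1} \<inter> ball a d)" by (simp add: openin_open_Int)
      show "a \<in> {0..1} \<inter> ball a d" using a d(1) by simp
      show "P t = P a" if "t \<in> {0..1} \<inter> ball a d" for t
        using that by (intro near) (simp_all add: dist_commute)
    qed
  qed
  then obtain v where "\<And>t. t \<in> {0..1} \<Longrightarrow> P t = v" unfolding constant_on_def by blast
  then have "P 1 = P 0" by simp
  moreover have "P 0"
  proof -
    have "E 0 z0 = glue_class z0 z0"
      by (simp add: E_def glue_class_def glue_loop_def seg_refl pre_def pp)
    then show ?thesis
      using P_iff[of 0 z0] base pp glue_class_in_subgroup[OF H e base base refl] by simp
  qed
  ultimately have "E 1 z0 \<in> H" using base pp by (simp add: P_def)
  moreover have "E 1 z0 = A"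
  proof -
    have "path_homotopic X (concat_paths p (\<lambda>_. q z0)) p" by (rule path_homotopic_concat_const[OF pp(1,3)])
    then show ?thesis
      using El[of 1 z0] base pp p by (simp add: E_def A pre_def seg_refl path_class_eq_iff)
  qed
  ultimately show "A \<in> H" by simp
qed

end


(* Topo6 *)




context based_polygon
begin

lemma norm_one_disc [simp]: "polygon_boundary g s \<in> disc"
  by simp

definition corner_class :: "nat \<Rightarrow> (real \<Rightarrow> 'a) set" where
  "corner_class n = glue_class (polygon_boundary g 0) (polygon_boundary g (real n))"

lemma corner_class_0: "corner_class 0 = \<one>\<^bsub>pi1\<^esub>"
  by (simp add: corner_class_def glue_class_refl)

lemma corner_class_end: "corner_class (4 * g) = \<one>\<^bsub>pi1\<^esub>"
  using polygon_boundary_period[OF g_pos, of 0] by (simp add: corner_class_def glue_class_refl)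

lemma q_corner: "q (polygon_boundary g (real m)) = q (polygon_boundary g (real n))"
  using fibres[of "polygon_boundary g (real m)" "polygon_boundary g (real n)"] vertices_iff[OF g_pos]
  by (simp add: glued_def)

lemma corner_class_closed: "corner_class n \<in> carrier pi1"
  unfolding corner_class_def using q_corner[of 0 n] by (intro glue_class_closed) simp_all

lemma corner_class_edge:
  assumes e: "(polygon_boundary g (real m), polygon_boundary g (real n)) \<in> edge_pairs g j" and j: "j < 4 * g"
  shows "corner_class n = corner_class m \<otimes>\<^bsub>pi1\<^esub> edge_class j"
  unfolding corner_class_def edge_class_eq[OF e j, symmetric]
  using q_corner[of 0 m] q_corner[of m n] by (intro glue_class_mult[symmetric]) simp_all

lemma corner_class_step:
  assumes k: "k < g"
  shows "corner_class (4 * Suc k) = corner_class (4 * k) \<otimes>\<^bsub>pi1\<^esub> edge_class (4 * k) \<otimes>\<^bsub>pi1\<^esub> edge_class (4 * k + 3)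
      \<otimes>\<^bsub>pi1\<^esub> m_inv pi1 (edge_class (4 * k)) \<otimes>\<^bsub>pi1\<^esub> m_inv pi1 (edge_class (4 * k + 3))"
proof -
  have lt: "4 * k < 4 * g" "4 * k + 1 < 4 * g" "4 * k + 2 < 4 * g" "4 * k + 3 < 4 * g" using k by linarith+
  have "corner_class (4 * k + 4) = corner_class (4 * k) \<otimes>\<^bsub>pi1\<^esub> edge_class (4 * k) \<otimes>\<^bsub>pi1\<^esub> edge_class (4 * k + 3)
      \<otimes>\<^bsub>pi1\<^esub> edge_class (4 * k + 2) \<otimes>\<^bsub>pi1\<^esub> edge_class (4 * k + 1)"
    unfolding corner_class_edge[OF edge_pairs_corners(4)[of g k] lt(2)] corner_class_edge[OF edge_pairs_corners(3)[of g k] lt(3)]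
      corner_class_edge[OF edge_pairs_corners(2)[of g k] lt(4)] corner_class_edge[OF edge_pairs_corners(1)[of g k] lt(1)] ..
  moreover have "4 * Suc k = 4 * k + 4" by simp
  ultimately show ?thesis
    using edge_class_partner[OF lt(1)] edge_class_partner[OF lt(4)] unfolding partner_block by (simp only:)
qed

text \<open>Think of a \<open>\<Gamma>\<close>-bundle over the surface, trivialised over the polygon: the labels
  say how a trivialisation jumps when a side is crossed, and the holonomy reads the jumps off.\<close>

lemma hom_of_labels:
  fixes \<Gamma> :: "('g, 'm) monoid_scheme" and U :: "complex \<Rightarrow> 'g"
  assumes \<Gamma>: "group \<Gamma>" and U: "\<And>z. U z \<in> carrier \<Gamma>" and U0: "U z0 = \<one>\<^bsub>\<Gamma>\<^esub>"
    and jump: "\<And>j. j < 4 * g \<Longrightarrow> \<exists>c\<in>carrier \<Gamma>. \<forall>(z, z')\<in>edge_pairs g j. U z' = U z \<otimes>\<^bsub>\<Gamma>\<^esub> c"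
  shows "\<exists>\<Phi>\<in>hom pi1 \<Gamma>. \<forall>z\<in>disc. \<forall>w\<in>disc. q z = q w \<longrightarrow> \<Phi> (glue_class z w) = m_inv \<Gamma> (U z) \<otimes>\<^bsub>\<Gamma>\<^esub> U w"
proof -
  interpret \<Gamma>: group \<Gamma> by (rule \<Gamma>)
  have cancel: "m_inv \<Gamma> u \<otimes>\<^bsub>\<Gamma>\<^esub> (u \<otimes>\<^bsub>\<Gamma>\<^esub> v) = v" "u \<otimes>\<^bsub>\<Gamma>\<^esub> (m_inv \<Gamma> u \<otimes>\<^bsub>\<Gamma>\<^esub> v) = v"
    if "u \<in> carrier \<Gamma>" "v \<in> carrier \<Gamma>" for u v
    using that by (simp_all add: \<Gamma>.m_assoc[symmetric])
  define rad where "rad x = (SOME e. good_radius x e)" for x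
  have rad: "good_radius x (rad x)" if "x \<in> topspace X" for x
    unfolding rad_def using good_radius_exists[OF that] by (rule someI_ex)
  let ?d = "\<lambda>z w. U z \<otimes>\<^bsub>\<Gamma>\<^esub> m_inv \<Gamma> (U w)"
  have d_trans: "?d z w \<otimes>\<^bsub>\<Gamma>\<^esub> ?d w u = ?d z u" for z w u
    using U by (simp add: \<Gamma>.m_assoc cancel)
  have close: "?d z w = ?d z' w'" if "close_pair g z z' w w'" for z z' w w'
  proof -
    have "?d z w = ?d z' w'" if j: "j < 4 * g" and e: "(z, z') \<in> edge_pairs g j" "(w, w') \<in> edge_pairs g j" for j
    proof -
      obtain c where c: "c \<in> carrier \<Gamma>" "U z' = U z \<otimes>\<^bsub>\<Gamma>\<^esub> c" "U w' = U w \<otimes>\<^bsub>\<Gamma>\<^esub> c"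
        using jump[OF j] e by blast
      show ?thesis unfolding c(2,3) using U c(1) by (simp add: \<Gamma>.m_assoc \<Gamma>.inv_mult_group cancel)
    qed
    then show ?thesis using that U unfolding close_pair_def by auto
  qed
  define \<T> where "\<T> x y a \<longleftrightarrow> (\<exists>z\<in>disc. \<exists>w\<in>disc. q z = x \<and> q w = y \<and> dist w z < rad x \<and> a = ?d z w)" for x y a
  define \<tau> where "\<tau> x y = (if \<exists>a. \<T> x y a then SOME a. \<T> x y a else \<one>\<^bsub>\<Gamma>\<^esub>)" for x y
  have \<tau>_eq: "\<tau> x y = ?d z w" if "z \<in> disc" "w \<in> disc" "q z = x" "q w = y" "dist w z < rad x" for x y z w
  proof -
    have x: "x \<in> topspace X" using that(1,3) q_space by blast
    have uniq: "a = ?d z w" if a: "\<T> x y a" for a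
    proof -
      obtain z1 w1 where 1: "z1 \<in> disc" "w1 \<in> disc" "q z1 = x" "q w1 = y" "dist w1 z1 < rad x" "a = ?d z1 w1"
        using a unfolding \<T>_def by (elim bexE conjE) (rule that)
      obtain z' where z': "z' \<in> disc" "q z' = x" "dist w1 z' = dist w z" "close_pair g z z' w w1"
        using good_radiusD(4)[OF rad[OF x], of z w w1] 1 \<open>z \<in> disc\<close> \<open>w \<in> disc\<close> \<open>q z = x\<close> \<open>q w = y\<close> \<open>dist w z < rad x\<close> by auto
      have "z' = z1"
        using good_radiusD(3)[OF rad[OF x], of z' z1 w1] z' 1 \<open>dist w z < rad x\<close> by auto
      then show ?thesis using close[OF z'(4)] 1(6) by simp
    qed
    have T: "\<T> x y (?d z w)" unfolding \<T>_def using that by blast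
    then have "\<T> x y (SOME a. \<T> x y a)" by (rule someI)
    then have "(SOME a. \<T> x y a) = ?d z w" by (rule uniq)
    then show ?thesis unfolding \<tau>_def using T by auto
  qed
  have \<tau>_closed: "\<tau> x y \<in> carrier \<Gamma>" for x y
  proof (cases "\<exists>a. \<T> x y a")
    case True
    then have "\<T> x y (SOME a. \<T> x y a)" by (rule someI_ex)
    moreover have "a \<in> carrier \<Gamma>" if "\<T> x y a" for a using that U by (auto simp: \<T>_def)
    ultimately show ?thesis unfolding \<tau>_def if_P[OF True] by blast
  qed (simp add: \<tau>_def)
  interpret local_system \<Gamma> X \<tau>
  proof
    show "\<tau> x y \<in> carrier \<Gamma>" for x y by (rule \<tau>_closed)
    fix x assume x: "x \<in> topspace X"
    note gx = rad[OF x]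
    show "\<exists>N. openin X N \<and> x \<in> N \<and> (\<forall>y\<in>N. \<exists>M. openin X M \<and> y \<in> M \<and> (\<forall>v\<in>M. \<tau> x v = \<tau> x y \<otimes>\<^bsub>\<Gamma>\<^esub> \<tau> y v))"
    proof (rule exI[of _ "q ` around x (rad x)"], intro conjI ballI)
      show "openin X (q ` around x (rad x))" by (rule openin_around[OF gx])
      show "x \<in> q ` around x (rad x)" by (rule in_around[OF x good_radiusD(1)[OF gx]])
      fix y assume "y \<in> q ` around x (rad x)"
      then obtain w z where w: "w \<in> disc" "y = q w" and z: "z \<in> disc" "q z = x" "dist w z < rad x"
        by (auto simp: around_def)
      have y: "y \<in> topspace X" using w q_space by blast
      define \<delta> where "\<delta> = min (rad y) (rad x - dist w z)"
      have \<delta>: "0 < \<delta>" "\<delta> \<le> rad y" "\<delta> \<le> rad x - dist w z"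
        using z(3) good_radiusD(1)[OF rad[OF y]] by (auto simp: \<delta>_def)
      show "\<exists>M. openin X M \<and> y \<in> M \<and> (\<forall>v\<in>M. \<tau> x v = \<tau> x y \<otimes>\<^bsub>\<Gamma>\<^esub> \<tau> y v)"
      proof (rule exI[of _ "q ` around y \<delta>"], intro conjI ballI)
        show "openin X (q ` around y \<delta>)" by (rule openin_around[OF good_radius_mono[OF rad[OF y] \<delta>(1,2)]])
        show "y \<in> q ` around y \<delta>" by (rule in_around[OF y \<delta>(1)])
        fix v assume "v \<in> q ` around y \<delta>"
        then obtain u w1 where u: "u \<in> disc" "v = q u" and w1: "w1 \<in> disc" "q w1 = y" "dist u w1 < \<delta>"
          by (auto simp: around_def)
        obtain z1 where z1: "z1 \<in> disc" "q z1 = x" "dist w1 z1 = dist w z"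
          using good_radiusD(4)[OF gx, of z w w1] z w w1 by auto
        have "dist u z1 \<le> dist u w1 + dist w1 z1" by (rule dist_triangle)
        then have "dist u z1 < rad x" using \<delta>(3) w1(3) z1(3) by linarith
        then have 1: "\<tau> x v = ?d z1 u" using z1 u by (intro \<tau>_eq) auto
        have 2: "\<tau> x y = ?d z1 w1" using z1 w1 z(3) by (intro \<tau>_eq) auto
        have 3: "\<tau> y v = ?d w1 u" using w1 u \<delta>(2) by (intro \<tau>_eq) auto
        show "\<tau> x v = \<tau> x y \<otimes>\<^bsub>\<Gamma>\<^esub> \<tau> y v" unfolding 1 2 3 by (rule d_trans[symmetric])
      qed
    qed
  qed
  have seg: "holonomy (seg z w) = ?d z w" if z: "z \<in> disc" and w: "w \<in> disc" for z w
  proof -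
    have par: "parallel {0..1} (seg z w) (\<lambda>t. ?d z (linepath z w t))"
      unfolding parallel_def
    proof (intro conjI ballI)
      show "?d z (linepath z w s) \<in> carrier \<Gamma>" for s using U by simp
      fix a :: real assume a: "a \<in> {0..1}"
      let ?x = "q (linepath z w a)"
      have x: "?x \<in> topspace X" using linepath_disc[OF z w a] q_space by blast
      have "continuous_on UNIV (linepath z w)" by (rule continuous_on_linepath)
      then have o: "open {s. dist (linepath z w s) (linepath z w a) < rad ?x}"
        by (intro open_Collect_less continuous_intros)
      show "\<exists>V. open V \<and> a \<in> V \<and> (\<forall>s\<in>{0..1} \<inter> V. ?d z (linepath z w s) = ?d z (linepath z w a) \<otimes>\<^bsub>\<Gamma>\<^esub> \<tau> (seg z w a) (seg z w s))"
      proof (rule exI[of _ "{s. dist (linepath z w s) (linepath z w a) < rad ?x}"], intro conjI ballI o)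
        show "a \<in> {s. dist (linepath z w s) (linepath z w a) < rad ?x}"
          using good_radiusD(1)[OF rad[OF x]] by simp
        fix s assume s: "s \<in> {0..1} \<inter> {s. dist (linepath z w s) (linepath z w a) < rad ?x}"
        have "\<tau> (seg z w a) (seg z w s) = ?d (linepath z w a) (linepath z w s)"
          unfolding seg_def using s by (intro \<tau>_eq linepath_disc[OF z w] a) auto
        then show "?d z (linepath z w s) = ?d z (linepath z w a) \<otimes>\<^bsub>\<Gamma>\<^esub> \<tau> (seg z w a) (seg z w s)"
          by (simp only: d_trans)
      qed
    qed
    have "holonomy (seg z w) = ?d z (linepath z w 1)"
      by (rule holonomy_eqI[OF pathin_seg[OF z w] par]) (use U in \<open>simp add: linepath_def\<close>)
    then show ?thesis by (simp add: linepath_def)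
  qed
  obtain \<Phi> where \<Phi>: "\<Phi> \<in> hom pi1 \<Gamma>" "\<And>p. p \<in> loops X (q z0) \<Longrightarrow> \<Phi> (path_class X (q z0) p) = holonomy p"
    using holonomy_hom[of "q z0"] by blast
  have "\<Phi> (glue_class z w) = m_inv \<Gamma> (U z) \<otimes>\<^bsub>\<Gamma>\<^esub> U w" if zw: "z \<in> disc" "w \<in> disc" "q z = q w" for z w
  proof -
    have "\<Phi> (glue_class z w) = holonomy (glue_loop z w)"
      unfolding glue_class_def by (rule \<Phi>(2)[OF glue_loop_loops[OF zw]])
    also have "\<dots> = holonomy (seg z0 z) \<otimes>\<^bsub>\<Gamma>\<^esub> holonomy (seg w z0)"
      unfolding glue_loop_def using zw base by (intro holonomy_concat pathin_seg) simp_all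
    also have "\<dots> = m_inv \<Gamma> (U z) \<otimes>\<^bsub>\<Gamma>\<^esub> U w" unfolding seg[OF base zw(1)] seg[OF zw(2) base] using U U0 by simp
    finally show ?thesis .
  qed
  then show ?thesis using \<Phi>(1) by blast
qed

lemma hom_of_boundary_labels:
  fixes \<Gamma> :: "('g, 'm) monoid_scheme" and L :: "real \<Rightarrow> 'g"
  assumes \<Gamma>: "group \<Gamma>" and L: "\<And>s. L s \<in> carrier \<Gamma>" and closed: "L (4 * real g) = L 0"
    and c: "\<And>j. j < 4 * g \<Longrightarrow> j mod 4 < 2 \<Longrightarrow> c j \<in> carrier \<Gamma>"
    and jump: "\<And>j s. j < 4 * g \<Longrightarrow> j mod 4 < 2 \<Longrightarrow> s \<in> {real j..real j + 1} \<Longrightarrow> L (mirror j s) = L s \<otimes>\<^bsub>\<Gamma>\<^esub> c j"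
  shows "\<exists>\<Phi>\<in>hom pi1 \<Gamma>. \<forall>j<4 * g. j mod 4 < 2 \<longrightarrow> \<Phi> (edge_class j) = c j"
proof -
  interpret \<Gamma>: group \<Gamma> by (rule \<Gamma>)
  let ?b = "polygon_boundary g"
  define N where "N z = (if norm z = 1 then L (SOME s. s \<in> {0..<4 * real g} \<and> ?b s = z) else \<one>\<^bsub>\<Gamma>\<^esub>)" for z
  have N: "N z \<in> carrier \<Gamma>" for z using L by (simp add: N_def)
  have Nb: "N (?b s) = L s" if s: "s \<in> {0..4 * real g}" for s
  proof -
    obtain u where u: "u \<in> {0..<4 * real g}" "?b u = ?b s" "L u = L s"
    proof (cases "s = 4 * real g")
      case True
      then show ?thesis using that[of 0] closed g_pos polygon_boundary_period[OF g_pos, of 0] by simp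
    qed (use s that[of s] in auto)
    have "(SOME u. u \<in> {0..<4 * real g} \<and> ?b u = ?b s) = u"
    proof (rule some_equality)
      fix v assume v: "v \<in> {0..<4 * real g} \<and> ?b v = ?b s"
      then have "\<bar>v - u\<bar> < 4 * real g" using u(1) by auto
      then show "v = u" using v u(2) polygon_boundary_inj[OF g_pos, of v u] by simp
    qed (use u in simp)
    then show ?thesis using u(3) by (simp add: N_def)
  qed
  have in_range: "s \<in> {0..4 * real g}" "mirror j s \<in> {0..4 * real g}" if "j < 4 * g" "s \<in> {real j..real j + 1}" for j s
  proof -
    have "real j + 1 \<le> 4 * real g" "real (partner j) + 1 \<le> 4 * real g"
      using that(1) partner_less[OF that(1)] by linarith+
    then show "s \<in> {0..4 * real g}" "mirror j s \<in> {0..4 * real g}"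
      using that(2) mirror_range[OF that(2)] by auto
  qed
  have first: "N z' = N z \<otimes>\<^bsub>\<Gamma>\<^esub> c j" if j: "j < 4 * g" "j mod 4 < 2" and e: "(z, z') \<in> edge_pairs g j" for j z z'
  proof -
    obtain s where s: "s \<in> {real j..real j + 1}" "z = ?b s" "z' = ?b (mirror j s)"
      using e by (auto simp: edge_pairs_def)
    show ?thesis unfolding s(2,3) Nb[OF in_range(1)[OF j(1) s(1)]] Nb[OF in_range(2)[OF j(1) s(1)]] by (rule jump[OF j s(1)])
  qed
  have N_jump: "\<exists>d\<in>carrier \<Gamma>. \<forall>(z, z')\<in>edge_pairs g j. N z' = N z \<otimes>\<^bsub>\<Gamma>\<^esub> d" if j: "j < 4 * g" for j
  proof (cases "j mod 4 < 2")
    case True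
    then show ?thesis using first[OF j True] c[OF j True] by blast
  next
    case False
    have p: "partner j < 4 * g" "partner j mod 4 < 2"
    proof -
      show "partner j mod 4 < 2"
      proof (cases j rule: block_cases)
        case (3 k)
        then show ?thesis unfolding 3 partner_block by simp
      next
        case (4 k)
        have "(4 * k + 1) mod 4 < (2::nat)" by simp
        then show ?thesis unfolding 4 partner_block .
      qed (use False in auto)
    qed (rule partner_less[OF j])
    have "N z' = N z \<otimes>\<^bsub>\<Gamma>\<^esub> m_inv \<Gamma> (c (partner j))" if "(z, z') \<in> edge_pairs g j" for z z'
      using first[OF p edge_pairs_sym[OF that]] N c[OF p] by (simp add: \<Gamma>.m_assoc)
    then show ?thesis using c[OF p] by blast
  qed
  define U where "U z = m_inv \<Gamma> (N z0) \<otimes>\<^bsub>\<Gamma>\<^esub> N z" for z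
  have U: "U z \<in> carrier \<Gamma>" for z using N by (simp add: U_def)
  have "\<exists>\<Phi>\<in>hom pi1 \<Gamma>. \<forall>z\<in>disc. \<forall>w\<in>disc. q z = q w \<longrightarrow> \<Phi> (glue_class z w) = m_inv \<Gamma> (U z) \<otimes>\<^bsub>\<Gamma>\<^esub> U w"
  proof (rule hom_of_labels[OF \<Gamma> U])
    show "U z0 = \<one>\<^bsub>\<Gamma>\<^esub>" using N by (simp add: U_def)
    fix j assume "j < 4 * g"
    then obtain d where d: "d \<in> carrier \<Gamma>" "\<forall>(z, z')\<in>edge_pairs g j. N z' = N z \<otimes>\<^bsub>\<Gamma>\<^esub> d"
      using N_jump by blast
    have "U z' = U z \<otimes>\<^bsub>\<Gamma>\<^esub> d" if "(z, z') \<in> edge_pairs g j" for z z'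
      using d that N by (auto simp: U_def \<Gamma>.m_assoc)
    then show "\<exists>d\<in>carrier \<Gamma>. \<forall>(z, z')\<in>edge_pairs g j. U z' = U z \<otimes>\<^bsub>\<Gamma>\<^esub> d" using d(1) by blast
  qed
  then obtain \<Phi> where \<Phi>: "\<Phi> \<in> hom pi1 \<Gamma>"
    "\<And>z w. z \<in> disc \<Longrightarrow> w \<in> disc \<Longrightarrow> q z = q w \<Longrightarrow> \<Phi> (glue_class z w) = m_inv \<Gamma> (U z) \<otimes>\<^bsub>\<Gamma>\<^esub> U w"
    by blast
  have "\<Phi> (edge_class j) = c j" if j: "j < 4 * g" "j mod 4 < 2" for j
  proof -
    have e: "(?b (real j), ?b (mirror j (real j))) \<in> edge_pairs g j" by (auto simp: edge_pairs_def)
    have eq: "U (?b (mirror j (real j))) = U (?b (real j)) \<otimes>\<^bsub>\<Gamma>\<^esub> c j"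
      using first[OF j e] N c[OF j] by (simp add: U_def \<Gamma>.m_assoc)
    have "m_inv \<Gamma> (u) \<otimes>\<^bsub>\<Gamma>\<^esub> (u \<otimes>\<^bsub>\<Gamma>\<^esub> v) = v" if "u \<in> carrier \<Gamma>" "v \<in> carrier \<Gamma>" for u v
      using that by (simp add: \<Gamma>.m_assoc[symmetric])
    then show ?thesis
      unfolding edge_class_def \<Phi>(2)[OF edge_pairs_disc[OF e j(1)]] eq using U c[OF j] by blast
  qed
  then show ?thesis using \<Phi>(1) by blast
qed

end


(* Fin *)


lemma m_inv_Homeo_plus: "f \<in> Homeos \<Longrightarrow> m_inv Homeo_plus f = inv f"
proof -
  assume f: "f \<in> Homeos"
  interpret group Homeo_plus by (rule group_Homeo_plus)
  have "inv f \<otimes>\<^bsub>Homeo_plus\<^esub> f = \<one>\<^bsub>Homeo_plus\<^esub>" using f by (auto simp: Homeo_plus_def[THEN arg_cong[where f=mult]] Homeo_plus_def[THEN arg_cong[where f=one]] fun_eq_iff)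
  then show ?thesis using f by (intro inv_equality) auto
qed

lemma mult_Homeo_plus [simp]: "f \<otimes>\<^bsub>Homeo_plus\<^esub> h = f \<circ> h"
  by (simp add: Homeo_plus_def)

lemma one_Homeo_plus [simp]: "\<one>\<^bsub>Homeo_plus\<^esub> = id"
  by (simp add: Homeo_plus_def)

lemma tendsto_Homeos_apply:
  fixes f :: "'b \<Rightarrow> real \<Rightarrow> real"
  assumes f: "\<And>x. ((\<lambda>n. f n x) \<longlongrightarrow> h x) F" and fH: "eventually (\<lambda>n. f n \<in> Homeos) F" and h: "h \<in> Homeos"
    and u: "(u \<longlongrightarrow> v) F"
  shows "((\<lambda>n. f n (u n)) \<longlongrightarrow> h v) F"
proof (rule order_tendstoI)
  fix y assume y: "y < h v"
  define x where "x = inv h ((y + h v) / 2)"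
  have hx: "h x = (y + h v) / 2" using h by (simp add: x_def)
  then have "h x < h v" "y < h x" using y by auto
  then have "eventually (\<lambda>n. y < f n x) F" "eventually (\<lambda>n. x < u n) F"
    using order_tendstoD(1)[OF f] order_tendstoD(1)[OF u] h by (auto simp: Homeos_less)
  then show "eventually (\<lambda>n. y < f n (u n)) F"
    using fH by eventually_elim (metis Homeos_less less_trans)
next
  fix y assume y: "h v < y"
  define x where "x = inv h ((y + h v) / 2)"
  have hx: "h x = (y + h v) / 2" using h by (simp add: x_def)
  then have "h v < h x" "h x < y" using y by auto
  then have "eventually (\<lambda>n. f n x < y) F" "eventually (\<lambda>n. u n < x) F"
    using order_tendstoD(2)[OF f] order_tendstoD(2)[OF u] h by (auto simp: Homeos_less)
  then show "eventually (\<lambda>n. f n (u n) < y) F"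
    using fH by eventually_elim (metis Homeos_less less_trans)
qed

lemma tendsto_Homeos_inv:
  fixes f :: "'b \<Rightarrow> real \<Rightarrow> real"
  assumes f: "\<And>x. ((\<lambda>n. f n x) \<longlongrightarrow> h x) F" and fH: "eventually (\<lambda>n. f n \<in> Homeos) F" and h: "h \<in> Homeos"
  shows "((\<lambda>n. inv (f n) x) \<longlongrightarrow> inv h x) F"
proof (rule order_tendstoI)
  fix y assume "y < inv h x"
  then have "eventually (\<lambda>n. f n y < x) F"
    using order_tendstoD(2)[OF f] h by (auto simp: Homeos_less_inv_iff)
  then show "eventually (\<lambda>n. y < inv (f n) x) F"
    using fH by eventually_elim (simp add: Homeos_less_inv_iff)
next
  fix y assume "inv h x < y"
  then have "eventually (\<lambda>n. x < f n y) F"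
    using order_tendstoD(1)[OF f] h by (auto simp: Homeos_inv_less_iff)
  then show "eventually (\<lambda>n. inv (f n) x < y) F"
    using fH by eventually_elim (simp add: Homeos_inv_less_iff)
qed

lemma eventually_compact_image_subset:
  fixes f :: "'b \<Rightarrow> real \<Rightarrow> real"
  assumes f: "\<And>x. ((\<lambda>n. f n x) \<longlongrightarrow> h x) F" and fH: "eventually (\<lambda>n. f n \<in> Homeos) F" and h: "h \<in> Homeos"
    and K: "compact K" and V: "open V" and hK: "h ` K \<subseteq> V"
  shows "eventually (\<lambda>n. f n ` K \<subseteq> V) F"
proof -
  have "\<exists>u v. x \<in> {u<..<v} \<and> eventually (\<lambda>n. f n ` {u<..<v} \<subseteq> V) F" if x: "x \<in> K" for x
  proof -
    obtain e where e: "e > 0" "ball (h x) e \<subseteq> V" using V hK x openE by (metis image_subset_iff)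
    define u v where "u = inv h (h x - e)" and "v = inv h (h x + e)"
    have hu: "h u = h x - e" and hv: "h v = h x + e" using h by (simp_all add: u_def v_def)
    define u' v' where "u' = inv h (h x - e / 2)" and "v' = inv h (h x + e / 2)"
    have hu': "h u' = h x - e / 2" and hv': "h v' = h x + e / 2" using h by (simp_all add: u'_def v'_def)
    have "u' < x" "x < v'" using hu' hv' e(1) Homeos_less[OF h, of u' x] Homeos_less[OF h, of x v'] by simp_all
    moreover have "eventually (\<lambda>n. h x - e < f n u') F" "eventually (\<lambda>n. f n v' < h x + e) F"
      using order_tendstoD[OF f] hu' hv' e(1) by auto
    then have "eventually (\<lambda>n. f n ` {u'<..<v'} \<subseteq> V) F"
      using fH
    proof eventually_elim
      case (elim n)
      have "f n y \<in> ball (h x) e" if "y \<in> {u'<..<v'}" for y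
      proof -
        have "f n u' < f n y" "f n y < f n v'" using that elim(3) by (auto simp: Homeos_less)
        then show ?thesis using elim(1,2) by (auto simp: dist_real_def)
      qed
      then show ?case using e(2) by blast
    qed
    ultimately show ?thesis by (intro exI[of _ u'] exI[of _ v']) simp
  qed
  then obtain u v where uv: "\<And>x. x \<in> K \<Longrightarrow> x \<in> {u x<..<v x}"
    and ev: "\<And>x. x \<in> K \<Longrightarrow> eventually (\<lambda>n. f n ` {u x<..<v x} \<subseteq> V) F" by metis
  obtain D where D: "D \<subseteq> K" "finite D" "K \<subseteq> (\<Union>x\<in>D. {u x<..<v x})"
    by (rule compactE_image[OF K, of K "\<lambda>x. {u x<..<v x}"]) (use uv in auto)
  have "eventually (\<lambda>n. \<forall>x\<in>D. f n ` {u x<..<v x} \<subseteq> V) F"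
    using ev D(1) by (intro eventually_ball_finite D(2)) blast
  then show ?thesis by (rule eventually_mono) (use D(3) in blast)
qed

lemma openin_top_of_setI:
  assumes "A \<subseteq> S" "\<And>a. a \<in> A \<Longrightarrow> eventually (\<lambda>x. x \<in> A) (at a within S)"
  shows "openin (top_of_set S) A"
proof (subst openin_subopen, intro ballI)
  fix a assume a: "a \<in> A"
  obtain U where U: "open U" "a \<in> U" "\<forall>x\<in>U. x \<noteq> a \<longrightarrow> x \<in> S \<longrightarrow> x \<in> A"
    using assms(2)[OF a] unfolding eventually_at_topological by blast
  show "\<exists>T. openin (top_of_set S) T \<and> a \<in> T \<and> T \<subseteq> A"
    by (rule exI[of _ "S \<inter> U"]) (use U a assms(1) in \<open>auto simp: openin_open_Int\<close>)
qed

context based_polygon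
begin

definition gen :: "nat \<Rightarrow> (real \<Rightarrow> 'a) set" where
  "gen i = edge_class (if even i then 2 * i else 2 * i + 1)"

lemma gen_block: "gen (2 * k) = edge_class (4 * k)" "gen (2 * k + 1) = edge_class (4 * k + 3)"
  by (simp_all add: gen_def numeral_3_eq_3)

lemma gen_closed: "i < 2 * g \<Longrightarrow> gen i \<in> carrier pi1"
  unfolding gen_def by (intro edge_class_closed) (auto elim!: oddE)

lemma gens_generate:
  assumes H: "subgroup H pi1" and e: "\<And>i. i < 2 * g \<Longrightarrow> gen i \<in> H"
  shows "carrier pi1 \<subseteq> H"
proof (rule edge_classes_generate[OF H])
  have main: "edge_class (4 * k) \<in> H" "edge_class (4 * k + 3) \<in> H" if "k < g" for k
    using e[of "2 * k"] e[of "2 * k + 1"] that unfolding gen_block by simp_all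
  fix j assume j: "j < 4 * g"
  show "edge_class j \<in> H"
  proof (cases j rule: block_cases)
    case (1 k)
    then show ?thesis using main j by simp
  next
    case (2 k)
    then have "k < g" using j by simp
    then have k: "k < g" "4 * k + 3 < 4 * g" by linarith+
    then show ?thesis
      using edge_class_partner[OF k(2)] subgroup.m_inv_closed[OF H main(2)[OF k(1)]] unfolding partner_block 2 by (simp only:)
  next
    case (3 k)
    then have k: "k < g" "4 * k < 4 * g" using j by simp_all
    then show ?thesis
      using edge_class_partner[OF k(2)] subgroup.m_inv_closed[OF H main(1)[OF k(1)]] unfolding partner_block 3 by (simp only:)
  next
    case (4 k)
    then show ?thesis using main j by simp
  qed
qed

definition tuple :: "((real \<Rightarrow> 'a) set \<Rightarrow> real \<Rightarrow> real) \<Rightarrow> nat \<Rightarrow> real \<Rightarrow> real" where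
  "tuple \<rho> i = (if i < 2 * g then \<rho> (gen i) else id)"

lemma surface_rep_tuple:
  assumes \<rho>: "\<rho> \<in> hom pi1 Homeo_plus"
  shows "surface_rep g (tuple \<rho>)"
proof -
  interpret group_hom pi1 Homeo_plus \<rho>
    using \<rho> group_pi1 group_Homeo_plus by (simp add: group_hom_def group_hom_axioms_def)
  have "\<rho> (corner_class (4 * k)) = surface_word k (tuple \<rho>)" if "k \<le> g" for k
    using that
  proof (induction k)
    case 0
    then show ?case using corner_class_0 hom_one by simp
  next
    case (Suc k)
    then have k: "k < g" "4 * k < 4 * g" "4 * k + 3 < 4 * g" "2 * k < 2 * g" "2 * k + 1 < 2 * g" by simp_all
    have t: "tuple \<rho> (2 * k) = \<rho> (edge_class (4 * k))" "tuple \<rho> (2 * k + 1) = \<rho> (edge_class (4 * k + 3))"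
      unfolding tuple_def gen_block using k(4,5) by simp_all
    note c = edge_class_closed[OF k(2)] edge_class_closed[OF k(3)]
    have "\<rho> (corner_class (4 * Suc k)) = \<rho> (corner_class (4 * k)) \<circ> \<rho> (edge_class (4 * k)) \<circ> \<rho> (edge_class (4 * k + 3))
        \<circ> inv (\<rho> (edge_class (4 * k))) \<circ> inv (\<rho> (edge_class (4 * k + 3)))"
      unfolding corner_class_step[OF k(1)] using c corner_class_closed
      by (simp add: m_inv_Homeo_plus)
    then show ?case using Suc k(1) unfolding surface_word.simps t by (simp add: commutator_def comp_assoc)
  qed
  from this[of g] have "surface_word g (tuple \<rho>) = id" using corner_class_end hom_one by simp
  then show ?thesis
    unfolding surface_rep_def using gen_closed by (auto simp: tuple_def)
qed

lemma hom_of_surface_rep: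
  assumes w: "surface_rep g w"
  shows "\<exists>\<Phi>\<in>hom pi1 Homeo_plus. \<forall>i<2 * g. \<Phi> (gen i) = w i"
proof -
  note wH = surface_repD(1)[OF w]
  define corner where "corner n = (let a = w (2 * (n div 4)); b = w (2 * (n div 4) + 1); P = surface_word (n div 4) w in
      if n mod 4 = 0 then P else if n mod 4 = 1 then P \<circ> a \<circ> b \<circ> inv a else if n mod 4 = 2 then P \<circ> a \<circ> b else P \<circ> a)" for n
  define side where "side j = (if j mod 4 = 1 then w (2 * (j div 4) + 1) else if j mod 4 = 2 then w (2 * (j div 4)) else id)" for j
  define L where "L s = (if s \<in> \<int> then corner (nat \<lfloor>s\<rfloor>) else side (nat \<lfloor>s\<rfloor>))" for s :: real
  define c where "c j = (if j mod 4 = 0 then w (j div 2) else inv (w (j div 2 + 1)))" for j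
  have Lc: "L (real n) = corner n" for n by (simp add: L_def)
  have Ls: "L s = side j" if "real j < s" "s < real j + 1" for j s
  proof -
    have fl: "\<lfloor>s\<rfloor> = int j" using that by linarith
    have "s \<notin> \<int>" using that fl by (metis floor_of_int Ints_cases less_irrefl of_int_of_nat_eq)
    then show ?thesis using fl by (simp add: L_def)
  qed
  have dm: "4 * k div 4 = k" "(4 * k + 1) div 4 = k" "(4 * k + 2) div 4 = k" "(4 * k + 3) div 4 = k"
      "4 * k mod 4 = 0" "(4 * k + 1) mod 4 = 1" "(4 * k + 2) mod 4 = 2" "(4 * k + 3) mod 4 = 3" for k :: nat
    by presburger+
  have corner: "corner (4 * k) = surface_word k w"
      "corner (4 * k + 1) = surface_word k w \<circ> w (2 * k) \<circ> w (2 * k + 1) \<circ> inv (w (2 * k))"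
      "corner (4 * k + 2) = surface_word k w \<circ> w (2 * k) \<circ> w (2 * k + 1)"
      "corner (4 * k + 3) = surface_word k w \<circ> w (2 * k)" for k
    unfolding corner_def Let_def dm by simp_all
  have side: "side (4 * k) = id" "side (4 * k + 1) = w (2 * k + 1)" "side (4 * k + 2) = w (2 * k)" "side (4 * k + 3) = id" for k
    unfolding side_def dm by simp_all
  have c: "c (4 * k) = w (2 * k)" "c (4 * k + 1) = inv (w (2 * k + 1))" for k
    by (simp_all add: c_def)
  have "\<exists>\<Phi>\<in>hom pi1 Homeo_plus. \<forall>j<4 * g. j mod 4 < 2 \<longrightarrow> \<Phi> (edge_class j) = c j"
  proof (rule hom_of_boundary_labels[OF group_Homeo_plus])
    show "L s \<in> Homeos" for s using wH by (simp add: L_def corner_def side_def Let_def)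
    have "L (real (4 * g)) = L (real 0)" unfolding Lc using corner(1)[of g] corner(1)[of 0] surface_repD(3)[OF w] by simp
    then show "L (4 * real g) = L 0" by simp
    show "c j \<in> Homeos" for j using wH by (simp add: c_def)
    fix j and s :: real assume j: "j < 4 * g" "j mod 4 < 2" and s: "s \<in> {real j..real j + 1}"
    have nc: "j \<noteq> 4 * k + 2" "j \<noteq> 4 * k + 3" for k
    proof -
      show "j \<noteq> 4 * k + 2" using j(2) dm(7)[of k] by (cases "j = 4 * k + 2") (simp_all only:, simp_all)
      show "j \<noteq> 4 * k + 3" using j(2) dm(8)[of k] by (cases "j = 4 * k + 3") (simp_all only:, simp_all)
    qed
    consider "s = real j" | "s = real j + 1" | "real j < s" "s < real j + 1" using s by fastforce
    then have "L (mirror j s) = L s \<circ> c j"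
    proof cases
      case 1
      show ?thesis
      proof (cases j rule: block_cases)
        case (1 k)
        have "mirror j s = real (4 * k + 3)" unfolding \<open>s = real j\<close> mirror_def 1 partner_block by simp
        then show ?thesis unfolding \<open>s = real j\<close> by (simp only: 1 Lc corner c)
      next
        case (2 k)
        have m: "mirror j s = real (4 * Suc k)" unfolding \<open>s = real j\<close> mirror_def 2 partner_block by simp
        show ?thesis unfolding m unfolding \<open>s = real j\<close>
          by (simp only: 2 Lc corner c surface_word.simps commutator_def comp_assoc)
      qed (use nc in \<open>blast+\<close>)
    next
      case 2
      show ?thesis
      proof (cases j rule: block_cases)
        case (1 k)
        have m: "mirror j s = real (4 * k + 2)" "s = real (4 * k + 1)" unfolding \<open>s = real j + 1\<close> mirror_def 1 partner_block by simp_all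
        have "c j = w (2 * k)" unfolding 1 c ..
        then show ?thesis unfolding m(1) unfolding m(2) Lc corner using wH by (simp add: fun_eq_iff)
      next
        case (2 k)
        have m: "mirror j s = real (4 * k + 3)" "s = real (4 * k + 2)" unfolding \<open>s = real j + 1\<close> mirror_def 2 partner_block by simp_all
        have "c j = inv (w (2 * k + 1))" unfolding 2 c ..
        then show ?thesis unfolding m(1) unfolding m(2) Lc corner using wH by (simp add: fun_eq_iff)
      qed (use nc in \<open>blast+\<close>)
    next
      case 3
      show ?thesis
      proof (cases j rule: block_cases)
        case (1 k)
        have "mirror j s = real (4 * k) + real (4 * k + 2) + 1 - s" unfolding mirror_def 1 partner_block ..
        then have "real (4 * k + 2) < mirror j s" "mirror j s < real (4 * k + 2) + 1" using 3 unfolding 1 by linarith+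
        from Ls[OF this] Ls[OF 3] show ?thesis by (simp only: 1 side c id_comp)
      next
        case (2 k)
        have "mirror j s = real (4 * k + 1) + real (4 * k + 3) + 1 - s" unfolding mirror_def 2 partner_block ..
        then have "real (4 * k + 3) < mirror j s" "mirror j s < real (4 * k + 3) + 1" using 3 unfolding 2 by linarith+
        from Ls[OF this] Ls[OF 3] show ?thesis using wH by (simp only: 2 side c) (simp add: fun_eq_iff)
      qed (use nc in \<open>blast+\<close>)
    qed
    then show "L (mirror j s) = L s \<otimes>\<^bsub>Homeo_plus\<^esub> c j" by simp
  qed
  then obtain \<Phi> where \<Phi>: "\<Phi> \<in> hom pi1 Homeo_plus" "\<And>j. j < 4 * g \<Longrightarrow> j mod 4 < 2 \<Longrightarrow> \<Phi> (edge_class j) = c j" by blast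
  interpret group_hom pi1 Homeo_plus \<Phi>
    using \<Phi>(1) group_pi1 group_Homeo_plus by (simp add: group_hom_def group_hom_axioms_def)
  have "\<Phi> (gen i) = w i" if i: "i < 2 * g" for i
  proof (cases "even i")
    case True
    then obtain k where k: "i = 2 * k" by blast
    show ?thesis unfolding k gen_block using \<Phi>(2)[of "4 * k"] i k by (simp add: c)
  next
    case False
    then obtain k where k: "i = 2 * k + 1" by (rule oddE)
    have lt: "4 * k + 1 < 4 * g" using i k by simp
    have "(4 * k + 1) mod 4 < (2::nat)" by simp
    from \<Phi>(2)[OF lt this] have e: "\<Phi> (edge_class (4 * k + 1)) = inv (w (2 * k + 1))" unfolding c .
    have "edge_class (4 * k + 3) = m_inv pi1 (edge_class (4 * k + 1))"
      using edge_class_partner[OF lt] unfolding partner_block .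
    then have "\<Phi> (edge_class (4 * k + 3)) = inv (inv (w (2 * k + 1)))"
      using edge_class_closed[OF lt] e wH by (simp add: m_inv_Homeo_plus)
    then show ?thesis unfolding k gen_block using wH by simp
  qed
  then show ?thesis using \<Phi>(1) by blast
qed

lemma hom_eqI:
  assumes "\<rho> \<in> hom pi1 Homeo_plus" "\<sigma> \<in> hom pi1 Homeo_plus" "\<And>i. i < 2 * g \<Longrightarrow> \<rho> (gen i) = \<sigma> (gen i)" "a \<in> carrier pi1"
  shows "\<rho> a = \<sigma> a"
proof -
  interpret \<rho>: group_hom pi1 Homeo_plus \<rho>
    using assms(1) group_pi1 group_Homeo_plus by (simp add: group_hom_def group_hom_axioms_def)
  interpret \<sigma>: group_hom pi1 Homeo_plus \<sigma>
    using assms(2) group_pi1 group_Homeo_plus by (simp add: group_hom_def group_hom_axioms_def)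
  have "subgroup {a \<in> carrier pi1. \<rho> a = \<sigma> a} pi1"
    by (rule group.subgroupI[OF group_pi1]) (auto simp del: mult_Homeo_plus)
  from gens_generate[OF this] show ?thesis using assms(3,4) gen_closed by blast
qed

definition rep_of :: "(nat \<Rightarrow> real \<Rightarrow> real) \<Rightarrow> (real \<Rightarrow> 'a) set \<Rightarrow> real \<Rightarrow> real" where
  "rep_of w = (SOME \<Phi>. \<Phi> \<in> topspace (Rep pi1) \<and> (\<forall>i<2 * g. \<Phi> (gen i) = w i))"

lemma rep_of:
  assumes "surface_rep g w"
  shows "rep_of w \<in> topspace (Rep pi1)" "i < 2 * g \<Longrightarrow> rep_of w (gen i) = w i"
proof -
  obtain \<Phi> where \<Phi>: "\<Phi> \<in> hom pi1 Homeo_plus" "\<forall>i<2 * g. \<Phi> (gen i) = w i"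
    using hom_of_surface_rep[OF assms] by blast
  interpret group pi1 by (rule group_pi1)
  have "restrict \<Phi> (carrier pi1) \<in> topspace (Rep pi1)"
    using \<Phi>(1) by (auto simp: topspace_Rep hom_def)
  then have "\<exists>\<Phi>. \<Phi> \<in> topspace (Rep pi1) \<and> (\<forall>i<2 * g. \<Phi> (gen i) = w i)"
    using \<Phi>(2) gen_closed by (intro exI[of _ "restrict \<Phi> (carrier pi1)"]) simp
  then have "rep_of w \<in> topspace (Rep pi1) \<and> (\<forall>i<2 * g. rep_of w (gen i) = w i)"
    unfolding rep_of_def by (rule someI_ex)
  then show "rep_of w \<in> topspace (Rep pi1)" "i < 2 * g \<Longrightarrow> rep_of w (gen i) = w i" by simp_all
qed

lemma rep_of_tuple:
  assumes "\<rho> \<in> topspace (Rep pi1)" shows "rep_of (tuple \<rho>) = \<rho>"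
proof -
  have \<rho>: "\<rho> \<in> hom pi1 Homeo_plus" "\<rho> \<in> extensional (carrier pi1)" using assms by (auto simp: topspace_Rep)
  note t = rep_of[OF surface_rep_tuple[OF \<rho>(1)]]
  have "rep_of (tuple \<rho>) \<in> hom pi1 Homeo_plus" "rep_of (tuple \<rho>) \<in> extensional (carrier pi1)"
    using t(1) by (auto simp: topspace_Rep)
  note r = this
  have gens: "rep_of (tuple \<rho>) (gen i) = \<rho> (gen i)" if i: "i < 2 * g" for i
  proof -
    have "rep_of (tuple \<rho>) (gen i) = tuple \<rho> i" by (rule t(2)[OF i])
    also have "\<dots> = \<rho> (gen i)" unfolding tuple_def by (rule if_P[OF i])
    finally show ?thesis .
  qed
  show ?thesis
  proof (rule extensionalityI[OF r(2) \<rho>(2)])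
    show "rep_of (tuple \<rho>) a = \<rho> a" if a: "a \<in> carrier pi1" for a
      by (rule hom_eqI[OF r(1) \<rho>(1) gens a])
  qed
qed

lemma tendsto_rep_of:
  assumes w0: "surface_rep g w0" and a: "a \<in> carrier pi1"
  shows "((\<lambda>w. rep_of w a x) \<longlongrightarrow> rep_of w0 a x) (at w0 within {w. surface_rep g w})"
proof -
  let ?F = "at w0 within {w. surface_rep g w}"
  have ev: "eventually (\<lambda>w. surface_rep g w) ?F" by (simp add: eventually_at_filter)
  have gh: "group_hom pi1 Homeo_plus (rep_of w)" if "surface_rep g w" for w
    using rep_of(1)[OF that] group_pi1 group_Homeo_plus by (simp add: group_hom_def group_hom_axioms_def topspace_Rep)
  have H: "eventually (\<lambda>w. rep_of w b \<in> Homeos) ?F" if "b \<in> carrier pi1" for b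
    using ev by eventually_elim (rule group_hom.hom_closed[OF gh that])
  have H0: "rep_of w0 b \<in> Homeos" if "b \<in> carrier pi1" for b using that by (rule group_hom.hom_closed[OF gh[OF w0]])
  interpret group pi1 by (rule group_pi1)
  have "subgroup {b \<in> carrier pi1. \<forall>x. ((\<lambda>w. rep_of w b x) \<longlongrightarrow> rep_of w0 b x) ?F} pi1" (is "subgroup ?B pi1")
  proof (rule subgroupI)
    have "((\<lambda>w. rep_of w \<one>\<^bsub>pi1\<^esub> x) \<longlongrightarrow> rep_of w0 \<one>\<^bsub>pi1\<^esub> x) ?F" for x
    proof (rule tendsto_eventually)
      show "eventually (\<lambda>w. rep_of w \<one>\<^bsub>pi1\<^esub> x = rep_of w0 \<one>\<^bsub>pi1\<^esub> x) ?F"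
        using ev by eventually_elim (simp add: group_hom.hom_one[OF gh] w0)
    qed
    then have "\<one>\<^bsub>pi1\<^esub> \<in> ?B" by simp
    then show "?B \<noteq> {}" by blast
    fix b assume b: "b \<in> ?B"
    have "((\<lambda>w. rep_of w (m_inv pi1 b) x) \<longlongrightarrow> rep_of w0 (m_inv pi1 b) x) ?F" for x
    proof -
      have i: "rep_of w (m_inv pi1 b) = inv (rep_of w b)" if "surface_rep g w" for w
        using group_hom.hom_inv[OF gh[OF that], of b] group_hom.hom_closed[OF gh[OF that], of b] b m_inv_Homeo_plus by auto
      have "((\<lambda>w. inv (rep_of w b) x) \<longlongrightarrow> inv (rep_of w0 b) x) ?F"
        by (rule tendsto_Homeos_inv) (use b H H0 in auto)
      then show ?thesis unfolding i[OF w0]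
        by (rule Lim_transform_eventually) (use ev in eventually_elim, simp add: i)
    qed
    then show "m_inv pi1 b \<in> ?B" using b by simp
    fix c assume c: "c \<in> ?B"
    have "((\<lambda>w. rep_of w (b \<otimes>\<^bsub>pi1\<^esub> c) x) \<longlongrightarrow> rep_of w0 (b \<otimes>\<^bsub>pi1\<^esub> c) x) ?F" for x
    proof -
      have m: "rep_of w (b \<otimes>\<^bsub>pi1\<^esub> c) x = rep_of w b (rep_of w c x)" if "surface_rep g w" for w
        using group_hom.hom_mult[OF gh[OF that], of b c] b c by simp
      have "((\<lambda>w. rep_of w b (rep_of w c x)) \<longlongrightarrow> rep_of w0 b (rep_of w0 c x)) ?F"
        by (rule tendsto_Homeos_apply) (use b c H H0 in auto)
      then show ?thesis unfolding m[OF w0]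
        by (rule Lim_transform_eventually) (use ev in eventually_elim, simp add: m)
    qed
    then show "b \<otimes>\<^bsub>pi1\<^esub> c \<in> ?B" using b c by simp
  qed auto
  moreover have "gen i \<in> ?B" if i: "i < 2 * g" for i
  proof -
    have "((\<lambda>w. w i x) \<longlongrightarrow> w0 i x) ?F" for x
      by (rule tendsto_fun_component[OF tendsto_fun_component[OF tendsto_ident_at]])
    then have "((\<lambda>w. rep_of w (gen i) x) \<longlongrightarrow> rep_of w0 (gen i) x) ?F" for x
      unfolding rep_of(2)[OF w0 i]
      by (rule Lim_transform_eventually) (use ev in eventually_elim, simp add: rep_of i)
    then show ?thesis using gen_closed[OF i] by simp
  qed
  ultimately show ?thesis using gens_generate a by blast
qed

lemma continuous_rep_of: "continuous_map (top_of_set {w. surface_rep g w}) (Rep pi1) rep_of"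
proof -
  let ?S = "{w. surface_rep g w}"
  have hom: "rep_of w \<in> hom pi1 Homeo_plus" "rep_of w \<in> extensional (carrier pi1)" if "surface_rep g w" for w
    using rep_of(1)[OF that] by (auto simp: topspace_Rep)
  have Hom: "rep_of w a \<in> Homeos" if "surface_rep g w" "a \<in> carrier pi1" for w a
    using hom(1)[OF that(1)] that(2) by (auto simp: hom_def)
  have "continuous_map (top_of_set ?S) compact_open_Homeo_plus (\<lambda>w. rep_of w a)" if a: "a \<in> carrier pi1" for a
    unfolding compact_open_Homeo_plus_def
  proof (rule continuous_on_generated_topo)
    fix \<U> assume "\<U> \<in> {{f \<in> Homeos. f ` K \<subseteq> U} | K U. compact K \<and> open U}"
    then obtain K U where KU: "compact K" "open U" "\<U> = {f \<in> Homeos. f ` K \<subseteq> U}" by blast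
    show "openin (top_of_set ?S) ((\<lambda>w. rep_of w a) -` \<U> \<inter> topspace (top_of_set ?S))"
    proof (rule openin_top_of_setI)
      fix w0 assume "w0 \<in> (\<lambda>w. rep_of w a) -` \<U> \<inter> topspace (top_of_set ?S)"
      then have w0: "surface_rep g w0" "rep_of w0 a ` K \<subseteq> U" by (auto simp: KU(3))
      have ev: "eventually (\<lambda>w. surface_rep g w) (at w0 within ?S)" by (simp add: eventually_at_filter)
      then have "eventually (\<lambda>w. rep_of w a \<in> Homeos) (at w0 within ?S)" by eventually_elim (rule Hom[OF _ a])
      from eventually_compact_image_subset[OF tendsto_rep_of[OF w0(1) a] this Hom[OF w0(1) a] KU(1,2) w0(2)] ev
      show "eventually (\<lambda>w. w \<in> (\<lambda>w. rep_of w a) -` \<U> \<inter> topspace (top_of_set ?S)) (at w0 within ?S)"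
        by eventually_elim (simp add: KU(3) Hom a)
    qed auto
  next
    show "(\<lambda>w. rep_of w a) ` topspace (top_of_set ?S) \<subseteq> \<Union> {{f \<in> Homeos. f ` K \<subseteq> U} | K U. compact K \<and> open U}"
    proof (rule image_subsetI)
      fix w assume "w \<in> topspace (top_of_set ?S)"
      then have "rep_of w a \<in> {f \<in> Homeos. f ` {} \<subseteq> UNIV}" using Hom a by simp
      then show "rep_of w a \<in> \<Union> {{f \<in> Homeos. f ` K \<subseteq> U} | K U. compact K \<and> open U}"
        by (rule UnionI[rotated]) (use compact_empty open_UNIV in blast)
    qed
  qed
  then show ?thesis
    unfolding Rep_def continuous_map_in_subtopology continuous_map_componentwise using hom by auto
qed

lemma dense_conjugacy_class:
  assumes g: "g \<ge> 2"
  shows "\<exists>\<theta> \<in> topspace (Rep pi1). (\<nexists>x. global_fixed_point pi1 \<theta> x) \<and>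
           Rep pi1 closure_of conjugacy_class pi1 \<theta> = topspace (Rep pi1)"
proof -
  let ?S = "{w. surface_rep g w}"
  obtain t where t: "surface_rep g t" "fixed t = {}" "?S \<subseteq> closure (conjugates t)"
    using surface_rep_dense_conjugates[OF g] by blast
  let ?\<theta> = "rep_of t"
  note \<theta> = rep_of[OF t(1)]
  have \<theta>_hom: "?\<theta> \<in> hom pi1 Homeo_plus" using \<theta>(1) by (simp add: topspace_Rep)
  interpret \<theta>: group_hom pi1 Homeo_plus ?\<theta>
    using \<theta>_hom group_pi1 group_Homeo_plus by (simp add: group_hom_def group_hom_axioms_def)
  have nofix: "\<not> global_fixed_point pi1 ?\<theta> x" for x
  proof
    assume fp: "global_fixed_point pi1 ?\<theta> x"
    have "t i x = x" for i
    proof (cases "i < 2 * g")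
      case True
      then show ?thesis using fp \<theta>(2) gen_closed unfolding global_fixed_point_def by metis
    qed (simp add: surface_repD(2)[OF t(1)])
    then show False using t(2) by (auto simp: fixed_def)
  qed
  have conj: "surface_rep g w \<and> rep_of w \<in> conjugacy_class pi1 ?\<theta>" if w: "w \<in> conjugates t" for w
  proof -
    obtain \<psi> where \<psi>: "\<psi> \<in> Homeos" "w = (\<lambda>j. \<psi> \<circ> t j \<circ> inv \<psi>)" using w by (auto simp: conjugates_def)
    define \<rho> where "\<rho> = (\<lambda>a\<in>carrier pi1. \<psi> \<circ> ?\<theta> a \<circ> inv_into UNIV \<psi>)"
    have "\<rho> \<in> hom pi1 Homeo_plus"
      using \<psi>(1) by (intro homI) (auto simp: \<rho>_def fun_eq_iff)
    then have \<rho>: "\<rho> \<in> topspace (Rep pi1)" by (simp add: topspace_Rep \<rho>_def)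
    have "tuple \<rho> i = w i" for i
      using \<theta>(2) gen_closed \<psi> surface_repD(2)[OF t(1), of i] by (auto simp: tuple_def \<rho>_def fun_eq_iff)
    then have "tuple \<rho> = w" by blast
    then show ?thesis
      using surface_rep_tuple[of \<rho>] rep_of_tuple[OF \<rho>] \<rho> \<psi>(1) by (auto simp: topspace_Rep conjugacy_class_def \<rho>_def)
  qed
  have "topspace (Rep pi1) \<subseteq> rep_of ` ?S"
  proof
    fix \<rho> assume \<rho>: "\<rho> \<in> topspace (Rep pi1)"
    then have "surface_rep g (tuple \<rho>)" by (intro surface_rep_tuple) (simp add: topspace_Rep)
    then show "\<rho> \<in> rep_of ` ?S" using rep_of_tuple[OF \<rho>] by (metis image_eqI mem_Collect_eq)
  qed
  also have "?S = top_of_set ?S closure_of conjugates t"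
  proof -
    have "?S \<inter> conjugates t = conjugates t" using conj by blast
    then show ?thesis using t(3) by (auto simp: closure_of_subtopology)
  qed
  also have "rep_of ` (top_of_set ?S closure_of conjugates t) \<subseteq> Rep pi1 closure_of (rep_of ` conjugates t)"
    by (rule continuous_map_image_closure_subset[OF continuous_rep_of])
  also have "\<dots> \<subseteq> Rep pi1 closure_of conjugacy_class pi1 ?\<theta>"
    using conj by (intro closure_of_mono) blast
  finally have "Rep pi1 closure_of conjugacy_class pi1 ?\<theta> = topspace (Rep pi1)"
    by (intro equalityI closure_of_subset_topspace)
  then show ?thesis using \<theta>(1) nofix by (intro bexI[of _ ?\<theta>] conjI) simp_all
qed

end

theorem theorem1p4:
  fixes \<Sigma> :: "'a topology" and g :: nat and x\<^sub>0 :: 'a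
  assumes "closed_orientable_surface g \<Sigma>"
    and "g \<ge> 2"
    and "x\<^sub>0 \<in> topspace \<Sigma>"
  shows "\<exists>\<theta> \<in> topspace (Rep (fundamental_group \<Sigma> x\<^sub>0)).
           (\<nexists>x. global_fixed_point (fundamental_group \<Sigma> x\<^sub>0) \<theta> x) \<and>
           Rep (fundamental_group \<Sigma> x\<^sub>0) closure_of
               conjugacy_class (fundamental_group \<Sigma> x\<^sub>0) \<theta>
             = topspace (Rep (fundamental_group \<Sigma> x\<^sub>0))"
proof -
  obtain q where q: "quotient_map (top_of_set (cball 0 1)) \<Sigma> q"
    "\<forall>z\<in>cball 0 1. \<forall>w\<in>cball 0 1. q z = q w \<longleftrightarrow> equivclp (side_pairing g) z w"
    using assms(1) unfolding closed_orientable_surface_def by (elim exE conjE) (rule that)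
  have "x\<^sub>0 \<in> q ` cball 0 1"
    using quotient_imp_surjective_map[OF q(1)] assms(3) by simp
  then obtain z0 where z0: "z0 \<in> cball 0 1" "q z0 = x\<^sub>0"
    by (elim imageE) (rule that, auto)
  have "based_polygon g \<Sigma> q z0"
  proof
    show g: "g \<ge> 1" using assms(2) by simp
    show "q z = q w \<longleftrightarrow> glued g z w" if "z \<in> cball 0 1" "w \<in> cball 0 1" for z w
      using q(2)[rule_format, OF that] unfolding glued_iff_equivclp[OF g] .
  qed (fact q(1) z0(1))+
  from based_polygon.dense_conjugacy_class[OF this assms(2)] show ?thesis unfolding z0(2) .
qed


end
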